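(* Let $p\in(0,\infty)$ and $\nu>-1$. Let $F$ be an entire function of exponential type at most $2$ such that $$\int_{|t|\ge1}\big|F(t)|t|^{2\nu+1}\big|^p\,dt<\infty.$$ Then $$\frac{F(z)}{A_\nu(z)^2}=\sum_{A_\nu(s)=0}\Big\{\frac{F(s)}{A_\nu'(s)^2(z-s)^2}+\frac{F'(s)}{A_\nu'(s)^2(z-s)}\Big\}+(2\nu+1)\sum_{A_\nu(s)=0}\frac{F(s)}{sA_\nu'(s)^2(z-s)}$$ and $$\frac{F(z)}{B_\nu(z)^2}=\sum_{B_\nu(t)=0}\Big\{\frac{F(t)}{B_\nu'(t)^2(z-t)^2}+\frac{F'(t)}{B_\nu'(t)^2(z-t)}\Big\}+(2\nu+1)\sum_{B_\nu(t)=0,\ t\ne0}\frac{F(t)}{tB_\nu'(t)^2(z-t)},$$ where the series converge uniformly on compact subsets of $\mathbb{C}$ away from their respective singularities.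
   Context: For $\nu>-1$, $A_\nu(z)=\sum_{n\ge0}\frac{(-1)^n(z/2)^{2n}}{n!(\nu+1)(\nu+2)\cdots(\nu+n)}=\Gamma(\nu+1)(z/2)^{-\nu}J_\nu(z)$ and $B_\nu(z)=\sum_{n\ge0}\frac{(-1)^n(z/2)^{2n+1}}{n!(\nu+1)(\nu+2)\cdots(\nu+n+1)}=\Gamma(\nu+1)(z/2)^{-\nu}J_{\nu+1}(z)$, where $J_\nu$ is the Bessel function of the first kind. Sums are over the (real) zeros of $A_\nu$, resp. $B_\nu$. An entire $F$ has exponential type at most $\tau$ if $\limsup_{|z|\to\infty}|z|^{-1}\log|F(z)|\le\tau$. *)

theory Defs
  imports "HOL-Analysis.Analysis"
begin

definition Abes :: "real \<Rightarrow> complex \<Rightarrow> complex" where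
  "Abes nu z = (\<Sum>n. (-1)^n * (z/2)^(2*n) / of_real (fact n * pochhammer (nu+1) n))"

definition Bbes :: "real \<Rightarrow> complex \<Rightarrow> complex" where
  "Bbes nu z = (\<Sum>n. (-1)^n * (z/2)^(2*n+1) / of_real (fact n * pochhammer (nu+1) (n+1)))"

definition exp_type_le :: "(complex \<Rightarrow> complex) \<Rightarrow> real \<Rightarrow> bool" where
  "exp_type_le F tau \<longleftrightarrow>
     Limsup at_infinity (\<lambda>z. ereal (ln (norm (F z)) / norm z)) \<le> ereal tau"

end

theory Submission
  imports Defs "HOL-Complex_Analysis.Complex_Analysis" "HOL-Real_Asymp.Real_Asymp"
begin

text \<open>
  Let \<open>G(w) = F(w) (w + \<i>)\<^bsup>2\<nu>+1\<^esup> e\<^bsup>2\<i>w\<^esup>\<close>, which is \<open>p\<close>-integrable on the real line. The Poisson integral of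
  \<open>log (1 + |\<lambda>G|\<^sup>p) / p\<close> majorises \<open>log |\<lambda>G|\<close> in the upper half-plane and tends to \<open>0\<close> along \<open>Im w = 1\<close>; as
  \<open>\<lambda>\<close> is arbitrary, \<open>G \<rightarrow> 0\<close> on that line. This works for every \<open>p > 0\<close>. Phragmen--Lindeloef in the half-planes
  bounded by \<open>Im w = \<plusminus>1\<close> then gives \<open>F(w) = o(|w|\<^bsup>-2\<nu>-1\<^esup> e\<^bsup>2|Im w|\<^esup>)\<close>.

  Since \<open>A' = -B\<close> and \<open>B' = A - (2\<nu>+1)B/z\<close>, the zeros of both functions are real and simple, \<open>A\<^sup>2 + B\<^sup>2\<close> is of
  exact order \<open>x\<^bsup>-2\<nu>-1\<^esup>\<close> on the real line, and on circles \<open>|w| = R\<close> through points where \<open>A\<close> (or \<open>B\<close>) is not small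
  \<open>|A(w)|\<^sup>2\<close> is at least a constant times \<open>|w|\<^bsup>-2\<nu>-1\<^esup> e\<^bsup>2|Im w|\<^esup>\<close>. So \<open>F/A\<^sup>2 = o(1)\<close> on these circles, and the residue
  theorem for \<open>F(w)/(A(w)\<^sup>2(w - z))\<close> gives the expansion; the second sum converges absolutely because
  \<open>F(s)/A'(s)\<^sup>2\<close> is bounded and the zeros are separated.
\<close>

section \<open>Phragmen--Lindeloef principles\<close>

text \<open>Integrability gives no pointwise bound on the real axis itself, so decay is obtained one
  unit away from it. Applied to \<open>F (w)\<close> and \<open>F (- w)\<close> this covers the
  lines Im w = 1 and Im w = -1; the half-planes bounded by them overlap, so the real axis is covered
  too. The factor e^(2iw) makes the growth along the imaginary axis subexponential, which is what
  excludes functions such as e^(-iw) from Phragmen-Lindeloef. The lower bound on circles uses no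
  asymptotic expansion: |u(R)| at a good real point R is carried along chords. The term with
  2\<nu>+1 is the part E''/E'^3 of the residue, since E'' = -(2\<nu>+1) E'/s at every zero s
  \<noteq> 0 of either function. The delicate point is the first series: its terms are only shown to
  be o(1), so it is never summed by itself. The combined sum converges along good radii by residues,
  and along all radii because an annulus of width 2 holds boundedly many zeros. The first series is
  then the combined sum minus the absolutely convergent second one, in the order of increasing
  |s|.\<close>

lemma maximum_modulus_limsup_frontier:
  fixes f :: "complex \<Rightarrow> complex"
  assumes S: "open S" "connected S" "bounded S" and f: "f holomorphic_on S"
    and bd: "\<And>x e. x \<in> frontier S \<Longrightarrow> 0 < e \<Longrightarrow> \<forall>\<^sub>F w in at x within S. norm (f w) \<le> M + e"
    and w: "w \<in> S"
  shows "norm (f w) \<le> M"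
proof (rule ccontr)
  assume "\<not> norm (f w) \<le> M"
  then obtain e where e: "0 < e" "M + 2 * e < norm (f w)"
    by (intro that[of "(norm (f w) - M) / 3"]) (auto simp: field_simps)
  \<comment> \<open>Superlevel set of |f|. It is closed in the plane, since |f| < M + 2e near every
    frontier point, so the maximum over it is attained inside \<open>S\<close> although
    \<open>f\<close> has no boundary values.\<close>
  define K where "K = {z \<in> S. M + 2 * e \<le> norm (f z)}"
  have near: "\<exists>d>0. \<forall>z\<in>S. dist z x < d \<longrightarrow> norm (f z) < M + 2 * e" if x: "x \<in> frontier S" for x
  proof -
    have xS: "x \<notin> S" using x S(1) by (simp add: frontier_def interior_open)
    obtain d where "d > 0" "\<forall>z\<in>S. z \<noteq> x \<and> dist z x < d \<longrightarrow> norm (f z) \<le> M + e"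
      using bd[OF x e(1)] unfolding eventually_at by auto
    then show ?thesis using xS e by (intro exI[of _ d]) force
  qed
  have "closed K"
    unfolding closed_sequential_limits
  proof (intro allI impI, elim conjE)
    fix z l assume z: "\<forall>n. z n \<in> K" and l: "z \<longlonglongrightarrow> l"
    have "l \<in> closure S"
      unfolding closure_sequential using z l by (auto simp: K_def)
    have "l \<notin> frontier S"
    proof
      assume "l \<in> frontier S"
      then obtain d where d: "d > 0" "\<forall>z\<in>S. dist z l < d \<longrightarrow> norm (f z) < M + 2 * e"
        using near by blast
      have "eventually (\<lambda>n. dist (z n) l < d) sequentially"
        using l d(1) by (simp add: tendsto_iff)
      then obtain n where "dist (z n) l < d"
        using eventually_sequentially by auto
      then show False using d(2) z by (auto simp: K_def) (metis not_le)
    qed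
    then have lS: "l \<in> S"
      using \<open>l \<in> closure S\<close> S(1) by (simp add: frontier_def interior_open)
    have "isCont f l"
      using f S(1) lS holomorphic_on_imp_continuous_on continuous_on_eq_continuous_at by blast
    then have "(\<lambda>n. norm (f (z n))) \<longlonglongrightarrow> norm (f l)"
      using isCont_tendsto_compose[OF _ l, of f] by (intro tendsto_norm)
    then have "M + 2 * e \<le> norm (f l)"
      using z by (intro LIMSEQ_le_const) (auto simp: K_def)
    then show "l \<in> K" using lS by (simp add: K_def)
  qed
  moreover have "bounded K" using S(3) by (rule bounded_subset) (auto simp: K_def)
  ultimately have "compact K" by (simp add: compact_eq_bounded_closed)
  moreover have "w \<in> K" using w e by (simp add: K_def)
  moreover have "continuous_on K (\<lambda>z. norm (f z))"
    using f by (intro continuous_on_norm continuous_on_subset[OF holomorphic_on_imp_continuous_on[OF f]])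
      (auto simp: K_def)
  ultimately obtain v where v: "v \<in> K" "\<forall>z\<in>K. norm (f z) \<le> norm (f v)"
    using continuous_attains_sup[of K "\<lambda>z. norm (f z)"] by blast
  have "f constant_on S"
  proof (rule maximum_modulus_principle[OF f S(1,2) S(1) order_refl])
    show "v \<in> S" using v by (simp add: K_def)
    show "norm (f z) \<le> norm (f v)" if "z \<in> S" for z
      using v that by (cases "z \<in> K") (auto simp: K_def)
  qed
  then obtain c where c: "\<And>z. z \<in> S \<Longrightarrow> f z = c" by (auto simp: constant_on_def)
  have "frontier S \<noteq> {}"
    using S w frontier_eq_empty[of S] by auto
  then obtain x where x: "x \<in> frontier S" by blast
  then obtain d where d: "d > 0" "\<forall>z\<in>S. dist z x < d \<longrightarrow> norm (f z) < M + 2 * e"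
    using near by blast
  have "x \<in> closure S" using x by (simp add: frontier_def)
  then obtain z where "z \<in> S" "dist z x < d"
    using closure_approachable d(1) by blast
  then show False using d c w e by force
qed

text \<open>The factor exp (- d k) has modulus at most 1 on \<open>S\<close> and makes
  \<open>f\<close> small far out, so the maximum principle applies on \<open>S\<close> cut by a
  large ball; then d tends to 0. The choice of \<open>k\<close> adapts this to a region and a growth
  class.\<close>

lemma phragmen_lindeloef_multiplier:
  fixes f k :: "complex \<Rightarrow> complex"
  assumes S: "open S" "convex S" and f: "f holomorphic_on S" and k: "k holomorphic_on S"
    and kpos: "\<And>w. w \<in> S \<Longrightarrow> 0 \<le> Re (k w)"
    and M: "0 \<le> M"
    and bd: "\<And>x e. x \<in> frontier S \<Longrightarrow> 0 < e \<Longrightarrow> \<forall>\<^sub>F w in at x within S. norm (f w) \<le> M + e"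
    and inf: "\<And>d e. 0 < d \<Longrightarrow> 0 < e \<Longrightarrow>
                \<exists>r. \<forall>w\<in>S. r \<le> norm w \<longrightarrow> norm (f w) * exp (- d * Re (k w)) \<le> e"
    and w: "w \<in> S"
  shows "norm (f w) \<le> M"
proof -
  have main: "norm (f w) * exp (- d * Re (k w)) \<le> M + e" if de: "0 < d" "0 < e" for d e
  proof -
    obtain r where r: "\<And>w. w \<in> S \<Longrightarrow> r \<le> norm w \<Longrightarrow> norm (f w) * exp (- d * Re (k w)) \<le> e"
      using inf[OF de] by blast
    \<comment> \<open>The extra 1 leaves room: points within distance 1 of the sphere of radius
      \<open>R\<close> still have norm at least \<open>r\<close>.\<close>
    define R where "R = \<bar>r\<bar> + norm w + 1"
    let ?g = "\<lambda>w. f w * exp (- of_real d * k w)"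
    let ?S = "S \<inter> ball 0 R"
    have ng: "norm (?g z) = norm (f z) * exp (- d * Re (k z))" for z
      by (simp add: norm_mult)
    have "norm (?g w) \<le> M + e"
    proof (rule maximum_modulus_limsup_frontier[of ?S ?g])
      show "open ?S" "bounded ?S" "connected ?S"
        using S by (auto intro: convex_connected convex_Int)
      show "?g holomorphic_on ?S"
        by (intro holomorphic_intros holomorphic_on_subset[OF f] holomorphic_on_subset[OF k]) auto
      show "w \<in> ?S" using w by (simp add: R_def)
      fix x e' assume x: "x \<in> frontier ?S" and e': "(0::real) < e'"
      show "\<forall>\<^sub>F z in at x within ?S. norm (?g z) \<le> M + e + e'"
      proof (cases "x \<in> frontier S")
        case True
        have "\<forall>\<^sub>F z in at x within ?S. norm (f z) \<le> M + e'"
          using bd[OF True e'] by (auto intro: filter_leD[OF at_le])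
        moreover have "\<forall>\<^sub>F z in at x within ?S. z \<in> S"
          by (auto simp: eventually_at_filter)
        ultimately show ?thesis
        proof eventually_elim
          case (elim z)
          have "exp (- d * Re (k z)) \<le> 1" using kpos[OF elim(2)] de by simp
          then have "norm (?g z) \<le> norm (f z)" unfolding ng by (simp add: mult_left_le)
          then show ?case using elim de by simp
        qed
      next
        case False
        have "x \<in> frontier (ball 0 R)"
          using x False frontier_Int_subset[of S "ball 0 R"] by auto
        moreover have "R > 0" by (simp add: R_def add_nonneg_pos)
        ultimately have "norm x = R" by simp
        have "\<forall>\<^sub>F z in at x within ?S. dist z x < 1"
          by (auto simp: eventually_at intro: exI[of _ 1])
        moreover have "\<forall>\<^sub>F z in at x within ?S. z \<in> S"
          by (auto simp: eventually_at_filter)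
        ultimately show ?thesis
        proof eventually_elim
          case (elim z)
          have "norm x \<le> norm z + dist z x"
            by (metis dist_norm norm_minus_commute norm_triangle_sub)
          then have "r \<le> norm z" using elim \<open>norm x = R\<close> norm_ge_zero[of w] unfolding R_def by linarith
          then have "norm (?g z) \<le> e" unfolding ng using r elim by blast
          then show ?case using M e' by linarith
        qed
      qed
    qed
    then show ?thesis unfolding ng .
  qed
  \<comment> \<open>The same parameter serves as damping rate and as slack, so a single one-sided
    limit removes both.\<close>
  have "norm (f w) * exp (- 0 * Re (k w)) \<le> M + 0"
  proof (rule tendsto_le[of "at_right 0"])
    show "((\<lambda>d. norm (f w) * exp (- d * Re (k w))) \<longlongrightarrow> norm (f w) * exp (- 0 * Re (k w))) (at_right 0)"
      by (intro tendsto_intros)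
    show "((\<lambda>d::real. M + d) \<longlongrightarrow> M + 0) (at_right 0)" by (intro tendsto_intros)
    show "\<forall>\<^sub>F d in at_right 0. norm (f w) * exp (- d * Re (k w)) \<le> M + d"
      using main eventually_at_right_less[of "0::real"] by (auto elim: eventually_mono)
  qed auto
  then show ?thesis by simp
qed

text \<open>In the sector of half-angle pi/4 the power z^(3/2) has argument at most 3 pi / 8, so its
  real part is comparable to its modulus. With sqrt z = x + iy the sector condition forces 2|y| <=
  x; the constant 1/8 is crude, as cos (3 pi / 8) is about 0.38.\<close>

lemma Re_csqrt_cubed_ge:
  assumes "\<bar>Im z\<bar> \<le> Re z"
  shows "norm z * sqrt (norm z) / 8 \<le> Re (csqrt z ^ 3)"
proof -
  define x y where "x = Re (csqrt z)" and "y = \<bar>Im (csqrt z)\<bar>"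
  have x0: "x \<ge> 0" unfolding x_def using csqrt_principal[of z] by auto
  have sq: "csqrt z ^ 2 = z" by simp
  have re: "Re z = x\<^sup>2 - y\<^sup>2"
    by (subst sq[symmetric]) (simp add: x_def y_def power2_eq_square)
  have im: "\<bar>Im z\<bar> = 2 * x * y"
    by (subst sq[symmetric]) (use x0 in \<open>simp add: x_def y_def power2_eq_square abs_mult\<close>)
  have y0: "y \<ge> 0" by (simp add: y_def)
  have h: "2 * x * y \<le> x\<^sup>2 - y\<^sup>2" using assms re im by simp
  have xy: "2 * y \<le> x"
  proof (rule ccontr)
    assume "\<not> 2 * y \<le> x"
    then have "x * x \<le> x * (2 * y)" "0 < y" using x0 by (auto intro: mult_left_mono)
    moreover have "0 < y\<^sup>2" using \<open>0 < y\<close> by simp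
    moreover have "2 * x * y = x * (2 * y)" by simp
    ultimately show False using h unfolding power2_eq_square by linarith
  qed
  have y2: "4 * y\<^sup>2 \<le> x\<^sup>2"
    using power_mono[OF xy, of 2] y0 by (simp add: power_mult_distrib)
  have nz: "norm (csqrt z) ^ 2 = x\<^sup>2 + y\<^sup>2"
    unfolding cmod_power2 x_def y_def by (simp only: power2_abs)
  have nz': "norm z = x\<^sup>2 + y\<^sup>2"
    by (metis nz norm_power sq)
  have sl: "sqrt (norm z) \<le> 2 * x * (sqrt 5 / 4)"
  proof (rule real_le_lsqrt)
    show "norm z \<le> (2 * x * (sqrt 5 / 4))\<^sup>2"
      unfolding nz' using y2 by (simp add: power_mult_distrib power_divide)
  qed (use x0 in auto)
  have "sqrt 5 \<le> 12/5" by (rule real_le_lsqrt) (auto simp: power2_eq_square)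
  then have sl': "sqrt (norm z) \<le> 6/5 * x"
    using mult_left_mono[of "sqrt 5" "12/5" x] x0 sl by simp
  have "norm z * sqrt (norm z) \<le> (5/4 * x\<^sup>2) * (6/5 * x)"
    using y2 x0 sl' by (intro mult_mono) (auto simp: nz')
  also have "\<dots> / 8 \<le> x * (x\<^sup>2 / 4)" using x0 by (simp add: power2_eq_square)
  also have "\<dots> \<le> x * (x\<^sup>2 - 3 * y\<^sup>2)" using y2 x0 by (intro mult_left_mono) auto
  also have "\<dots> = Re (csqrt z ^ 3)"
    by (simp add: x_def y_def power3_eq_cube power2_eq_square algebra_simps del: csqrt.simps)
  finally show ?thesis by simp
qed

lemma not_nonpos_Reals_Re: "0 < Re z \<Longrightarrow> z \<notin> \<real>\<^sub>\<le>\<^sub>0"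
  by (auto simp: complex_nonpos_Reals_iff)

text \<open>A sector of opening pi/2 tolerates growth of any order below 2. The multiplier has order
  3/2, strictly between the order 1 of the growth bound and 2.\<close>

lemma phragmen_lindeloef_quadrant:
  fixes f :: "complex \<Rightarrow> complex"
  defines "Q \<equiv> {w. 0 < Re w \<and> 0 < Im w}"
  assumes f: "f holomorphic_on Q" and M: "0 \<le> M"
    and bd: "\<And>x e. x \<in> frontier Q \<Longrightarrow> 0 < e \<Longrightarrow> \<forall>\<^sub>F w in at x within Q. norm (f w) \<le> M + e"
    and gr: "\<And>w. w \<in> Q \<Longrightarrow> norm (f w) \<le> C * exp (B * norm w)"
    and w: "w \<in> Q"
  shows "norm (f w) \<le> M"
proof -
  \<comment> \<open>Multiplication by 1 - i rotates by -pi/4 and places the quadrant in the sector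
    of \<open>Re_csqrt_cubed_ge\<close>; the shift keeps the real part above 2.\<close>
  define m where "m z = (z + 1 + \<i>) * (1 - \<i>)" for z
  have mR: "Re (m z) = Re z + Im z + 2" and mI: "Im (m z) = Im z - Re z" for z
    by (auto simp: m_def)
  have mQ: "\<bar>Im (m z)\<bar> \<le> Re (m z)" "0 < Re (m z)" "norm z \<le> norm (m z)" if "z \<in> Q" for z
  proof -
    show "\<bar>Im (m z)\<bar> \<le> Re (m z)" "0 < Re (m z)" using that by (auto simp: mR mI Q_def)
    have "norm z \<le> \<bar>Re z\<bar> + \<bar>Im z\<bar>" by (rule cmod_le)
    also have "\<dots> \<le> Re (m z)" using that by (simp add: mR Q_def)
    also have "\<dots> \<le> norm (m z)" by (rule complex_Re_le_cmod)
    finally show "norm z \<le> norm (m z)" .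
  qed
  have kl: "norm z * sqrt (norm z) / 8 \<le> Re (csqrt (m z) ^ 3)" if "z \<in> Q" for z
  proof -
    have "norm z * sqrt (norm z) \<le> norm (m z) * sqrt (norm (m z))"
      using mQ[OF that] by (intro mult_mono) auto
    then show ?thesis using Re_csqrt_cubed_ge[OF mQ(1)[OF that]] by linarith
  qed
  show ?thesis
  proof (rule phragmen_lindeloef_multiplier[where S = Q and k = "\<lambda>z. csqrt (m z) ^ 3", OF _ _ f _ _ M bd _ w])
    have "Q = {w. Re w > 0} \<inter> {w. Im w > 0}" by (auto simp: Q_def)
    then show "open Q" "convex Q"
      by (auto intro!: open_Int open_halfspace_Re_gt open_halfspace_Im_gt convex_Int convex_halfspace_Re_gt convex_halfspace_Im_gt)
    show "(\<lambda>z. csqrt (m z) ^ 3) holomorphic_on Q"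
      using mQ(2) not_nonpos_Reals_Re by (auto intro!: holomorphic_intros simp: m_def)
    show "0 \<le> Re (csqrt (m z) ^ 3)" if "z \<in> Q" for z
      using kl[OF that] by (smt (verit) divide_nonneg_pos mult_nonneg_nonneg norm_ge_zero real_sqrt_ge_zero)
    fix d e :: real assume de: "0 < d" "0 < e"
    \<comment> \<open>The square makes d |z|^(3/2) / 8 at least (|B| + 1) |z|, which leaves a factor
      exp (- |z|); the logarithm makes that factor at most e / (|C| + 1).\<close>
    define r where "r = max (max 0 ((8 * (\<bar>B\<bar> + 1) / d)\<^sup>2)) (ln ((\<bar>C\<bar> + 1) / e))"
    show "\<exists>r. \<forall>w\<in>Q. r \<le> norm w \<longrightarrow> norm (f w) * exp (- d * Re (csqrt (m w) ^ 3)) \<le> e"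
    proof (intro exI[of _ r] ballI impI)
      fix z assume z: "z \<in> Q" "r \<le> norm z"
      have "8 * (\<bar>B\<bar> + 1) / d \<le> sqrt (norm z)"
        using z(2) de by (intro real_le_rsqrt) (auto simp: r_def)
      then have "(\<bar>B\<bar> + 1) \<le> d * sqrt (norm z) / 8" using de by (simp add: field_simps)
      then have "norm z * (\<bar>B\<bar> + 1) \<le> norm z * (d * sqrt (norm z) / 8)"
        by (intro mult_left_mono) auto
      also have "\<dots> \<le> d * Re (csqrt (m z) ^ 3)"
        using mult_left_mono[OF kl[OF z(1)], of d] de by (simp add: mult_ac)
      finally have 1: "norm z * \<bar>B\<bar> + norm z \<le> d * Re (csqrt (m z) ^ 3)" by (simp add: algebra_simps)
      have "norm (f z) * exp (- d * Re (csqrt (m z) ^ 3)) \<le>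
            ((\<bar>C\<bar> + 1) * exp (\<bar>B\<bar> * norm z)) * exp (- (norm z * \<bar>B\<bar> + norm z))"
      proof (intro mult_mono)
        have "C * exp (B * norm z) \<le> (\<bar>C\<bar> + 1) * exp (\<bar>B\<bar> * norm z)"
          by (intro mult_mono) (auto intro: mult_right_mono)
        then show "norm (f z) \<le> (\<bar>C\<bar> + 1) * exp (\<bar>B\<bar> * norm z)" using gr[OF z(1)] by linarith
      qed (use 1 in auto)
      also have "\<dots> = (\<bar>C\<bar> + 1) * exp (- norm z)"
        by (simp add: mult.assoc exp_add[symmetric] mult.commute)
      also have "\<dots> \<le> (\<bar>C\<bar> + 1) * exp (- ln ((\<bar>C\<bar> + 1) / e))"
        using z(2) by (intro mult_left_mono) (auto simp: r_def)
      also have "\<dots> = e" using de by (simp add: exp_minus)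
      finally show "norm (f z) * exp (- d * Re (csqrt (m z) ^ 3)) \<le> e" .
    qed
  qed auto
qed


lemma frontier_upper_half_plane: "frontier {w. 0 < Im w} = {w. Im w = 0}"
proof -
  have "closure {w. 0 < Im w} = {w. 0 \<le> Im w}"
    using closure_halfspace_gt[of \<i> 0] by (simp add: inner_complex_def)
  moreover have "interior {w. 0 < Im w} = {w. 0 < Im w}"
    by (simp add: interior_open open_halfspace_Im_gt)
  ultimately show ?thesis by (auto simp: frontier_def)
qed

lemma frontier_quadrant:
  assumes "x \<in> frontier {w. 0 < Re w \<and> 0 < Im w}"
  shows "0 \<le> Re x" "0 \<le> Im x" "Re x = 0 \<or> Im x = 0"
proof -
  let ?Q = "{w. 0 < Re w \<and> 0 < Im w}"
  have Q: "?Q = {w. Re w > 0} \<inter> {w. Im w > 0}" by auto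
  have "open ?Q" unfolding Q by (intro open_Int open_halfspace_Re_gt open_halfspace_Im_gt)
  then have "x \<notin> ?Q" using assms by (simp add: frontier_def interior_open)
  moreover have "closed ({w. Re w \<ge> 0} \<inter> {w. Im w \<ge> 0})"
    by (intro closed_Int closed_halfspace_Re_ge closed_halfspace_Im_ge)
  then have "closure ?Q \<subseteq> {w. Re w \<ge> 0} \<inter> {w. Im w \<ge> 0}"
    by (intro closure_minimal) auto
  then show "0 \<le> Re x" "0 \<le> Im x" using assms by (auto simp: frontier_def)
  ultimately show "Re x = 0 \<or> Im x = 0" by auto
qed

text \<open>For bounded \<open>f\<close> any multiplier whose real part tends to infinity works. The
  square root of -i (z + i) does: its argument is at most pi/4 in modulus, so its squared real part
  is at least half of |z + i|.\<close>

lemma phragmen_lindeloef_half_plane_bounded: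
  fixes f :: "complex \<Rightarrow> complex"
  defines "H \<equiv> {w. 0 < Im w}"
  assumes f: "f holomorphic_on H" and M: "0 \<le> M"
    and bd: "\<And>x e. 0 < e \<Longrightarrow> \<forall>\<^sub>F w in at (of_real x) within H. norm (f w) \<le> M + e"
    and gr: "\<And>w. w \<in> H \<Longrightarrow> norm (f w) \<le> C"
    and w: "w \<in> H"
  shows "norm (f w) \<le> M"
proof -
  define m where "m z = - \<i> * (z + \<i>)" for z
  have mR: "Re (m z) = Im z + 1" for z by (simp add: m_def)
  have kl: "norm z - 1 \<le> 2 * (Re (csqrt (m z)))\<^sup>2" "0 \<le> Re (csqrt (m z))" if "z \<in> H" for z
  proof -
    define s where "s = csqrt (m z)"
    have s2: "s ^ 2 = m z" by (simp add: s_def)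
    have "Re (s ^ 2) > 0" unfolding s2 mR using that by (simp add: H_def)
    then have "(Im s)\<^sup>2 \<le> (Re s)\<^sup>2" by (simp add: power2_eq_square)
    moreover have "norm (m z) = (Re s)\<^sup>2 + (Im s)\<^sup>2"
      by (metis s2 norm_power cmod_power2)
    moreover have "norm z \<le> norm (m z) + 1"
      unfolding m_def norm_mult using norm_triangle_ineq4[of "z + \<i>" \<i>] by simp
    ultimately have "norm z - 1 \<le> 2 * (Re s)\<^sup>2" by linarith
    then show "norm z - 1 \<le> 2 * (Re (csqrt (m z)))\<^sup>2" unfolding s_def .
    show "0 \<le> Re (csqrt (m z))" using csqrt_principal[of "m z"] by linarith
  qed
  show ?thesis
  proof (rule phragmen_lindeloef_multiplier[where S = H and k = "\<lambda>z. csqrt (m z)", OF _ _ f _ _ M _ _ w])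
    show "open H" "convex H"
      by (auto simp: H_def intro!: open_halfspace_Im_gt convex_halfspace_Im_gt)
    show "(\<lambda>z. csqrt (m z)) holomorphic_on H"
      unfolding m_def
      by (intro holomorphic_intros not_nonpos_Reals_Re) (auto simp: H_def)
    show "0 \<le> Re (csqrt (m z))" if "z \<in> H" for z using that by (rule kl(2))
    show "\<forall>\<^sub>F w in at x within H. norm (f w) \<le> M + e" if "x \<in> frontier H" "0 < e" for x e
    proof -
      have "x = of_real (Re x)"
        using that by (simp add: H_def frontier_upper_half_plane complex_eq_iff)
      then show ?thesis using bd[OF that(2), of "Re x"] by simp
    qed
    fix d e :: real assume de: "0 < d" "0 < e"
    define l where "l = \<bar>ln ((\<bar>C\<bar> + 1) / e)\<bar> / d"
    show "\<exists>r. \<forall>w\<in>H. r \<le> norm w \<longrightarrow> norm (f w) * exp (- d * Re (csqrt (m w))) \<le> e"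
    proof (intro exI[of _ "1 + 2 * l\<^sup>2"] ballI impI)
      fix z assume z: "z \<in> H" "1 + 2 * l\<^sup>2 \<le> norm z"
      have "l\<^sup>2 \<le> (Re (csqrt (m z)))\<^sup>2" using kl[OF z(1)] z(2) by linarith
      then have "l \<le> Re (csqrt (m z))" using kl(2)[OF z(1)] by (rule power2_le_imp_le)
      then have "d * l \<le> d * Re (csqrt (m z))" using de by (intro mult_left_mono) auto
      then have 1: "ln ((\<bar>C\<bar> + 1) / e) \<le> d * Re (csqrt (m z))" using de by (simp add: l_def)
      have "norm (f z) * exp (- d * Re (csqrt (m z))) \<le> (\<bar>C\<bar> + 1) * exp (- ln ((\<bar>C\<bar> + 1) / e))"
        using gr[OF z(1)] 1 by (intro mult_mono) auto
      also have "\<dots> = e" using de by (simp add: exp_minus)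
      finally show "norm (f z) * exp (- d * Re (csqrt (m z))) \<le> e" .
    qed
  qed
qed

text \<open>The function exp (- i w) shows that exponential growth alone is too weak a hypothesis;
  \<open>im\<close> excludes it. The factor exp (i e w) makes \<open>f\<close> bounded on the
  imaginary axis, hence in both quadrants; the bounded case then restores the constant
  \<open>M\<close>, and e tends to 0.\<close>

lemma phragmen_lindeloef_half_plane:
  fixes f :: "complex \<Rightarrow> complex"
  defines "H \<equiv> {w. 0 < Im w}"
  assumes f: "f holomorphic_on H" and M: "0 \<le> M"
    and bd: "\<And>x e. 0 < e \<Longrightarrow> \<forall>\<^sub>F w in at (of_real x) within H. norm (f w) \<le> M + e"
    and gr: "\<And>w. w \<in> H \<Longrightarrow> norm (f w) \<le> C * exp (B * norm w)"
    and im: "\<And>e. 0 < e \<Longrightarrow> \<exists>C. \<forall>y>0. norm (f (\<i> * of_real y)) \<le> C * exp (e * y)"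
    and w: "w \<in> H"
  shows "norm (f w) \<le> M"
proof -
  let ?Q = "{w. 0 < Re w \<and> 0 < Im w}"
  have oH: "open H" unfolding H_def by (rule open_halfspace_Im_gt)
  have main: "norm (f w) * exp (- e * Im w) \<le> M" if e: "0 < e" for e
  proof -
    define g where "g z = f z * exp (\<i> * of_real e * z)" for z
    have ng: "norm (g z) = norm (f z) * exp (- e * Im z)" for z
      by (simp add: g_def norm_mult)
    have ngle: "norm (g z) \<le> norm (f z)" if "z \<in> H" for z
      unfolding ng using that e by (intro mult_left_le) (auto simp: H_def)
    obtain C' where C': "\<And>y. 0 < y \<Longrightarrow> norm (f (\<i> * of_real y)) \<le> C' * exp (e * y)"
      using im[OF e] by blast
    have gim: "norm (g z) \<le> C'" if "Re z = 0" "0 < Im z" for z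
    proof -
      have "z = \<i> * of_real (Im z)" using that by (simp add: complex_eq_iff)
      then have "norm (f z) \<le> C' * exp (e * Im z)" using C'[OF that(2)] by metis
      then show ?thesis unfolding ng
        by (simp add: exp_minus field_simps)
    qed
    have gH: "g holomorphic_on H" unfolding g_def by (intro holomorphic_intros f)
    have gbd: "\<forall>\<^sub>F w in at (of_real x) within H. norm (g w) \<le> M + e'" if "0 < e'" for x e'
    proof -
      have "\<forall>\<^sub>F w in at (of_real x) within H. w \<in> H" by (auto simp: eventually_at_filter)
      with bd[OF that, of x] show ?thesis
        by eventually_elim (use ngle in force)
    qed
    \<comment> \<open>\<open>c = \<i>\<close> carries the first quadrant onto the second. On the two
      boundary rays the bounds are \<open>M\<close> (real axis) and \<open>C'\<close> (imaginary
      axis).\<close>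
    have quad: "norm (g (c * z)) \<le> max M C'"
      if c: "c = 1 \<or> c = \<i>" and z: "z \<in> ?Q" for c z
    proof (rule phragmen_lindeloef_quadrant[of "\<lambda>z. g (c * z)", OF _ _ _ _ z])
      have cQ: "c * z \<in> H" if "z \<in> ?Q" for z using c that by (auto simp: H_def)
      have nc: "norm c = 1" using c by auto
      show "(\<lambda>z. g (c * z)) holomorphic_on ?Q"
        using cQ by (intro holomorphic_on_compose_gen[OF _ gH, unfolded o_def] holomorphic_intros) auto
      show "0 \<le> max M C'" using M by simp
      show "norm (g (c * z)) \<le> C * exp (B * norm z)" if "z \<in> ?Q" for z
        using gr[OF cQ[OF that]] ngle[OF cQ[OF that]] nc by (simp add: norm_mult)
      fix x e' assume x: "x \<in> frontier ?Q" and e': "(0::real) < e'"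
      have flim: "filterlim (\<lambda>z. c * z) (at (c * x) within H) (at x within ?Q)"
        unfolding filterlim_at
      proof
        show "((\<lambda>z. c * z) \<longlongrightarrow> c * x) (at x within ?Q)" by (intro tendsto_intros)
        show "\<forall>\<^sub>F z in at x within ?Q. c * z \<in> H \<and> c * z \<noteq> c * x"
          using cQ c by (auto simp: eventually_at_filter)
      qed
      show "\<forall>\<^sub>F z in at x within ?Q. norm (g (c * z)) \<le> max M C' + e'"
      proof (cases "Im (c * x) = 0")
        case True
        then have eq: "c * x = of_real (Re (c * x))" by (simp add: complex_eq_iff)
        have "\<forall>\<^sub>F w in at (c * x) within H. norm (g w) \<le> M + e'"
          using gbd[OF e'] eq by metis
        then have "\<forall>\<^sub>F z in at x within ?Q. norm (g (c * z)) \<le> M + e'"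
          using flim by (rule eventually_compose_filterlim)
        then show ?thesis by (rule eventually_mono) auto
      next
        case False
        then have x': "Re (c * x) = 0" "0 < Im (c * x)"
          using c frontier_quadrant[OF x] by auto
        then have "c * x \<in> H" by (simp add: H_def)
        then have "isCont g (c * x)"
          using gH oH holomorphic_on_imp_continuous_on continuous_on_eq_continuous_at by blast
        then have "(g \<longlongrightarrow> g (c * x)) (at (c * x) within H)"
          unfolding isCont_def by (rule tendsto_within_subset) simp
        then have "((\<lambda>w. norm (g w)) \<longlongrightarrow> norm (g (c * x))) (at (c * x) within H)"
          by (rule tendsto_norm)
        moreover have "norm (g (c * x)) < max M C' + e'"
          using gim[OF x'] e' by linarith
        ultimately have "\<forall>\<^sub>F w in at (c * x) within H. norm (g w) < max M C' + e'"
          by (rule order_tendstoD)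
        then have "\<forall>\<^sub>F z in at x within ?Q. norm (g (c * z)) < max M C' + e'"
          using flim by (rule eventually_compose_filterlim)
        then show ?thesis by (rule eventually_mono) auto
      qed
    qed
    have "norm (g w) \<le> M"
    proof (rule phragmen_lindeloef_half_plane_bounded[of g, OF _ M])
      show "g holomorphic_on {w. 0 < Im w}" using gH by (simp add: H_def)
      show "\<forall>\<^sub>F w in at (of_real x) within {w. 0 < Im w}. norm (g w) \<le> M + e'" if "0 < e'" for x e'
        using gbd[OF that] by (simp add: H_def)
      show "w \<in> {w. 0 < Im w}" using w by (simp add: H_def)
      show "norm (g z) \<le> max M C'" if "z \<in> {w. 0 < Im w}" for z
      proof -
        consider "Re z > 0" | "Re z = 0" | "Re z < 0" by linarith
        then show ?thesis
        proof cases
          case 1 then show ?thesis using quad[of 1 z] that by auto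
        next
          case 2 then show ?thesis using gim[of z] that by auto
        next
          case 3 then show ?thesis using quad[of \<i> "- \<i> * z"] that by auto
        qed
      qed
    qed
    then show ?thesis by (simp add: ng)
  qed
  have "norm (f w) * exp (- 0 * Im w) \<le> M"
  proof (rule tendsto_upperbound)
    show "((\<lambda>d. norm (f w) * exp (- d * Im w)) \<longlongrightarrow> norm (f w) * exp (- 0 * Im w)) (at_right 0)"
      by (intro tendsto_intros)
    show "\<forall>\<^sub>F d in at_right 0. norm (f w) * exp (- d * Im w) \<le> M"
      using main eventually_at_right_less[of "0::real"] by (auto elim: eventually_mono)
  qed auto
  then show ?thesis by simp
qed

section \<open>Decay of functions of exponential type\<close>

text \<open>\<open>g\<close> is the Cauchy integral of \<open>\<phi>\<close> divided by pi i, and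
  its real part is the Poisson integral. A holomorphic \<open>g\<close> is wanted, not only a
  harmonic majorant, because functions will be divided by exp g. The bound at the boundary is
  one-sided, as majorisation asks.\<close>

lemma poisson_majorant:
  fixes \<phi> :: "real \<Rightarrow> real"
  defines "H \<equiv> {w. 0 < Im w}"
  assumes cont: "continuous_on UNIV \<phi>" and nonneg: "\<And>t. 0 \<le> \<phi> t" and int: "integrable lborel \<phi>"
  obtains g where "g holomorphic_on H" "\<And>w. w \<in> H \<Longrightarrow> 0 \<le> Re (g w)"
    "\<And>x e. 0 < e \<Longrightarrow> \<forall>\<^sub>F w in at (of_real x) within H. \<phi> x - e \<le> Re (g w)"
    "((\<lambda>x. Re (g (of_real x + \<i>))) \<longlongrightarrow> 0) at_infinity"
proof -
  define k where "k w t = 1 / (of_real pi * \<i> * (of_real t - w))" for w :: complex and t :: real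
  define f where "f w t = of_real (\<phi> t) * k w t" for w t
  define g where "g w = (\<integral>t. f w t \<partial>lborel)" for w
  define P where "P w t = Im w / (pi * ((t - Re w)\<^sup>2 + (Im w)\<^sup>2))" for w t
  have tw: "of_real t \<noteq> w" if "w \<in> H" for w t using that by (auto simp: H_def)
  have nk: "norm (k w t) \<le> 1 / (pi * Im w)" if "w \<in> H" for w t
  proof -
    have "Im w \<le> norm (of_real t - w)"
      using abs_Im_le_cmod[of "of_real t - w"] that by (auto simp: H_def)
    then show ?thesis
      using that unfolding k_def norm_divide norm_mult
      by (auto intro!: divide_left_mono mult_left_mono mult_pos_pos simp: H_def tw)
  qed
  have Rek: "Re (k w t) = P w t" for w t
  proof -
    have e: "\<i> * (of_real t - w) = Complex (Im w) (t - Re w)" by (simp add: complex_eq_iff)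
    have "k w t = of_real (1 / pi) * (1 / Complex (Im w) (t - Re w))"
      unfolding k_def mult.assoc e by simp
    also have "Re \<dots> = 1 / pi * Re (1 / Complex (Im w) (t - Re w))"
      by (simp only: times_complex.sel Re_complex_of_real Im_complex_of_real mult_zero_left diff_zero)
    also have "\<dots> = P w t" by (simp add: P_def Re_divide add.commute)
    finally show ?thesis .
  qed
  have contk: "continuous_on UNIV (k w)" if "w \<in> H" for w
    unfolding k_def using tw[OF that] by (intro continuous_intros) auto
  have contf: "continuous_on UNIV (f w)" if "w \<in> H" for w
    unfolding f_def using contk[OF that] cont by (intro continuous_intros)
  have nf: "norm (f w t) \<le> \<phi> t / (pi * Im w)" if "w \<in> H" for w t
    using mult_left_mono[OF nk[OF that, of t] nonneg[of t]] nonneg[of t] by (simp add: f_def norm_mult)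
  have intf: "integrable lborel (f w)" if w: "w \<in> H" for w
  proof (rule Bochner_Integration.integrable_bound)
    show "integrable lborel (\<lambda>t. \<phi> t / (pi * Im w))" using int by auto
    show "f w \<in> borel_measurable lborel"
      using borel_measurable_continuous_onI[OF contf[OF w]] by simp
    show "AE t in lborel. norm (f w t) \<le> norm (\<phi> t / (pi * Im w))"
      using order_trans[OF nf[OF w] abs_ge_self] by auto
  qed
  have intP: "integrable lborel (\<lambda>t. \<phi> t * P w t)" if w: "w \<in> H" for w
    using integrable_Re[OF intf[OF w]] by (simp add: f_def Rek)
  have Reg: "Re (g w) = (\<integral>t. \<phi> t * P w t \<partial>lborel)" if w: "w \<in> H" for w
  proof -
    have "(\<lambda>t. Re (f w t)) = (\<lambda>t. \<phi> t * P w t)" by (simp add: f_def Rek)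
    then show ?thesis using integral_Re[OF intf[OF w]] by (simp add: g_def)
  qed
  have P0: "0 \<le> P w t" if "w \<in> H" for w t
    using that by (auto simp: P_def H_def intro!: divide_nonneg_nonneg)
  \<comment> \<open>Mass of \<open>\<phi>\<close> outside [-n, n]. Since |k w t| <= 1 / (pi Im w),
    it controls the truncation error locally uniformly in w, so \<open>g\<close> is a locally
    uniform limit of the holomorphic integrals over compact intervals.\<close>
  define T where "T n = (\<integral>t. (1 - indicator {- real n..real n} t) * \<phi> t \<partial>lborel)" for n :: nat
  have T: "T \<longlonglongrightarrow> 0"
  proof -
    have "T \<longlonglongrightarrow> (\<integral>t. 0 \<partial>(lborel :: real measure))"
      unfolding T_def
    proof (rule integral_dominated_convergence[where w = \<phi>])
      show "(\<lambda>t. (1 - indicator {- real n..real n} t) * \<phi> t) \<in> borel_measurable lborel" for n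
        using borel_measurable_integrable[OF int] by measurable
      show "AE t in lborel. (\<lambda>n. (1 - indicator {- real n..real n} t) * \<phi> t) \<longlonglongrightarrow> 0"
      proof (rule AE_I2, rule tendsto_eventually)
        fix t :: real
        obtain N where "\<bar>t\<bar> \<le> real N" using real_arch_simple by blast
        then show "\<forall>\<^sub>F n in sequentially. (1 - indicator {- real n..real n} t) * \<phi> t = 0"
          by (intro eventually_sequentiallyI[of N]) (auto simp: indicator_def)
      qed
      show "AE t in lborel. norm ((1 - indicator {- real n..real n} t) * \<phi> t) \<le> \<phi> t" for n
        using nonneg by (auto simp: indicator_def)
    qed (use int in auto)
    then show ?thesis by simp
  qed
  define gn where "gn n w = integral (cbox (- real n) (real n)) (f w)" for n w
  have gn_eq: "gn n w = (\<integral>t. indicator {- real n..real n} t *\<^sub>R f w t \<partial>lborel)" if w: "w \<in> H" for n w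
  proof -
    have "set_integrable lborel {- real n..real n} (f w)"
      unfolding set_integrable_def by (intro integrable_mult_indicator intf[OF w]) auto
    from set_borel_integral_eq_integral(2)[OF this] show ?thesis
      by (simp add: gn_def set_lebesgue_integral_def)
  qed
  have diff: "norm (gn n w - g w) \<le> T n / (pi * Im w)" if w: "w \<in> H" for n w
  proof -
    have i1: "integrable lborel (\<lambda>t. indicator {- real n..real n} t *\<^sub>R f w t)"
      by (intro integrable_mult_indicator intf[OF w]) auto
    have i2: "integrable lborel (\<lambda>t. indicator {- real n..real n} t *\<^sub>R \<phi> t)"
      by (intro integrable_mult_indicator int) auto
    have i3: "integrable lborel (\<lambda>t. (1 - indicator {- real n..real n} t) * \<phi> t)"
      using Bochner_Integration.integrable_diff[OF int i2] by (simp add: algebra_simps)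
    have "norm (gn n w - g w) = norm (\<integral>t. f w t - indicator {- real n..real n} t *\<^sub>R f w t \<partial>lborel)"
      unfolding gn_eq[OF w] g_def Bochner_Integration.integral_diff[OF intf[OF w] i1]
      by (rule norm_minus_commute)
    also have "\<dots> \<le> (\<integral>t. (1 - indicator {- real n..real n} t) * \<phi> t / (pi * Im w) \<partial>lborel)"
    proof (rule Bochner_Integration.integral_norm_bound_integral)
      show "integrable lborel (\<lambda>t. f w t - indicator {- real n..real n} t *\<^sub>R f w t)"
        by (rule Bochner_Integration.integrable_diff[OF intf[OF w] i1])
      show "integrable lborel (\<lambda>t. (1 - indicator {- real n..real n} t) * \<phi> t / (pi * Im w))"
        using i3 by simp
    qed (use nf[OF w] in \<open>auto simp: indicator_def\<close>)
    also have "\<dots> = T n / (pi * Im w)" by (simp add: T_def)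
    finally show ?thesis .
  qed
  have oH: "open H" "convex H" unfolding H_def by (auto intro: open_halfspace_Im_gt convex_halfspace_Im_gt)
  have hol: "g holomorphic_on H"
  proof (rule holomorphic_uniform_sequence[where f = gn])
    show "open H" by (rule oH)
    show "gn n holomorphic_on H" for n
      unfolding gn_def
    proof (rule leibniz_rule_holomorphic[OF _ _ _ oH(2)])
      show "((\<lambda>w. f w t) has_field_derivative 
          of_real (\<phi> t) * (of_real pi * \<i>) / (of_real pi * \<i> * (of_real t - w))\<^sup>2) (at w within H)"
        if "w \<in> H" for w t
        unfolding f_def k_def using tw[OF that]
        by (auto intro!: derivative_eq_intros simp: power2_eq_square)
      show "f w integrable_on cbox (- real n) (real n)" if "w \<in> H" for w
        using contf[OF that] by (intro integrable_continuous continuous_on_subset[OF contf[OF that]]) auto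
      have "continuous_on (H \<times> cbox (- real n) (real n)) (\<lambda>x. \<phi> (snd x))"
        by (rule continuous_on_compose2[OF cont]) (auto intro!: continuous_intros)
      then show "continuous_on (H \<times> cbox (- real n) (real n))
          (\<lambda>(w, t). of_real (\<phi> t) * (of_real pi * \<i>) / (of_real pi * \<i> * (of_real t - w))\<^sup>2)"
        unfolding split_beta by (intro continuous_intros) (auto dest: tw)
    qed
    fix w assume w: "w \<in> H"
    define d where "d = Im w / 2"
    have d: "d > 0" using w by (simp add: d_def H_def)
    have Imd: "d \<le> Im z" if "z \<in> cball w d" for z
      using that abs_Im_le_cmod[of "w - z"] by (auto simp: dist_norm d_def)
    then have sub: "cball w d \<subseteq> H" using d unfolding H_def by force
    have "uniform_limit (cball w d) gn g sequentially"
    proof (rule uniform_limitI)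
      fix e :: real assume "0 < e"
      have "(\<lambda>n. T n / (pi * d)) \<longlonglongrightarrow> 0 / (pi * d)" using d by (intro tendsto_intros T) auto
      then have "\<forall>\<^sub>F n in sequentially. T n / (pi * d) < e"
        using \<open>0 < e\<close> by (intro order_tendstoD) auto
      then show "\<forall>\<^sub>F n in sequentially. \<forall>z\<in>cball w d. dist (gn n z) (g z) < e"
      proof eventually_elim
        case (elim n)
        show ?case
        proof
          fix z assume z: "z \<in> cball w d"
          have zH: "z \<in> H" using sub z by blast
          have T0: "0 \<le> T n" unfolding T_def by (rule integral_nonneg_AE) (auto simp: indicator_def nonneg)
          have "norm (gn n z - g z) \<le> T n / (pi * Im z)" by (rule diff[OF zH])
          also have "\<dots> \<le> T n / (pi * d)"
            using T0 Imd[OF z] d zH by (intro divide_left_mono) (auto simp: H_def)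
          finally show "dist (gn n z) (g z) < e" using elim by (simp add: dist_norm)
        qed
      qed
    qed
    then show "\<exists>d>0. cball w d \<subseteq> H \<and> uniform_limit (cball w d) gn g sequentially"
      using d sub by blast
  qed
  have pos: "0 \<le> Re (g w)" if "w \<in> H" for w
    unfolding Reg[OF that] by (rule integral_nonneg_AE) (use nonneg P0[OF that] in auto)
  have bdry: "\<forall>\<^sub>F w in at (of_real x) within H. \<phi> x - e \<le> Re (g w)" if e: "0 < e" for x e
  proof (cases "\<phi> x - e / 2 \<le> 0")
    case True
    have "\<forall>\<^sub>F w in at (of_real x) within H. w \<in> H" by (auto simp: eventually_at_filter)
    then show ?thesis by eventually_elim (use True e pos in force)
  next
    case False
    define c where "c = \<phi> x - e / 2"
    have c: "c > 0" using False by (simp add: c_def)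
    obtain \<delta> where \<delta>: "\<delta> > 0" "\<And>t. \<bar>t - x\<bar> < \<delta> \<Longrightarrow> \<bar>\<phi> t - \<phi> x\<bar> < e / 2"
      using cont e unfolding continuous_on_iff dist_real_def by (metis UNIV_I half_gt_zero)
    \<comment> \<open>With a third of \<open>\<delta>\<close>, the window of half-width
      \<open>b\<close> about \<open>Re w\<close> stays in the \<open>\<delta>\<close>-neighbourhood
      of \<open>x\<close> as long as |Re w - x| < b, and there \<open>\<phi>\<close> exceeds
      \<open>c\<close>. The window carries kernel mass (2 / pi) arctan (b / Im w), which tends to 1
      at the boundary.\<close>
    define b where "b = \<delta> / 3"
    have b: "b > 0" using \<delta> by (simp add: b_def)
    have low: "c * (2 / pi * arctan (b / Im w)) \<le> Re (g w)" if w: "w \<in> H" and wx: "\<bar>Re w - x\<bar> < b" for w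
    proof -
      let ?I = "{Re w - b..Re w + b}"
      have Iw: "Im w > 0" using w by (simp add: H_def)
      have "((\<lambda>t. arctan ((t - Re w) / Im w) / pi) has_real_derivative P w t) (at t)" for t
      proof -
        have "((\<lambda>t. arctan ((t - Re w) / Im w) / pi) has_real_derivative
            1 / (1 + ((t - Re w) / Im w)\<^sup>2) * (1 / Im w) / pi) (at t)"
          using Iw by (auto intro!: derivative_eq_intros simp: inverse_eq_divide)
        moreover have "1 + ((t - Re w) / Im w)\<^sup>2 = ((t - Re w)\<^sup>2 + (Im w)\<^sup>2) / (Im w)\<^sup>2"
          using Iw by (simp add: power_divide add_divide_distrib)
        ultimately show ?thesis using Iw by (simp add: P_def power2_eq_square mult.commute)
      qed
      then have "has_bochner_integral lborel (\<lambda>t. P w t * indicator ?I t)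
            (arctan ((Re w + b - Re w) / Im w) / pi - arctan ((Re w - b - Re w) / Im w) / pi)"
        using P0[OF w] b
        by (intro has_bochner_integral_FTC_Icc_nonneg) (auto simp: P_def)
      then have hb: "integrable lborel (\<lambda>t. P w t * indicator ?I t)"
          "(\<integral>t. P w t * indicator ?I t \<partial>lborel) = 2 / pi * arctan (b / Im w)"
        by (auto simp: has_bochner_integral_iff arctan_minus)
      have "c * (2 / pi * arctan (b / Im w)) = (\<integral>t. c * (P w t * indicator ?I t) \<partial>lborel)"
        by (simp add: hb)
      also have "\<dots> \<le> (\<integral>t. \<phi> t * P w t \<partial>lborel)"
      proof (rule integral_mono)
        fix t
        show "c * (P w t * indicator ?I t) \<le> \<phi> t * P w t"
        proof (cases "t \<in> ?I")
          case True
          then have "Re w - b \<le> t" "t \<le> Re w + b" by auto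
          then have "\<bar>t - x\<bar> < \<delta>" using wx \<delta>(1) unfolding b_def by linarith
          then have "c \<le> \<phi> t" using \<delta>(2)[of t] unfolding c_def by linarith
          then show ?thesis using True P0[OF w] by (simp add: mult_right_mono)
        qed (use nonneg P0[OF w] in auto)
      qed (use hb intP[OF w] in auto)
      finally show ?thesis by (simp add: Reg[OF w])
    qed
    have "filterlim Im (at_right 0) (at (of_real x) within H)"
      unfolding filterlim_at
    proof
      have "(Im \<longlongrightarrow> Im (of_real x)) (at (of_real x) within H)" by (intro tendsto_intros)
      then show "(Im \<longlongrightarrow> 0) (at (of_real x) within H)" by simp
    qed (auto simp: eventually_at_filter H_def)
    then have "filterlim (\<lambda>w. inverse (Im w)) at_top (at (of_real x) within H)"
      by (rule filterlim_compose[OF filterlim_inverse_at_top_right])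
    then have "filterlim (\<lambda>w. b * inverse (Im w)) at_top (at (of_real x) within H)"
      using b by (intro filterlim_tendsto_pos_mult_at_top[OF tendsto_const])
    then have "((\<lambda>w. arctan (b * inverse (Im w))) \<longlongrightarrow> pi / 2) (at (of_real x) within H)"
      by (rule filterlim_compose[OF tendsto_arctan_at_top])
    then have "((\<lambda>w. c * (2 / pi * arctan (b / Im w))) \<longlongrightarrow> c * (2 / pi * (pi / 2))) (at (of_real x) within H)"
      unfolding divide_inverse[of b] by (intro tendsto_intros)
    moreover have "\<phi> x - e < c * (2 / pi * (pi / 2))" using e by (simp add: c_def)
    ultimately have "\<forall>\<^sub>F w in at (of_real x) within H. \<phi> x - e < c * (2 / pi * arctan (b / Im w))"
      by (rule order_tendstoD)
    moreover have "\<forall>\<^sub>F w in at (of_real x) within H. w \<in> H" by (auto simp: eventually_at_filter)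
    moreover have "\<forall>\<^sub>F w in at (of_real x) within H. \<bar>Re w - x\<bar> < b"
    proof -
      have "((\<lambda>w. \<bar>Re w - x\<bar>) \<longlongrightarrow> \<bar>Re (of_real x) - x\<bar>) (at (of_real x) within H)"
        by (intro tendsto_intros)
      then show ?thesis using b by (intro order_tendstoD) auto
    qed
    ultimately show ?thesis by eventually_elim (use low in force)
  qed
  have lim: "((\<lambda>x. Re (g (of_real x + \<i>))) \<longlongrightarrow> 0) at_infinity"
  proof -
    have i: "of_real x + \<i> \<in> H" for x by (simp add: H_def)
    define q where "q x t = P (of_real x + \<i>) t" for x t
    have q: "q x t = 1 / (pi * ((t - x)\<^sup>2 + 1))" for x t by (simp add: q_def P_def)
    have eq: "Re (g (of_real x + \<i>)) = (\<integral>t. \<phi> t * q x t \<partial>lborel)" for x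
      unfolding q_def by (rule Reg[OF i])
    have q0: "0 \<le> q x t" for x t unfolding q_def by (rule P0[OF i])
    have q1: "q x t \<le> 1" for x t
    proof -
      have "1 \<le> pi * ((t - x)\<^sup>2 + 1)"
        using mult_mono[of 1 pi 1 "(t - x)\<^sup>2 + 1"] pi_gt3 by simp
      then show ?thesis by (simp add: q divide_le_eq)
    qed
    \<comment> \<open>The sign \<open>c\<close> treats both ends of the real line at once. On the
      line Im w = 1 the kernel is at most 1, so \<open>\<phi>\<close> itself is the dominating
      function.\<close>
    have *: "((\<lambda>x. \<integral>t. \<phi> t * q (c * x) t \<partial>lborel) \<longlongrightarrow> (\<integral>t. 0 \<partial>(lborel :: real measure))) at_top"
      if "c = 1 \<or> c = -1" for c :: real
    proof (rule integral_dominated_convergence_at_top[where w = \<phi>])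
      show "(\<lambda>t. \<phi> t * q (c * x) t) \<in> borel_measurable lborel" for x
        unfolding q_def by (rule borel_measurable_integrable[OF intP[OF i]])
      show "\<forall>\<^sub>F x in at_top. AE t in lborel. norm (\<phi> t * q (c * x) t) \<le> \<phi> t"
        using q0 q1 nonneg by (auto simp: abs_mult intro!: mult_left_le always_eventually)
      have "((\<lambda>x. q (c * x) t) \<longlongrightarrow> 0) at_top" for t
        unfolding q using that by (elim disjE; hypsubst; real_asymp)
      then show "AE t in lborel. ((\<lambda>x. \<phi> t * q (c * x) t) \<longlongrightarrow> 0) at_top"
        by (auto intro!: tendsto_mult_right_zero)
    qed (use int in auto)
    have "((\<lambda>x. Re (g (of_real x + \<i>))) \<longlongrightarrow> 0) at_top"
      unfolding eq using *[of 1] by simp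
    moreover have "((\<lambda>x. Re (g (of_real x + \<i>))) \<longlongrightarrow> 0) at_bot"
      unfolding filterlim_at_bot_mirror eq using *[of "-1"] by simp
    ultimately show ?thesis by (simp add: at_infinity_eq_at_top_bot filterlim_sup)
  qed
  show ?thesis using that[OF hol pos bdry lim] by blast
qed

lemma isCont_eventually_norm_le:
  fixes f :: "complex \<Rightarrow> complex"
  assumes "isCont f x" "norm (f x) \<le> M" "0 < e"
  shows "\<forall>\<^sub>F w in at x within S. norm (f w) \<le> M + e"
proof -
  have "(f \<longlongrightarrow> f x) (at x within S)"
    using assms(1) unfolding isCont_def by (rule tendsto_within_subset) simp
  then have "((\<lambda>w. norm (f w)) \<longlongrightarrow> norm (f x)) (at x within S)" by (rule tendsto_norm)
  moreover have "norm (f x) < M + e" using assms by simp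
  ultimately have "\<forall>\<^sub>F w in at x within S. norm (f w) < M + e" by (rule order_tendstoD)
  then show ?thesis by (rule eventually_mono) simp
qed

lemma continuous_on_of_real_compose:
  fixes G :: "complex \<Rightarrow> complex"
  assumes "\<And>x. isCont G (of_real x)"
  shows "continuous_on S (\<lambda>t. G (of_real t))"
proof (intro continuous_at_imp_continuous_on ballI)
  show "isCont (\<lambda>t. G (of_real t)) x" for x
    by (rule isCont_o2[where f = of_real and a = x and g = G]) (auto intro: assms)
qed

lemma norm_le_norm_add_imaginary:
  assumes "0 \<le> Im w" "0 \<le> L"
  shows "norm w \<le> norm (w + \<i> * of_real L)"
  unfolding cmod_def using assms by (intro real_sqrt_le_mono) (simp add: power_mono)

text \<open>The negative part of log |G| is out of control, whereas ln (1 + y^p) / p is nonnegative,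
  continuous along the axis, at least ln y, and at most y^p / p, hence integrable. Dividing l G by
  exp g leaves a function bounded by 1, and Re g < 1 far out on the line gives |G| <= e / l
  there.\<close>

lemma integrable_powr_imp_tendsto_0:
  fixes G :: "complex \<Rightarrow> complex"
  defines "H \<equiv> {w. 0 < Im w}"
  assumes G: "G holomorphic_on H" and cont: "\<And>x. isCont G (of_real x)"
    and gr: "\<And>w. w \<in> H \<Longrightarrow> norm (G w) \<le> C * exp (B * norm w)"
    and im: "\<And>e. 0 < e \<Longrightarrow> \<exists>C. \<forall>y>0. norm (G (\<i> * of_real y)) \<le> C * exp (e * y)"
    and p: "0 < p" and int: "integrable lborel (\<lambda>t. norm (G (of_real t)) powr p)"
  shows "((\<lambda>x. G (of_real x + \<i>)) \<longlongrightarrow> 0) at_infinity"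
proof -
  have contR: "continuous_on UNIV (\<lambda>t. G (of_real t))"
    by (rule continuous_on_of_real_compose[OF cont])
  have main: "\<forall>\<^sub>F x in at_infinity. norm (G (of_real x + \<i>)) \<le> exp 1 / l" if l: "0 < l" for l
  proof -
    define \<phi> where "\<phi> t = ln (1 + (l * norm (G (of_real t))) powr p) / p" for t
    have c\<phi>: "continuous_on UNIV \<phi>"
      unfolding \<phi>_def using l p
      by (intro continuous_intros continuous_on_powr' contR) (auto simp: add_nonneg_eq_0_iff)
    have \<phi>0: "0 \<le> \<phi> t" for t using p by (simp add: \<phi>_def)
    have i\<phi>: "integrable lborel \<phi>"
    proof (rule Bochner_Integration.integrable_bound)
      show "integrable lborel (\<lambda>t. l powr p / p * norm (G (of_real t)) powr p)" using int by auto
      show "\<phi> \<in> borel_measurable lborel"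
        using borel_measurable_continuous_onI[OF c\<phi>] by simp
      show "AE t in lborel. norm (\<phi> t) \<le> norm (l powr p / p * norm (G (of_real t)) powr p)"
      proof (rule AE_I2)
        fix t
        have "ln (1 + (l * norm (G (of_real t))) powr p) \<le> (l * norm (G (of_real t))) powr p"
          by (rule ln_add_one_self_le_self) simp
        also have "\<dots> = l powr p * norm (G (of_real t)) powr p"
          using l by (simp add: powr_mult)
        finally show "norm (\<phi> t) \<le> norm (l powr p / p * norm (G (of_real t)) powr p)"
          using p \<phi>0[of t] by (simp add: \<phi>_def field_simps)
      qed
    qed
    have major: "l * norm (G (of_real t)) \<le> exp (\<phi> t)" for t
    proof -
      let ?y = "l * norm (G (of_real t))"
      have "?y = (?y powr p) powr (1 / p)" using p l by (simp add: powr_powr)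
      also have "\<dots> \<le> (1 + ?y powr p) powr (1 / p)" using p by (intro powr_mono2) auto
      also have "\<dots> = exp (\<phi> t)"
        by (simp add: powr_def \<phi>_def add_nonneg_eq_0_iff)
      finally show ?thesis .
    qed
    obtain g where g: "g holomorphic_on H" "\<And>w. w \<in> H \<Longrightarrow> 0 \<le> Re (g w)"
      "\<And>x e. 0 < e \<Longrightarrow> \<forall>\<^sub>F w in at (of_real x) within H. \<phi> x - e \<le> Re (g w)"
      "((\<lambda>x. Re (g (of_real x + \<i>))) \<longlongrightarrow> 0) at_infinity"
      using poisson_majorant[OF c\<phi> \<phi>0 i\<phi>] unfolding H_def by blast
    define f where "f w = of_real l * G w * exp (- g w)" for w
    have nf: "norm (f w) = l * norm (G w) * exp (- Re (g w))" for w
      using l by (simp add: f_def norm_mult)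
    have nfle: "norm (f w) \<le> l * norm (G w)" if "w \<in> H" for w
      unfolding nf using g(2)[OF that] l by (intro mult_left_le) auto
    have bound: "norm (f w) \<le> 1" if w: "w \<in> H" for w
    proof (rule phragmen_lindeloef_half_plane[of f])
      show "f holomorphic_on {w. 0 < Im w}"
        unfolding f_def using G g(1) by (intro holomorphic_intros) (auto simp: H_def)
      show "w \<in> {w. 0 < Im w}" using w by (simp add: H_def)
      show "norm (f w) \<le> l * C * exp (B * norm w)" if "w \<in> {w. 0 < Im w}" for w
        unfolding mult.assoc using that l unfolding H_def[symmetric]
        by (intro order_trans[OF nfle] mult_left_mono gr) auto
      show "\<exists>C. \<forall>y>0. norm (f (\<i> * of_real y)) \<le> C * exp (e * y)" if e: "0 < e" for e
      proof -
        obtain C where C: "\<And>y. 0 < y \<Longrightarrow> norm (G (\<i> * of_real y)) \<le> C * exp (e * y)"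
          using im[OF e] by blast
        have "norm (f (\<i> * of_real y)) \<le> l * C * exp (e * y)" if "y > 0" for y
          unfolding mult.assoc using that l by (intro order_trans[OF nfle] mult_left_mono C) (auto simp: H_def)
        then show ?thesis by blast
      qed
      fix x e :: real assume e: "0 < e"
      \<comment> \<open>Chosen for the final product: with exp d <= 1 + 2d it is (1 + d)(1 + 2d) <=
        1 + 5d <= 1 + e.\<close>
      define d where "d = min 1 (e / 5)"
      have d: "0 < d" "d \<le> 1" "5 * d \<le> e" using e by (auto simp: d_def min_def)
      have "\<forall>\<^sub>F w in at (of_real x) within H. norm (of_real l * G w) \<le> exp (\<phi> x) + d"
      proof (rule isCont_eventually_norm_le[OF _ _ d(1)])
        show "isCont (\<lambda>w. of_real l * G w) (of_real x)" by (intro continuous_intros cont)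
        show "norm (of_real l * G (of_real x)) \<le> exp (\<phi> x)"
          using major[of x] l by (simp add: norm_mult)
      qed
      with g(3)[OF d(1), of x]
      have "\<forall>\<^sub>F w in at (of_real x) within H. norm (f w) \<le> 1 + e"
      proof eventually_elim
        case (elim w)
        have ed: "exp d \<le> 1 + 2 * d"
        proof -
          have "exp d \<le> 1 + d + d\<^sup>2" using d by (intro exp_bound) auto
          moreover have "d\<^sup>2 \<le> d" using d by (simp add: power2_eq_square mult_left_le)
          ultimately show ?thesis by simp
        qed
        have "norm (f w) \<le> (exp (\<phi> x) + d) * exp (- (\<phi> x - d))"
          unfolding nf using elim l d by (intro mult_mono) (auto simp: norm_mult intro: add_nonneg_nonneg)
        also have "\<dots> = (exp (\<phi> x) + d) * (exp (- \<phi> x) * exp d)"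
          by (simp add: exp_add[symmetric])
        also have "\<dots> = (exp (\<phi> x) * exp (- \<phi> x) + d * exp (- \<phi> x)) * exp d"
          by (simp only: algebra_simps)
        also have "\<dots> = (1 + d * exp (- \<phi> x)) * exp d" by (simp add: exp_minus_inverse)
        also have "\<dots> \<le> (1 + d) * (1 + 2 * d)"
          using d \<phi>0[of x] ed by (intro mult_mono add_left_mono mult_left_le) auto
        also have "\<dots> = 1 + 3 * d + 2 * (d * d)" by (simp add: algebra_simps)
        also have "\<dots> \<le> 1 + e" using d mult_left_le[of d d] by linarith
        finally show ?case .
      qed
      then show "\<forall>\<^sub>F w in at (of_real x) within {w. 0 < Im w}. norm (f w) \<le> 1 + e"
        by (simp add: H_def)
    qed simp
    have "\<forall>\<^sub>F x in at_infinity. Re (g (of_real x + \<i>)) < 1"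
      using g(4) by (rule order_tendstoD) simp
    then show ?thesis
    proof eventually_elim
      case (elim x)
      have "l * norm (G (of_real x + \<i>)) * exp (- Re (g (of_real x + \<i>))) \<le> 1"
        using bound[of "of_real x + \<i>"] by (simp add: nf H_def)
      then have "l * norm (G (of_real x + \<i>)) \<le> exp (Re (g (of_real x + \<i>)))"
        by (simp add: exp_minus field_simps)
      also have "\<dots> \<le> exp 1" using elim by simp
      finally show ?case using l by (simp add: field_simps)
    qed
  qed
  show ?thesis
  proof (rule tendstoI)
    fix e :: real assume e: "0 < e"
    have "\<forall>\<^sub>F x in at_infinity. norm (G (of_real x + \<i>)) \<le> exp 1 / (2 * exp 1 / e)"
      using e by (intro main) auto
    then show "\<forall>\<^sub>F x in at_infinity. dist (G (of_real x + \<i>)) 0 < e"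
      by eventually_elim (use e in auto)
  qed
qed

section \<open>Growth bounds and weights for functions of exponential type\<close>

lemma exp_type_le_bound:
  assumes F: "F holomorphic_on UNIV" and ty: "exp_type_le F \<tau>" and \<tau>: "0 \<le> \<tau>" and e: "0 < e"
  shows "\<exists>C. \<forall>w. norm (F w) \<le> C * exp ((\<tau> + e) * norm w)"
proof -
  have "Limsup at_infinity (\<lambda>z. ereal (ln (norm (F z)) / norm z)) < ereal (\<tau> + e)"
    using e by (intro le_less_trans[OF ty[unfolded exp_type_le_def]]) simp
  then have "\<forall>\<^sub>F z in at_infinity. ereal (ln (norm (F z)) / norm z) < ereal (\<tau> + e)"
    by (rule Limsup_lessD)
  then obtain b where b: "\<And>z. b \<le> norm z \<Longrightarrow> ln (norm (F z)) / norm z < \<tau> + e"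
    by (auto simp: eventually_at_infinity)
  have "compact (F ` cball 0 (max b 1))"
    using F by (intro compact_continuous_image holomorphic_on_imp_continuous_on holomorphic_on_subset[OF F]) auto
  then obtain K where K: "\<And>z. norm z \<le> max b 1 \<Longrightarrow> norm (F z) \<le> K"
    using compact_imp_bounded[of "F ` cball 0 (max b 1)"] unfolding bounded_iff
    by (metis imageI mem_cball_0)
  have "norm (F w) \<le> (\<bar>K\<bar> + 1) * exp ((\<tau> + e) * norm w)" for w
  proof (cases "norm w \<le> max b 1")
    case True
    then have "norm (F w) \<le> (\<bar>K\<bar> + 1) * 1" using K[OF True] by simp
    also have "\<dots> \<le> (\<bar>K\<bar> + 1) * exp ((\<tau> + e) * norm w)"
      using \<tau> e by (intro mult_left_mono) auto
    finally show ?thesis .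
  next
    case False
    \<comment> \<open>Since \<open>ln 0 = 0\<close>, the bound on the logarithm can be exponentiated
      only where \<open>F w\<close> is nonzero.\<close>
    show ?thesis
    proof (cases "F w = 0")
      case True
      then show ?thesis by (simp add: add_nonneg_nonneg)
    next
      case nz: False
      have w: "0 < norm w" "b \<le> norm w" using False by (auto simp: not_le max_def split: if_splits)
      have "ln (norm (F w)) < (\<tau> + e) * norm w" using b[OF w(2)] w(1) by (simp add: divide_less_eq)
      then have "norm (F w) < exp ((\<tau> + e) * norm w)" using nz by (metis exp_less_cancel_iff exp_ln zero_less_norm_iff)
      also have "\<dots> \<le> (\<bar>K\<bar> + 1) * exp ((\<tau> + e) * norm w)" by simp
      finally show ?thesis by simp
    qed
  qed
  then show ?thesis by blast
qed

lemma powr_le_exp_linear: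
  fixes q e :: real
  assumes e: "0 < e"
  shows "\<exists>C. \<forall>r\<ge>0. (1 + r) powr \<bar>q\<bar> \<le> C * exp (e * r)"
proof -
  define d where "d = e / (\<bar>q\<bar> + 1)"
  have d: "d > 0" using e by (simp add: d_def add_nonneg_pos)
  have qd: "\<bar>q\<bar> * d \<le> e" using e by (simp add: d_def field_simps)
  have "(1 + r) powr \<bar>q\<bar> \<le> exp (\<bar>q\<bar> * (d - 1 - ln d)) * exp (e * r)" if r: "0 \<le> r" for r
  proof -
    have "ln (d * (1 + r)) \<le> d * (1 + r) - 1" using d r by (intro ln_le_minus_one) auto
    then have "ln (1 + r) \<le> d - 1 - ln d + d * r"
      using d r unfolding ln_mult_pos[OF d, of "1 + r"] by (subst (asm) ln_mult_pos) (auto simp: algebra_simps)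
    then have "\<bar>q\<bar> * ln (1 + r) \<le> \<bar>q\<bar> * (d - 1 - ln d + d * r)" by (intro mult_left_mono) auto
    also have "\<dots> = \<bar>q\<bar> * (d - 1 - ln d) + (\<bar>q\<bar> * d) * r" by (simp add: algebra_simps)
    also have "\<dots> \<le> \<bar>q\<bar> * (d - 1 - ln d) + e * r" using qd r by (intro add_left_mono mult_right_mono) auto
    finally show ?thesis using r by (simp add: powr_def exp_add[symmetric])
  qed
  then show ?thesis by blast
qed

text \<open>The exponent 2\<nu>+1 is negative when \<nu> < -1/2; the constant with
  \<open>\<bar>q\<bar>\<close> serves both signs.\<close>

lemma powr_comparable:
  fixes r s c q :: real
  assumes "0 < r" "r \<le> s" "s \<le> c * r"
  shows "s powr q \<le> c powr \<bar>q\<bar> * r powr q" "r powr q \<le> c powr \<bar>q\<bar> * s powr q"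
proof -
  have c: "1 \<le> c"
  proof (rule ccontr)
    assume "\<not> 1 \<le> c"
    then have "c * r < 1 * r" using assms(1) by (intro mult_strict_right_mono) auto
    then show False using assms by linarith
  qed
  have a1: "1 powr \<bar>q\<bar> \<le> c powr \<bar>q\<bar>" using c by (intro powr_mono2) auto
  show "s powr q \<le> c powr \<bar>q\<bar> * r powr q"
  proof (cases "0 \<le> q")
    case True
    then have "s powr q \<le> (c * r) powr q" using assms by (intro powr_mono2) auto
    then show ?thesis using True c assms by (simp add: powr_mult)
  next
    case False
    then have "s powr q \<le> 1 * r powr q" using assms by (simp add: powr_mono2')
    also have "\<dots> \<le> c powr \<bar>q\<bar> * r powr q" using a1 by (intro mult_right_mono) auto
    finally show ?thesis .
  qed
  show "r powr q \<le> c powr \<bar>q\<bar> * s powr q"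
  proof (cases "0 \<le> q")
    case True
    then have "r powr q \<le> 1 * s powr q" using assms by (simp add: powr_mono2)
    also have "\<dots> \<le> c powr \<bar>q\<bar> * s powr q" using a1 by (intro mult_right_mono) auto
    finally show ?thesis .
  next
    case False
    then have "(c * r) powr q \<le> s powr q" using assms by (intro powr_mono2') auto
    then have "c powr \<bar>q\<bar> * ((c * r) powr q) \<le> c powr \<bar>q\<bar> * s powr q" by (intro mult_left_mono) auto
    moreover have "c powr \<bar>q\<bar> * ((c * r) powr q) = r powr q"
      using False c assms by (simp add: powr_mult mult.assoc[symmetric] powr_add[symmetric])
    ultimately show ?thesis by simp
  qed
qed

text \<open>The shift by \<open>s\<close> lets the real axis stand for the line Im w = -s of
  \<open>F\<close> (s = 0 and s = 1 occur). The base w + i keeps the branch cut outside Im w > -1,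
  and e^(2iw) cancels the type 2 in the upper half-plane.\<close>

definition weighted :: "real \<Rightarrow> real \<Rightarrow> (complex \<Rightarrow> complex) \<Rightarrow> complex \<Rightarrow> complex" where
  "weighted q s F w = F (w - \<i> * of_real s) * (w + \<i>) powr of_real q * exp (2 * \<i> * w)"

lemma norm_weighted:
  "norm (weighted q s F w) = norm (F (w - \<i> * of_real s)) * norm (w + \<i>) powr q * exp (- 2 * Im w)"
  by (simp add: weighted_def norm_mult norm_powr_real_powr')

lemma holomorphic_on_weighted:
  assumes "F holomorphic_on UNIV"
  shows "weighted q s F holomorphic_on {w. -1 < Im w}"
proof -
  have *: "(\<lambda>w. F (w - \<i> * of_real s)) holomorphic_on {w. -1 < Im w}"
    by (rule holomorphic_on_compose_gen[OF _ assms, unfolded o_def]) (auto intro!: holomorphic_intros)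
  have "w + \<i> \<notin> \<real>\<^sub>\<le>\<^sub>0" if "-1 < Im w" for w
    using that by (auto simp: complex_nonpos_Reals_iff)
  then show ?thesis unfolding weighted_def by (intro holomorphic_intros *) auto
qed

lemma isCont_weighted:
  assumes "F holomorphic_on UNIV"
  shows "isCont (weighted q s F) (of_real x)"
proof -
  have "open {w. -1 < Im w}" by (rule open_halfspace_Im_gt)
  moreover have "of_real x \<in> {w. -1 < Im w}" by simp
  ultimately show ?thesis
    using holomorphic_on_imp_continuous_on[OF holomorphic_on_weighted[OF assms, of q s]]
      continuous_on_eq_continuous_at by blast
qed

lemma weighted_bound:
  assumes gr: "\<And>e. 0 < e \<Longrightarrow> \<exists>C. \<forall>w. norm (F w) \<le> C * exp ((2 + e) * norm w)" and e: "0 < e"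
  shows "\<exists>C. \<forall>w. 0 \<le> Im w \<longrightarrow> norm (weighted q s F w) \<le> C * exp ((2 + e) * norm w - 2 * Im w)"
proof -
  obtain C where C: "\<And>w. norm (F w) \<le> C * exp ((2 + e / 2) * norm w)"
    using gr[of "e / 2"] e by auto
  obtain D where D: "\<And>r. 0 \<le> r \<Longrightarrow> (1 + r) powr \<bar>q\<bar> \<le> D * exp (e / 2 * r)"
    using powr_le_exp_linear[of "e / 2" q] e by auto
  have "norm (weighted q s F w) \<le> \<bar>C\<bar> * exp ((2 + e / 2) * \<bar>s\<bar>) * \<bar>D\<bar> * exp ((2 + e) * norm w - 2 * Im w)"
    if w: "0 \<le> Im w" for w
  proof -
    have "norm (w - \<i> * of_real s) \<le> norm w + \<bar>s\<bar>"
      using norm_triangle_ineq4[of w "\<i> * of_real s"] by (simp add: norm_mult)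
    then have "(2 + e / 2) * norm (w - \<i> * of_real s) \<le> (2 + e / 2) * (norm w + \<bar>s\<bar>)"
      using e by (intro mult_left_mono) auto
    then have "C * exp ((2 + e / 2) * norm (w - \<i> * of_real s)) \<le> \<bar>C\<bar> * exp ((2 + e / 2) * (norm w + \<bar>s\<bar>))"
      by (intro mult_mono) auto
    then have 1: "norm (F (w - \<i> * of_real s)) \<le> \<bar>C\<bar> * exp ((2 + e / 2) * (norm w + \<bar>s\<bar>))"
      using C order_trans by blast
    have a: "1 \<le> norm (w + \<i>)" using abs_Im_le_cmod[of "w + \<i>"] w by simp
    have b: "norm (w + \<i>) \<le> 1 + norm w" using norm_triangle_ineq[of w \<i>] by simp
    have "norm (w + \<i>) powr q \<le> norm (w + \<i>) powr \<bar>q\<bar>" using a by (intro powr_mono) auto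
    also have "\<dots> \<le> (1 + norm w) powr \<bar>q\<bar>" using b by (intro powr_mono2) auto
    also have "\<dots> \<le> D * exp (e / 2 * norm w)" by (rule D) simp
    also have "\<dots> \<le> \<bar>D\<bar> * exp (e / 2 * norm w)" by (intro mult_right_mono) auto
    finally have 2: "norm (w + \<i>) powr q \<le> \<bar>D\<bar> * exp (e / 2 * norm w)" .
    have "norm (weighted q s F w) \<le> (\<bar>C\<bar> * exp ((2 + e / 2) * (norm w + \<bar>s\<bar>))) * (\<bar>D\<bar> * exp (e / 2 * norm w)) * exp (- 2 * Im w)"
      unfolding norm_weighted using 1 2 by (intro mult_right_mono mult_mono) auto
    also have "\<dots> = \<bar>C\<bar> * \<bar>D\<bar> * (exp ((2 + e / 2) * (norm w + \<bar>s\<bar>)) * exp (e / 2 * norm w) * exp (- 2 * Im w))"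
      by (simp only: mult_ac)
    also have "exp ((2 + e / 2) * (norm w + \<bar>s\<bar>)) * exp (e / 2 * norm w) * exp (- 2 * Im w)
       = exp ((2 + e / 2) * \<bar>s\<bar>) * exp ((2 + e) * norm w - 2 * Im w)"
      unfolding exp_add[symmetric] by (rule arg_cong[of _ _ exp]) (simp add: field_simps)
    finally show ?thesis by (simp only: mult_ac)
  qed
  then show ?thesis by blast
qed

text \<open>These are the two growth hypotheses of \<open>phragmen_lindeloef_half_plane\<close>. On
  the imaginary axis norm w = Im w, so the exponent (2 + e) norm w - 2 Im w collapses to e
  y.\<close>

lemma weighted_growth:
  assumes gr: "\<And>e. 0 < e \<Longrightarrow> \<exists>C. \<forall>w. norm (F w) \<le> C * exp ((2 + e) * norm w)"
  obtains C where "\<And>w. 0 < Im w \<Longrightarrow> norm (weighted q s F w) \<le> C * exp (3 * norm w)"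
    "\<And>e. 0 < e \<Longrightarrow> \<exists>C. \<forall>y>0. norm (weighted q s F (\<i> * of_real y)) \<le> C * exp (e * y)"
proof -
  obtain C where C: "\<And>w. 0 \<le> Im w \<Longrightarrow> norm (weighted q s F w) \<le> C * exp ((2 + 1) * norm w - 2 * Im w)"
    using weighted_bound[OF gr, where e = 1 and q = q and s = s] by auto
  show ?thesis
  proof (rule that[of "\<bar>C\<bar>"])
    fix w assume w: "0 < Im w"
    then have "norm (weighted q s F w) \<le> C * exp ((2 + 1) * norm w - 2 * Im w)" by (intro C) auto
    also have "\<dots> \<le> \<bar>C\<bar> * exp (3 * norm w)" using w by (intro mult_mono) auto
    finally show "norm (weighted q s F w) \<le> \<bar>C\<bar> * exp (3 * norm w)" .
  next
    fix e :: real assume "0 < e"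
    then obtain C where C: "\<And>w. 0 \<le> Im w \<Longrightarrow> norm (weighted q s F w) \<le> C * exp ((2 + e) * norm w - 2 * Im w)"
      using weighted_bound[OF gr, where e = e and q = q and s = s] by auto
    have "norm (weighted q s F (\<i> * of_real y)) \<le> C * exp (e * y)" if "y > 0" for y
      using C[of "\<i> * of_real y"] that by (simp add: norm_mult algebra_simps)
    then show "\<exists>C. \<forall>y>0. norm (weighted q s F (\<i> * of_real y)) \<le> C * exp (e * y)" by blast
  qed
qed

lemma exponential_type_decay_on_line:
  assumes F: "F holomorphic_on UNIV"
    and gr: "\<And>e. 0 < e \<Longrightarrow> \<exists>C. \<forall>w. norm (F w) \<le> C * exp ((2 + e) * norm w)"
    and p: "0 < p"
    and int: "integrable lborel (\<lambda>t. indicator {t. 1 \<le> \<bar>t\<bar>} t * norm (F (of_real t) * of_real (\<bar>t\<bar> powr q)) powr p)"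
  shows "((\<lambda>x. norm (F (of_real x + \<i>)) * \<bar>x\<bar> powr q) \<longlongrightarrow> 0) at_infinity"
proof -
  define G where "G = weighted q 0 F"
  have nG: "norm (G w) = norm (F w) * norm (w + \<i>) powr q * exp (- 2 * Im w)" for w
    by (simp add: G_def norm_weighted)
  have contG: "isCont G (of_real x)" for x unfolding G_def by (rule isCont_weighted[OF F])
  have contR: "continuous_on UNIV (\<lambda>t. G (of_real t))"
    by (rule continuous_on_of_real_compose[OF contG])
  have contRp: "continuous_on UNIV (\<lambda>t. norm (G (of_real t)) powr p)"
    using p by (intro continuous_on_powr' continuous_intros contR) auto
  have intG: "integrable lborel (\<lambda>t. norm (G (of_real t)) powr p)"
  proof (rule Bochner_Integration.integrable_bound)
    \<comment> \<open>On [-1, 1] the integrability comes from continuity; for |t| >= 1 the weights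
      |t + i| and |t| agree up to a factor 2.\<close>
    have "integrable lborel (\<lambda>t. indicator {-1..1} t *\<^sub>R (norm (G (of_real t)) powr p))"
      by (rule borel_integrable_compact) (auto intro: continuous_on_subset[OF contRp])
    then show "integrable lborel (\<lambda>t. indicator {-1..1} t * norm (G (of_real t)) powr p
        + (2 powr \<bar>q\<bar>) powr p * (indicator {t. 1 \<le> \<bar>t\<bar>} t * norm (F (of_real t) * of_real (\<bar>t\<bar> powr q)) powr p))"
      using int by auto
    show "(\<lambda>t. norm (G (of_real t)) powr p) \<in> borel_measurable lborel"
      using borel_measurable_continuous_onI[OF contRp] by simp
    show "AE t in lborel. norm (norm (G (of_real t)) powr p) \<le> norm (indicator {-1..1} t * norm (G (of_real t)) powr p
        + (2 powr \<bar>q\<bar>) powr p * (indicator {t. 1 \<le> \<bar>t\<bar>} t * norm (F (of_real t) * of_real (\<bar>t\<bar> powr q)) powr p))"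
    proof (rule AE_I2)
      fix t :: real
      show "norm (norm (G (of_real t)) powr p) \<le> norm (indicator {-1..1} t * norm (G (of_real t)) powr p
        + (2 powr \<bar>q\<bar>) powr p * (indicator {t. 1 \<le> \<bar>t\<bar>} t * norm (F (of_real t) * of_real (\<bar>t\<bar> powr q)) powr p))"
      proof (cases "1 \<le> \<bar>t\<bar>")
        case True
        have "\<bar>t\<bar> \<le> norm (of_real t + \<i>)" using abs_Re_le_cmod[of "of_real t + \<i>"] by simp
        moreover have "norm (of_real t + \<i>) \<le> 2 * \<bar>t\<bar>"
          using norm_triangle_ineq[of "of_real t" \<i>] True by simp
        ultimately have "norm (of_real t + \<i>) powr q \<le> 2 powr \<bar>q\<bar> * \<bar>t\<bar> powr q"
          using True by (intro powr_comparable(1)) auto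
        then have "norm (G (of_real t)) \<le> 2 powr \<bar>q\<bar> * norm (F (of_real t) * of_real (\<bar>t\<bar> powr q))"
          unfolding nG by (drule_tac mult_left_mono[of _ _ "norm (F (of_real t))"]) (auto simp: norm_mult mult_ac)
        then have "norm (G (of_real t)) powr p \<le> (2 powr \<bar>q\<bar> * norm (F (of_real t) * of_real (\<bar>t\<bar> powr q))) powr p"
          using p by (intro powr_mono2) auto
        also have "\<dots> = (2 powr \<bar>q\<bar>) powr p * norm (F (of_real t) * of_real (\<bar>t\<bar> powr q)) powr p"
          by (rule powr_mult)
        finally show ?thesis using True by (simp add: add_increasing indicator_def)
      qed (auto simp: indicator_def abs_le_iff)
    qed
  qed
  obtain C where C: "\<And>w. 0 < Im w \<Longrightarrow> norm (G w) \<le> C * exp (3 * norm w)"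
    and im: "\<And>e. 0 < e \<Longrightarrow> \<exists>C. \<forall>y>0. norm (G (\<i> * of_real y)) \<le> C * exp (e * y)"
    using weighted_growth[OF gr] unfolding G_def by blast
  have "((\<lambda>x. G (of_real x + \<i>)) \<longlongrightarrow> 0) at_infinity"
  proof (rule integrable_powr_imp_tendsto_0[OF _ contG _ im p intG])
    show "G holomorphic_on {w. 0 < Im w}"
      unfolding G_def by (rule holomorphic_on_subset[OF holomorphic_on_weighted[OF F]]) auto
    show "norm (G w) \<le> C * exp (3 * norm w)" if "w \<in> {w. 0 < Im w}" for w
      using that by (intro C) simp
  qed
  then have "((\<lambda>x. 3 powr \<bar>q\<bar> * exp 2 * norm (G (of_real x + \<i>))) \<longlongrightarrow> 3 powr \<bar>q\<bar> * exp 2 * 0) at_infinity"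
    by (intro tendsto_mult tendsto_const tendsto_norm_zero)
  then have lim: "((\<lambda>x. 3 powr \<bar>q\<bar> * exp 2 * norm (G (of_real x + \<i>))) \<longlongrightarrow> 0) at_infinity" by simp
  show ?thesis
  proof (rule Lim_null_comparison[OF _ lim])
    show "\<forall>\<^sub>F x in at_infinity. norm (norm (F (of_real x + \<i>)) * \<bar>x\<bar> powr q) \<le> 3 powr \<bar>q\<bar> * exp 2 * norm (G (of_real x + \<i>))"
      unfolding eventually_at_infinity
    proof (intro exI[of _ 1] allI impI)
      fix x :: real assume x: "1 \<le> norm x"
      define y where "y = norm (of_real x + \<i> + \<i>)"
      have "\<bar>x\<bar> \<le> y" using abs_Re_le_cmod[of "of_real x + \<i> + \<i>"] by (simp add: y_def)
      moreover have "y \<le> 3 * \<bar>x\<bar>"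
        unfolding y_def using norm_triangle_ineq[of "of_real x" "\<i> + \<i>"] norm_triangle_ineq[of \<i> \<i>] x
        by (simp add: add.assoc)
      ultimately have "\<bar>x\<bar> powr q \<le> 3 powr \<bar>q\<bar> * y powr q"
        using x by (intro powr_comparable(2)) auto
      then have "norm (F (of_real x + \<i>)) * \<bar>x\<bar> powr q \<le> norm (F (of_real x + \<i>)) * (3 powr \<bar>q\<bar> * y powr q)"
        by (intro mult_left_mono) auto
      also have "\<dots> = 3 powr \<bar>q\<bar> * (exp 2 * exp (-2)) * (norm (F (of_real x + \<i>)) * y powr q)"
        by (simp add: exp_minus)
      also have "\<dots> = 3 powr \<bar>q\<bar> * exp 2 * norm (G (of_real x + \<i>))"
        by (simp add: nG y_def)
      finally show "norm (norm (F (of_real x + \<i>)) * \<bar>x\<bar> powr q) \<le> 3 powr \<bar>q\<bar> * exp 2 * norm (G (of_real x + \<i>))"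
        by simp
    qed
  qed
qed

text \<open>Starting from the line Im w = -1 makes the conclusion hold up to and on the real axis.
  Phragmen-Lindeloef first gives boundedness of the shifted weighted function; a second application
  to a modified function turns decay on the boundary into decay in all directions.\<close>

lemma exponential_type_decay_upper:
  assumes F: "F holomorphic_on UNIV"
    and gr: "\<And>e. 0 < e \<Longrightarrow> \<exists>C. \<forall>w. norm (F w) \<le> C * exp ((2 + e) * norm w)"
    and line: "((\<lambda>x. norm (F (of_real x - \<i>)) * \<bar>x\<bar> powr q) \<longlongrightarrow> 0) at_infinity"
    and e: "0 < e"
  shows "\<exists>X. \<forall>w. 0 \<le> Im w \<longrightarrow> X \<le> norm w \<longrightarrow> norm (F w) * norm w powr q * exp (- 2 * Im w) \<le> e"
proof -
  define G where "G = weighted q 1 F"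
  have nG: "norm (G w) = norm (F (w - \<i>)) * norm (w + \<i>) powr q * exp (- 2 * Im w)" for w
    by (simp add: G_def norm_weighted)
  have contG: "isCont G (of_real x)" for x unfolding G_def by (rule isCont_weighted[OF F])
  have holG: "G holomorphic_on {w. 0 < Im w}"
    unfolding G_def by (rule holomorphic_on_subset[OF holomorphic_on_weighted[OF F]]) auto
  have limG: "((\<lambda>x. G (of_real x)) \<longlongrightarrow> 0) at_infinity"
  proof (rule Lim_null_comparison)
    have "((\<lambda>x. 2 powr \<bar>q\<bar> * (norm (F (of_real x - \<i>)) * \<bar>x\<bar> powr q)) \<longlongrightarrow> 2 powr \<bar>q\<bar> * 0) at_infinity"
      by (intro tendsto_mult tendsto_const line)
    then show "((\<lambda>x. 2 powr \<bar>q\<bar> * (norm (F (of_real x - \<i>)) * \<bar>x\<bar> powr q)) \<longlongrightarrow> 0) at_infinity" by simp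
    show "\<forall>\<^sub>F x in at_infinity. norm (G (of_real x)) \<le> 2 powr \<bar>q\<bar> * (norm (F (of_real x - \<i>)) * \<bar>x\<bar> powr q)"
      unfolding eventually_at_infinity
    proof (intro exI[of _ 1] allI impI)
      fix x :: real assume x: "1 \<le> norm x"
      have "\<bar>x\<bar> \<le> norm (of_real x + \<i>)" using abs_Re_le_cmod[of "of_real x + \<i>"] by simp
      moreover have "norm (of_real x + \<i>) \<le> 2 * \<bar>x\<bar>"
        using norm_triangle_ineq[of "of_real x" \<i>] x by simp
      ultimately have "norm (of_real x + \<i>) powr q \<le> 2 powr \<bar>q\<bar> * \<bar>x\<bar> powr q"
        using x by (intro powr_comparable(1)) auto
      then have "norm (F (of_real x - \<i>)) * norm (of_real x + \<i>) powr q \<le> norm (F (of_real x - \<i>)) * (2 powr \<bar>q\<bar> * \<bar>x\<bar> powr q)"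
        by (intro mult_left_mono) auto
      then show "norm (G (of_real x)) \<le> 2 powr \<bar>q\<bar> * (norm (F (of_real x - \<i>)) * \<bar>x\<bar> powr q)"
        by (simp add: nG mult_ac)
    qed
  qed
  have small: "\<exists>X>0. \<forall>x. X \<le> \<bar>x\<bar> \<longrightarrow> norm (G (of_real x)) \<le> d" if "0 < d" for d
  proof -
    have "\<forall>\<^sub>F x in at_infinity. dist (G (of_real x)) 0 < d" using limG that by (rule tendstoD)
    then obtain b where "\<And>x. b \<le> \<bar>x\<bar> \<Longrightarrow> norm (G (of_real x)) < d"
      by (auto simp: eventually_at_infinity)
    then show ?thesis by (intro exI[of _ "max b 1"]) (auto intro: less_imp_le)
  qed
  have "\<exists>M. \<forall>x. norm (G (of_real x)) \<le> M"
  proof -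
    obtain X where X: "X > 0" "\<And>x. X \<le> \<bar>x\<bar> \<Longrightarrow> norm (G (of_real x)) \<le> 1" using small[of 1] by auto
    have "continuous_on {-X..X} (\<lambda>x. G (of_real x))"
      by (rule continuous_on_of_real_compose[OF contG])
    then have "bounded ((\<lambda>x. G (of_real x)) ` {-X..X})"
      by (intro compact_imp_bounded compact_continuous_image) auto
    then obtain K where K: "\<And>x. x \<in> {-X..X} \<Longrightarrow> norm (G (of_real x)) \<le> K"
      unfolding bounded_iff by (metis imageI)
    have "norm (G (of_real x)) \<le> max K 1" for x
      using K[of x] X(2)[of x] by (cases "X \<le> \<bar>x\<bar>") (auto simp: abs_le_iff not_le abs_less_iff le_max_iff_disj)
    then show ?thesis by blast
  qed
  then obtain M where M: "\<And>x. norm (G (of_real x)) \<le> M" by blast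
  have M0: "0 \<le> M" using M[of 0] norm_ge_zero order_trans by blast
  obtain C where C: "\<And>w. 0 < Im w \<Longrightarrow> norm (G w) \<le> C * exp (3 * norm w)"
    and im: "\<And>e. 0 < e \<Longrightarrow> \<exists>C. \<forall>y>0. norm (G (\<i> * of_real y)) \<le> C * exp (e * y)"
    using weighted_growth[OF gr] unfolding G_def by blast
  have GM: "norm (G w) \<le> M" if w: "0 < Im w" for w
  proof (rule phragmen_lindeloef_half_plane[OF holG M0 _ _ im])
    show "\<forall>\<^sub>F w in at (of_real x) within {w. 0 < Im w}. norm (G w) \<le> M + d" if "0 < d" for x d
      by (rule isCont_eventually_norm_le[OF contG M that])
    show "norm (G w) \<le> C * exp (3 * norm w)" if "w \<in> {w. 0 < Im w}" for w
      using that by (intro C) simp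
  qed (use w in auto)
  have Gsmall: "\<exists>L>0. \<forall>w. 0 < Im w \<longrightarrow> L \<le> norm w \<longrightarrow> norm (G w) \<le> 2 * d" if d: "0 < d" for d
  proof -
    obtain X where X: "X > 0" "\<And>x. X \<le> \<bar>x\<bar> \<Longrightarrow> norm (G (of_real x)) \<le> d" using small[OF d] by auto
    define L where "L = M * X / d + 1"
    have L: "L > 0" "M * X \<le> d * L" using M0 X d by (auto simp: L_def field_simps add_pos_nonneg)
    \<comment> \<open>The factor w / (w + iL) has modulus at most 1 in the closed half-plane and at
      most X / L at real points with |x| < X, where only |G| <= M is known; \<open>L\<close> makes M
      X / L <= d. For |w| >= L dividing it out again costs at most a factor 2.\<close>
    define f where "f w = G w * (w / (w + \<i> * of_real L))" for w
    have nz: "w + \<i> * of_real L \<noteq> 0" if "0 \<le> Im w" for w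
      using that L by (auto simp: complex_eq_iff)
    have le: "norm w \<le> norm (w + \<i> * of_real L)" if "0 \<le> Im w" for w
      using that L by (intro norm_le_norm_add_imaginary) auto
    have fle: "norm (f w) \<le> d" if w: "0 < Im w" for w
    proof (rule phragmen_lindeloef_half_plane_bounded[of f])
      show "f holomorphic_on {w. 0 < Im w}"
        unfolding f_def using nz by (intro holomorphic_intros holG) auto
      show "norm (f w) \<le> M" if "w \<in> {w. 0 < Im w}" for w
      proof -
        have "norm (w / (w + \<i> * of_real L)) \<le> 1"
          using le[of w] nz[of w] that by (auto simp: norm_divide divide_le_eq_1)
        then have "norm (f w) \<le> norm (G w)"
          unfolding f_def norm_mult by (intro mult_left_le) auto
        then show ?thesis using GM[of w] that by simp
      qed
      fix x h :: real assume h: "0 < h"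
      show "\<forall>\<^sub>F w in at (of_real x) within {w. 0 < Im w}. norm (f w) \<le> d + h"
      proof (rule isCont_eventually_norm_le[OF _ _ h])
        show "isCont f (of_real x)"
          unfolding f_def using nz[of "of_real x"] by (intro continuous_intros contG) auto
        show "norm (f (of_real x)) \<le> d"
        proof (cases "X \<le> \<bar>x\<bar>")
          case True
          have "norm (of_real x / (of_real x + \<i> * of_real L)) \<le> 1"
            using le[of "of_real x"] nz[of "of_real x"] by (auto simp: norm_divide divide_le_eq_1)
          then have "norm (f (of_real x)) \<le> norm (G (of_real x))"
            unfolding f_def norm_mult by (intro mult_left_le) auto
          then show ?thesis using X(2)[OF True] by simp
        next
          case False
          have "L \<le> norm (of_real x + \<i> * of_real L)"
            using abs_Im_le_cmod[of "of_real x + \<i> * of_real L"] L by simp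
          then have "norm (of_real x / (of_real x + \<i> * of_real L)) \<le> X / L"
            unfolding norm_divide using False L X by (intro frac_le) auto
          then have "norm (f (of_real x)) \<le> M * (X / L)"
            unfolding f_def norm_mult using M[of x] M0 by (intro mult_mono) auto
          also have "\<dots> \<le> d" using L by (simp add: field_simps)
          finally show ?thesis .
        qed
      qed
    qed (use w d in auto)
    have "norm (G w) \<le> 2 * d" if w: "0 < Im w" "L \<le> norm w" for w
    proof -
      have "norm (w + \<i> * of_real L) \<le> norm w + L"
        using norm_triangle_ineq[of w "\<i> * of_real L"] L by (simp add: norm_mult)
      then have a: "norm (w + \<i> * of_real L) \<le> 2 * norm w" using w by simp
      have "norm (G w) * norm w \<le> d * norm (w + \<i> * of_real L)"
        using fle[OF w(1)] nz[of w] w by (simp add: f_def norm_mult norm_divide field_simps)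
      also have "\<dots> \<le> d * (2 * norm w)" using a d by (intro mult_left_mono) auto
      finally have "norm (G w) * norm w \<le> (2 * d) * norm w" by simp
      moreover have "norm w > 0" using w L by linarith
      ultimately show ?thesis by (simp add: mult_le_cancel_right)
    qed
    then show ?thesis using L by blast
  qed
  \<comment> \<open>The factor \<open>3 powr \<bar>q\<bar>\<close> pays for replacing |w + 2i| by
    |w|, \<open>exp 2\<close> for evaluating \<open>G\<close> at w + i, and 2 is the loss in
    \<open>Gsmall\<close>.\<close>
  define d where "d = e / (2 * (3 powr \<bar>q\<bar> * exp 2))"
  have d: "d > 0" using e by (simp add: d_def)
  obtain L where L: "L > 0" "\<And>w. 0 < Im w \<Longrightarrow> L \<le> norm w \<Longrightarrow> norm (G w) \<le> 2 * d"
    using Gsmall[OF d] by blast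
  show ?thesis
  proof (intro exI[of _ "L + 1"] allI impI)
    fix w assume w: "0 \<le> Im w" "L + 1 \<le> norm w"
    define y where "y = norm (w + \<i> + \<i>)"
    have "norm w \<le> y"
      unfolding y_def using norm_le_norm_add_imaginary[of w 2] w by (simp add: add.assoc mult.commute)
    moreover have "y \<le> 3 * norm w"
      unfolding y_def using norm_triangle_ineq[of w "\<i> + \<i>"] norm_triangle_ineq[of \<i> \<i>] w L
      by (simp add: add.assoc)
    ultimately have cmp: "norm w powr q \<le> 3 powr \<bar>q\<bar> * y powr q"
      using w L by (intro powr_comparable(2)) auto
    have "norm w \<le> norm (w + \<i>)"
      using norm_le_norm_add_imaginary[of w 1] w by simp
    then have "norm (G (w + \<i>)) \<le> 2 * d" using w L(2)[of "w + \<i>"] by simp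
    then have g: "norm (F w) * y powr q * exp (- 2 * (Im w + 1)) \<le> 2 * d"
      by (simp add: nG y_def)
    have "norm (F w) * norm w powr q * exp (- 2 * Im w) \<le> norm (F w) * (3 powr \<bar>q\<bar> * y powr q) * exp (- 2 * Im w)"
      using cmp by (intro mult_left_mono mult_right_mono) auto
    also have "\<dots> = norm (F w) * (3 powr \<bar>q\<bar> * y powr q) * (exp 2 * exp (- 2 * (Im w + 1)))"
      by (simp add: exp_add[symmetric])
    also have "\<dots> = (3 powr \<bar>q\<bar> * exp 2) * (norm (F w) * y powr q * exp (- 2 * (Im w + 1)))"
      by (simp only: mult_ac)
    also have "\<dots> \<le> (3 powr \<bar>q\<bar> * exp 2) * (2 * d)"
      using g by (intro mult_left_mono) auto
    also have "\<dots> = e" by (simp add: d_def)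
    finally show "norm (F w) * norm w powr q * exp (- 2 * Im w) \<le> e" .
  qed
qed

lemma exponential_type_decay:
  fixes F :: "complex \<Rightarrow> complex"
  assumes F: "F holomorphic_on UNIV" and ty: "exp_type_le F 2" and p: "0 < p"
    and fin: "(\<integral>\<^sup>+ t. ennreal (indicator {t. 1 \<le> \<bar>t\<bar>} t *
            norm (F (of_real t) * of_real (\<bar>t\<bar> powr q)) powr p) \<partial>lborel) < \<infinity>"
  shows "((\<lambda>w. norm (F w) * norm w powr q * exp (- 2 * \<bar>Im w\<bar>)) \<longlongrightarrow> 0) at_infinity"
proof -
  let ?h = "\<lambda>F t. indicator {t. 1 \<le> \<bar>t\<bar>} t * norm (F (of_real t) * of_real (\<bar>t\<bar> powr q)) powr p"
  \<comment> \<open>The reflection exchanges the half-planes: decay of \<open>F'\<close> on Im w = 1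
    is decay of \<open>F\<close> on Im w = -1, and conversely, so each function supplies the
    boundary line for the other.\<close>
  define F' where "F' w = F (- w)" for w
  have F': "F' holomorphic_on UNIV"
    unfolding F'_def by (rule holomorphic_on_compose_gen[OF _ F, unfolded o_def]) (auto intro!: holomorphic_intros)
  have gr: "\<exists>C. \<forall>w. norm (F w) \<le> C * exp ((2 + e) * norm w)" if "0 < e" for e
    using exp_type_le_bound[OF F ty _ that] by simp
  then have gr': "\<exists>C. \<forall>w. norm (F' w) \<le> C * exp ((2 + e) * norm w)" if "0 < e" for e
    using that unfolding F'_def by (metis norm_minus_cancel)
  have "continuous_on UNIV (\<lambda>t. F (of_real t))"
    by (rule continuous_on_compose2[OF holomorphic_on_imp_continuous_on[OF F]]) (auto intro!: continuous_intros)
  then have [measurable]: "(\<lambda>t. F (of_real t)) \<in> borel_measurable borel"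
    by (rule borel_measurable_continuous_onI)
  have int: "integrable lborel (?h F)"
  proof (rule integrableI_nonneg)
    show "?h F \<in> borel_measurable lborel" by measurable
    show "(\<integral>\<^sup>+ t. ennreal (?h F t) \<partial>lborel) < \<infinity>" by (rule fin)
  qed (auto simp: indicator_def)
  have int': "integrable lborel (?h F')"
    using lborel_integrable_real_affine[OF int, of "-1" 0] by (simp add: F'_def indicator_def)
  note l = exponential_type_decay_on_line[OF F gr p int] exponential_type_decay_on_line[OF F' gr' p int']
  have neg: "filterlim (uminus :: real \<Rightarrow> real) at_infinity at_infinity"
    unfolding filterlim_iff eventually_at_infinity by (metis norm_minus_cancel)
  have l1: "((\<lambda>x. norm (F (of_real x - \<i>)) * \<bar>x\<bar> powr q) \<longlongrightarrow> 0) at_infinity"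
    using filterlim_compose[OF l(2) neg] by (simp add: F'_def)
  have l2: "((\<lambda>x. norm (F' (of_real x - \<i>)) * \<bar>x\<bar> powr q) \<longlongrightarrow> 0) at_infinity"
    using filterlim_compose[OF l(1) neg] by (simp add: F'_def add.commute)
  show ?thesis
  proof (rule tendstoI)
    fix e :: real assume e: "0 < e"
    then have e2: "0 < e / 2" by simp
    obtain X where X: "\<And>w. 0 \<le> Im w \<Longrightarrow> X \<le> norm w \<Longrightarrow> norm (F w) * norm w powr q * exp (- 2 * Im w) \<le> e / 2"
      using exponential_type_decay_upper[OF F gr l1 e2] by blast
    obtain Y where Y: "\<And>w. 0 \<le> Im w \<Longrightarrow> Y \<le> norm w \<Longrightarrow> norm (F' w) * norm w powr q * exp (- 2 * Im w) \<le> e / 2"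
      using exponential_type_decay_upper[OF F' gr' l2 e2] by blast
    have "norm (F w) * norm w powr q * exp (- 2 * \<bar>Im w\<bar>) \<le> e / 2" if "max X Y \<le> norm w" for w
      using X[of w] Y[of "- w"] that by (cases "0 \<le> Im w") (auto simp: F'_def)
    then have "\<forall>w. max X Y \<le> norm w \<longrightarrow> dist (norm (F w) * norm w powr q * exp (- 2 * \<bar>Im w\<bar>)) 0 < e"
      using e by (force simp: dist_real_def)
    then show "\<forall>\<^sub>F w in at_infinity. dist (norm (F w) * norm w powr q * exp (- 2 * \<bar>Im w\<bar>)) 0 < e"
      unfolding eventually_at_infinity by blast
  qed
qed

section \<open>The functions \<open>A\<^sub>\<nu>\<close> and \<open>B\<^sub>\<nu>\<close>\<close>

definition bessel_coeff :: "real \<Rightarrow> nat \<Rightarrow> nat \<Rightarrow> complex" where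
  "bessel_coeff nu k n = (-1) ^ n / of_real (fact n * pochhammer (nu + 1) (n + k))"

text \<open>At t = (z/2)^2 this is \<Gamma>(\<nu>+1) (z/2)^(-\<nu>-k) J_(\<nu>+k)(z). As an entire
  function of t it avoids branches, and differentiation in t just raises \<open>k\<close> and
  changes the sign.\<close>

definition bessel_series :: "real \<Rightarrow> nat \<Rightarrow> complex \<Rightarrow> complex" where
  "bessel_series nu k t = (\<Sum>n. bessel_coeff nu k n * t ^ n)"

lemma summable_bessel_series:
  assumes nu: "nu > -1"
  shows "summable (\<lambda>n. bessel_coeff nu k n * t ^ n)"
proof -
  obtain N :: nat where N: "2 * norm t \<le> real N" using real_arch_simple by blast
  show ?thesis
  proof (rule summable_ratio_test[of "1/2" "N + 1"])
    fix n assume n: "N + 1 \<le> n"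
    have pos: "0 < pochhammer (nu + 1) m" for m using nu by (intro pochhammer_pos) auto
    have st: "bessel_coeff nu k (Suc n) * t ^ Suc n =
        (bessel_coeff nu k n * t ^ n) * (- t / of_real ((real n + 1) * (nu + 1 + real (n + k))))"
      using pos by (simp add: bessel_coeff_def pochhammer_Suc field_simps)
    have "1 \<le> nu + 1 + real (n + k)" using nu n by simp
    then have "2 * norm t \<le> (real n + 1) * (nu + 1 + real (n + k))"
      using mult_mono[of "2 * norm t" "real n + 1" 1 "nu + 1 + real (n + k)"] N n by simp
    moreover have "0 < (real n + 1) * (nu + 1 + real (n + k))"
      using \<open>1 \<le> nu + 1 + real (n + k)\<close> by (intro mult_pos_pos) auto
    ultimately have "norm (- t / of_real ((real n + 1) * (nu + 1 + real (n + k)))) \<le> 1 / 2"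
      unfolding norm_divide norm_minus_cancel norm_of_real by (simp add: field_simps del: of_nat_add)
    then show "norm (bessel_coeff nu k (Suc n) * t ^ Suc n) \<le> 1 / 2 * norm (bessel_coeff nu k n * t ^ n)"
      unfolding st norm_mult[of "bessel_coeff nu k n * t ^ n"]
      by (subst mult.commute) (rule mult_right_mono, auto)
  qed simp
qed

lemma Abes_eq_series: "Abes nu z = bessel_series nu 0 ((z / 2)\<^sup>2)"
  by (simp add: Abes_def bessel_series_def bessel_coeff_def power_mult)

lemma Bbes_eq_series: 
  assumes "nu > -1"
  shows "Bbes nu z = z / 2 * bessel_series nu 1 ((z / 2)\<^sup>2)"
proof -
  have "bessel_series nu 1 ((z / 2)\<^sup>2) * (z / 2) = (\<Sum>n. bessel_coeff nu 1 n * ((z / 2)\<^sup>2) ^ n * (z / 2))"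
    unfolding bessel_series_def by (rule suminf_mult2[OF summable_bessel_series[OF assms]])
  also have "\<dots> = Bbes nu z"
    unfolding Bbes_def by (rule suminf_cong) (simp add: bessel_coeff_def power_mult, simp add: mult_ac)
  finally show ?thesis by (simp add: mult.commute)
qed

lemma diffs_bessel_coeff:
  assumes "nu > -1"
  shows "diffs (bessel_coeff nu k) n = - bessel_coeff nu (Suc k) n"
proof -
  have "pochhammer (nu + 1) (Suc (n + k)) \<noteq> 0" using pochhammer_pos[of "nu + 1" "Suc (n + k)"] assms by simp
  then show ?thesis
    by (simp add: diffs_def bessel_coeff_def field_simps del: of_nat_Suc)
qed

lemma has_field_derivative_bessel_series:
  assumes "nu > -1"
  shows "(bessel_series nu k has_field_derivative - bessel_series nu (Suc k) t) (at t)"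
proof -
  have "((\<lambda>t. \<Sum>n. bessel_coeff nu k n * t ^ n) has_field_derivative
      (\<Sum>n. diffs (bessel_coeff nu k) n * t ^ n)) (at t)"
    by (rule termdiffs_strong_converges_everywhere[OF summable_bessel_series[OF assms]])
  also have "(\<lambda>t. \<Sum>n. bessel_coeff nu k n * t ^ n) = bessel_series nu k"
    by (simp add: bessel_series_def fun_eq_iff)
  also have "(\<Sum>n. diffs (bessel_coeff nu k) n * t ^ n) = - bessel_series nu (Suc k) t"
    unfolding diffs_bessel_coeff[OF assms] bessel_series_def mult_minus_left
    by (rule suminf_minus[OF summable_bessel_series[OF assms]])
  finally show ?thesis .
qed

text \<open>The classical relation J_\<nu> + J_(\<nu>+2) = (2(\<nu>+1)/z) J_(\<nu>+1).
  Coefficientwise, t d/dt contributes n, and n + \<nu> + 1 cancels the last factor of the Pochhammer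
  symbol.\<close>

lemma bessel_series_recurrence:
  assumes nu: "nu > -1"
  shows "- t * bessel_series nu 2 t + of_real (nu + 1) * bessel_series nu 1 t = bessel_series nu 0 t"
proof -
  have s2: "(\<lambda>n. bessel_coeff nu 2 n * t ^ n) sums bessel_series nu 2 t"
    unfolding bessel_series_def by (rule summable_sums[OF summable_bessel_series[OF nu]])
  have s1: "(\<lambda>n. bessel_coeff nu 1 n * t ^ n) sums bessel_series nu 1 t"
    unfolding bessel_series_def by (rule summable_sums[OF summable_bessel_series[OF nu]])
  have d: "diffs (bessel_coeff nu 1) n * t ^ n = - (bessel_coeff nu 2 n * t ^ n)" for n
    using diffs_bessel_coeff[OF nu, of 1 n] by (simp add: numeral_2_eq_2)
  have "summable (\<lambda>n. diffs (bessel_coeff nu 1) n * t ^ n)"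
    unfolding d by (intro summable_minus summable_bessel_series nu)
  from diffs_equiv[OF this]
  have "(\<lambda>n. of_nat n * bessel_coeff nu 1 n * t ^ (n - Suc 0)) sums (- bessel_series nu 2 t)"
    unfolding d using suminf_minus[OF summable_bessel_series[OF nu, of 2 t]]
    by (simp add: bessel_series_def)
  from sums_mult[OF this, of t]
  have "(\<lambda>n. t * (of_nat n * bessel_coeff nu 1 n * t ^ (n - Suc 0))) sums (- t * bessel_series nu 2 t)"
    by simp
  moreover have "t * (of_nat n * bessel_coeff nu 1 n * t ^ (n - Suc 0)) = of_nat n * bessel_coeff nu 1 n * t ^ n" for n
    by (cases n) auto
  ultimately have "(\<lambda>n. of_nat n * bessel_coeff nu 1 n * t ^ n) sums (- t * bessel_series nu 2 t)"
    by (simp only:)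
  from sums_add[OF this sums_mult[OF s1, of "of_real (nu + 1)"]]
  have "(\<lambda>n. of_nat n * bessel_coeff nu 1 n * t ^ n + of_real (nu + 1) * (bessel_coeff nu 1 n * t ^ n))
     sums (- t * bessel_series nu 2 t + of_real (nu + 1) * bessel_series nu 1 t)" .
  moreover have "of_nat n * bessel_coeff nu 1 n * t ^ n + of_real (nu + 1) * (bessel_coeff nu 1 n * t ^ n)
      = bessel_coeff nu 0 n * t ^ n" for n
  proof -
    have "pochhammer (nu + 1) n > 0" "nu + 1 + real n > 0" using nu by (auto intro: pochhammer_pos)
    then have "of_real (real n + (nu + 1)) * bessel_coeff nu 1 n = bessel_coeff nu 0 n"
    proof -
      have "(real n + (nu + 1)) * (1 / (fact n * pochhammer (nu + 1) (n + 1))) = 1 / (fact n * pochhammer (nu + 1) n)"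
        using \<open>pochhammer (nu + 1) n > 0\<close> \<open>nu + 1 + real n > 0\<close>
        by (simp add: pochhammer_Suc divide_simps)
      then have "(of_real (real n + (nu + 1)) * of_real (1 / (fact n * pochhammer (nu + 1) (n + 1))) :: complex)
          = of_real (1 / (fact n * pochhammer (nu + 1) n))"
        unfolding of_real_mult[symmetric] by (rule arg_cong)
      then have "(-1) ^ n * (of_real (real n + (nu + 1)) * of_real (1 / (fact n * pochhammer (nu + 1) (n + 1))))
          = (-1) ^ n * (of_real (1 / (fact n * pochhammer (nu + 1) n)) :: complex)"
        by (rule arg_cong)
      then show ?thesis by (simp add: bessel_coeff_def mult.commute)
    qed
    then have "of_real (real n + (nu + 1)) * bessel_coeff nu 1 n * t ^ n = bessel_coeff nu 0 n * t ^ n"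
      by simp
    then show ?thesis by (simp add: algebra_simps)
  qed
  ultimately have "(\<lambda>n. bessel_coeff nu 0 n * t ^ n) sums
      (- t * bessel_series nu 2 t + of_real (nu + 1) * bessel_series nu 1 t)" by simp
  then show ?thesis unfolding bessel_series_def[of nu 0] by (rule sums_unique)
qed

lemma has_field_derivative_bessel_series_square:
  assumes "nu > -1"
  shows "((\<lambda>z. bessel_series nu k ((z / 2)\<^sup>2)) has_field_derivative
       - bessel_series nu (Suc k) ((z / 2)\<^sup>2) * (z / 2)) (at z)"
proof (rule DERIV_chain2[where f = "bessel_series nu k" and g = "\<lambda>z. (z / 2)\<^sup>2"])
  show "(bessel_series nu k has_field_derivative - bessel_series nu (Suc k) ((z / 2)\<^sup>2)) (at ((z / 2)\<^sup>2))"
    by (rule has_field_derivative_bessel_series[OF assms])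
  show "((\<lambda>z. (z / 2)\<^sup>2) has_field_derivative z / 2) (at z)"
    by (auto intro!: derivative_eq_intros)
qed

lemma has_field_derivative_Abes:
  assumes "nu > -1"
  shows "(Abes nu has_field_derivative - Bbes nu z) (at z)"
proof -
  have "((\<lambda>z. bessel_series nu 0 ((z / 2)\<^sup>2)) has_field_derivative
       - bessel_series nu 1 ((z / 2)\<^sup>2) * (z / 2)) (at z)"
    using has_field_derivative_bessel_series_square[OF assms, of 0 z] by simp
  then show ?thesis
    unfolding Bbes_eq_series[OF assms] Abes_eq_series[abs_def] by (simp add: mult.commute)
qed

text \<open>Writing (2\<nu>+1) B/z through the series gives a form that is also valid at 0, which is
  a zero of \<open>Bbes\<close> and therefore a node of the second formula.\<close>

lemma has_field_derivative_Bbes: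
  assumes nu: "nu > -1"
  shows "(Bbes nu has_field_derivative
           Abes nu z - of_real (nu + 1 / 2) * bessel_series nu 1 ((z / 2)\<^sup>2)) (at z)"
proof -
  define t where "t = (z / 2)\<^sup>2"
  have d: "((\<lambda>z. bessel_series nu 1 ((z / 2)\<^sup>2)) has_field_derivative
       - bessel_series nu 2 t * (z / 2)) (at z)"
    using has_field_derivative_bessel_series_square[OF nu, of 1 z] by (simp add: t_def numeral_2_eq_2)
  have h: "((\<lambda>z::complex. z / 2) has_field_derivative 1 / 2) (at z)"
    by (auto intro!: derivative_eq_intros)
  have "((\<lambda>z. z / 2 * bessel_series nu 1 ((z / 2)\<^sup>2)) has_field_derivative
       1 / 2 * bessel_series nu 1 t + - bessel_series nu 2 t * (z / 2) * (z / 2)) (at z)"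
    using DERIV_mult[OF h d] by (simp add: t_def)
  moreover have "1 / 2 * bessel_series nu 1 t + - bessel_series nu 2 t * (z / 2) * (z / 2)
     = Abes nu z - of_real (nu + 1 / 2) * bessel_series nu 1 t"
    unfolding Abes_eq_series t_def[symmetric] bessel_series_recurrence[OF nu, of t, symmetric]
    by (simp add: t_def power2_eq_square algebra_simps)
  ultimately show ?thesis
    unfolding Bbes_eq_series[OF nu, abs_def] t_def by simp
qed

lemma has_field_derivative_Bbes':
  assumes nu: "nu > -1" and z: "z \<noteq> 0"
  shows "(Bbes nu has_field_derivative Abes nu z - of_real (2 * nu + 1) / z * Bbes nu z) (at z)"
proof -
  have "of_real (2 * nu + 1) / z * Bbes nu z = of_real (nu + 1 / 2) * bessel_series nu 1 ((z / 2)\<^sup>2)"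
    unfolding Bbes_eq_series[OF nu] using z by (simp add: field_simps)
  then show ?thesis using has_field_derivative_Bbes[OF nu, of z] by simp
qed

lemma bessel_series_0: "bessel_series nu k 0 = 1 / of_real (pochhammer (nu + 1) k)"
  unfolding bessel_series_def by (subst powser_zero) (simp add: bessel_coeff_def)

lemma Abes_0: "Abes nu 0 = 1" by (simp add: Abes_eq_series bessel_series_0)

lemma Bbes_0: "nu > -1 \<Longrightarrow> Bbes nu 0 = 0" by (simp add: Bbes_eq_series)

lemma deriv_Bbes_0:
  assumes "nu > -1"
  shows "deriv (Bbes nu) 0 = of_real (1 / (2 * (nu + 1)))"
proof -
  have "deriv (Bbes nu) 0 = of_real (1 - (nu + 1 / 2) / (nu + 1))"
    using DERIV_imp_deriv[OF has_field_derivative_Bbes[OF assms, of 0]]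
    by (simp add: Abes_0 bessel_series_0)
  also have "1 - (nu + 1 / 2) / (nu + 1) = 1 / (2 * (nu + 1))"
    using assms by (simp add: field_simps)
  finally show ?thesis .
qed

lemma holomorphic_Abes: "nu > -1 \<Longrightarrow> Abes nu holomorphic_on UNIV"
  using has_field_derivative_Abes by (auto simp: holomorphic_on_open)

lemma holomorphic_Bbes: "nu > -1 \<Longrightarrow> Bbes nu holomorphic_on UNIV"
  using has_field_derivative_Bbes by (auto simp: holomorphic_on_open)

lemma Abes_minus: "Abes nu (- z) = Abes nu z"
  by (simp add: Abes_eq_series)

lemma Bbes_minus: "nu > -1 \<Longrightarrow> Bbes nu (- z) = - Bbes nu z"
  by (simp add: Bbes_eq_series)

lemma cnj_bessel_series:
  assumes "nu > -1"
  shows "cnj (bessel_series nu k t) = bessel_series nu k (cnj t)"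
proof -
  have "cnj (bessel_series nu k t) = (\<Sum>n. cnj (bessel_coeff nu k n * t ^ n))"
    unfolding bessel_series_def
    by (rule bounded_linear.suminf[OF bounded_linear_cnj summable_bessel_series[OF assms]])
  also have "\<dots> = bessel_series nu k (cnj t)"
    unfolding bessel_series_def by (rule suminf_cong) (simp add: bessel_coeff_def)
  finally show ?thesis .
qed

lemma cnj_Abes: "nu > -1 \<Longrightarrow> cnj (Abes nu z) = Abes nu (cnj z)"
  by (simp add: Abes_eq_series cnj_bessel_series)

lemma cnj_Bbes: "nu > -1 \<Longrightarrow> cnj (Bbes nu z) = Bbes nu (cnj z)"
  by (simp add: Bbes_eq_series cnj_bessel_series)

section \<open>The first-order Bessel system: energy, zeros and lower bounds on circles\<close>

lemma has_real_derivative_Re_of_real: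
  assumes "(f has_field_derivative D) (at (of_real x))"
  shows "((\<lambda>t. Re (f (of_real t))) has_real_derivative Re D) (at x)"
  by (intro has_field_derivative_Re has_vector_derivative_real_field assms)

text \<open>With \<open>a = \<nu> + 1/2\<close>, both \<open>(w\<^sup>a A\<^sub>\<nu>, w\<^sup>a B\<^sub>\<nu>, a)\<close> and \<open>(w\<^sup>a B\<^sub>\<nu>, - w\<^sup>a A\<^sub>\<nu>, - a)\<close> are instances.\<close>

locale bessel_system =
  fixes a :: real and U V :: "complex \<Rightarrow> complex"
  assumes deriv_U: "\<And>w. 0 \<le> Re w \<Longrightarrow> w \<noteq> 0 \<Longrightarrow> (U has_field_derivative of_real a / w * U w - V w) (at w)"
    and deriv_V: "\<And>w. 0 \<le> Re w \<Longrightarrow> w \<noteq> 0 \<Longrightarrow> (V has_field_derivative U w - of_real a / w * V w) (at w)"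
    and real_U: "\<And>x. 0 < x \<Longrightarrow> U (of_real x) \<in> \<real>"
    and real_V: "\<And>x. 0 < x \<Longrightarrow> V (of_real x) \<in> \<real>"
    and nontrivial: "\<And>x. 0 < x \<Longrightarrow> U (of_real x) \<noteq> 0 \<or> V (of_real x) \<noteq> 0"
begin

definition u :: "real \<Rightarrow> real" where "u x = Re (U (of_real x))"
definition v :: "real \<Rightarrow> real" where "v x = Re (V (of_real x))"

lemma U_of_real: "0 < x \<Longrightarrow> U (of_real x) = of_real (u x)"
  using real_U[of x] by (simp add: u_def)

lemma V_of_real: "0 < x \<Longrightarrow> V (of_real x) = of_real (v x)"
  using real_V[of x] by (simp add: v_def)

lemma deriv_u: "0 < x \<Longrightarrow> (u has_real_derivative a / x * u x - v x) (at x)"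
  using has_real_derivative_Re_of_real[OF deriv_U[of "of_real x"]]
  by (simp add: U_of_real V_of_real flip: u_def)

lemma deriv_v: "0 < x \<Longrightarrow> (v has_real_derivative u x - a / x * v x) (at x)"
  using has_real_derivative_Re_of_real[OF deriv_V[of "of_real x"]]
  by (simp add: U_of_real V_of_real flip: v_def)

lemma energy_pos: "0 < x \<Longrightarrow> 0 < (u x)\<^sup>2 + (v x)\<^sup>2"
  using nontrivial[of x] by (auto simp: U_of_real V_of_real sum_power2_gt_zero_iff)

text \<open>The oscillating part of \<open>(u\<^sup>2 + v\<^sup>2)' = (2a/x)(u\<^sup>2 - v\<^sup>2)\<close> is removed by \<open>(u v)' = u\<^sup>2 - v\<^sup>2\<close>.\<close>

lemma energy_bounds:
  obtains x0 c C where "1 \<le> x0" "0 < c" "0 < C"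
    "\<And>x. x0 \<le> x \<Longrightarrow> c \<le> (u x)\<^sup>2 + (v x)\<^sup>2" "\<And>x. x0 \<le> x \<Longrightarrow> (u x)\<^sup>2 + (v x)\<^sup>2 \<le> C"
proof -
  define N where "N x = (u x)\<^sup>2 + (v x)\<^sup>2" for x
  define W where "W x = N x - 2 * a / x * (u x * v x)" for x
  \<comment> \<open>Makes the correction term of \<open>W\<close> at most a quarter of
    \<open>N\<close>, so that \<open>W\<close> and \<open>N\<close> are comparable.\<close>
  define x0 where "x0 = 4 * \<bar>a\<bar> + 1"
  define k where "k = 2 * \<bar>a\<bar>"
  have x0: "1 \<le> x0" by (simp add: x0_def)
  have k0: "0 \<le> k" by (simp add: k_def)
  have uv: "2 * \<bar>u x * v x\<bar> \<le> N x" for x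
    using sum_squares_bound[of "\<bar>u x\<bar>" "\<bar>v x\<bar>"] by (simp add: N_def abs_mult)
  have dW: "(W has_real_derivative 2 * a / x\<^sup>2 * (u x * v x)) (at x)" if "0 < x" for x
  proof -
    have 1: "((\<lambda>x. (u x)\<^sup>2 + (v x)\<^sup>2) has_real_derivative 2 * u x * (a / x * u x - v x) + 2 * v x * (u x - a / x * v x)) (at x)"
      using that by (auto intro!: derivative_eq_intros deriv_u deriv_v)
    have 2: "((\<lambda>x. 2 * a / x) has_real_derivative - (2 * a) / x\<^sup>2) (at x)"
      using that by (auto intro!: derivative_eq_intros simp: power2_eq_square)
    note 3 = DERIV_mult[OF deriv_u[OF that] deriv_v[OF that]]
    have "(W has_real_derivative 2 * u x * (a / x * u x - v x) + 2 * v x * (u x - a / x * v x)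
       - (- (2 * a) / x\<^sup>2 * (u x * v x) + ((a / x * u x - v x) * v x + (u x - a / x * v x) * u x) * (2 * a / x))) (at x)"
      unfolding W_def[abs_def] N_def by (rule DERIV_diff[OF 1 DERIV_mult[OF 2 3]])
    moreover have "2 * u x * (a / x * u x - v x) + 2 * v x * (u x - a / x * v x)
       - (- (2 * a) / x\<^sup>2 * (u x * v x) + ((a / x * u x - v x) * v x + (u x - a / x * v x) * u x) * (2 * a / x))
       = 2 * a / x\<^sup>2 * (u x * v x)"
      using that by (simp add: field_simps power2_eq_square)
    ultimately show ?thesis by (rule DERIV_cong)
  qed
  have close: "3/4 * N x \<le> W x" "W x \<le> 5/4 * N x" if "x0 \<le> x" for x
  proof -
    have x: "0 < x" using that x0 by simp
    have "\<bar>2 * a / x * (u x * v x)\<bar> = \<bar>a\<bar> / x * (2 * \<bar>u x * v x\<bar>)"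
      using x by (simp add: abs_mult)
    also have "\<dots> \<le> 1/4 * N x"
      using x that uv[of x] by (intro mult_mono) (auto simp: x0_def field_simps)
    finally show "3/4 * N x \<le> W x" "W x \<le> 5/4 * N x" unfolding W_def by linarith+
  qed
  have W'le: "\<bar>2 * a / x\<^sup>2 * (u x * v x)\<bar> \<le> k / x\<^sup>2 * W x" if "x0 \<le> x" for x
  proof -
    have "\<bar>2 * a / x\<^sup>2 * (u x * v x)\<bar> = \<bar>a\<bar> / x\<^sup>2 * (2 * \<bar>u x * v x\<bar>)" by (simp add: abs_mult)
    also have "\<dots> \<le> \<bar>a\<bar> / x\<^sup>2 * (2 * W x)"
      using uv[of x] close[OF that] by (intro mult_left_mono) auto
    finally show ?thesis by (simp add: k_def mult_ac)
  qed
  have W0: "0 < W x" if "x0 \<le> x" for x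
    using close(1)[OF that] energy_pos[of x] that x0 by (simp add: N_def)
  \<comment> \<open>|W'| <= k W / x^2, and k / x^2 is the derivative of - k / x. Hence W exp (- k/x)
    increases and W exp (k/x) decreases, while both factors tend to 1: \<open>W\<close> stays
    between positive constants.\<close>
  have incr: "W x0 * exp (- k / x0) \<le> W x * exp (- k / x)" if x: "x0 \<le> x" for x
  proof (rule DERIV_nonneg_imp_nondecreasing[OF x])
    fix y assume y: "x0 \<le> y" "y \<le> x"
    have y0: "0 < y" using y x0 by simp
    have der: "((\<lambda>x. W x * exp (- k / x)) has_real_derivative
        (2 * a / y\<^sup>2 * (u y * v y)) * exp (- k / y) + exp (- k / y) * (k / y\<^sup>2) * W y) (at y)"
      using y0 by (auto intro!: derivative_eq_intros dW simp: power2_eq_square)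
    have eq: "(2 * a / y\<^sup>2 * (u y * v y)) * exp (- k / y) + exp (- k / y) * (k / y\<^sup>2) * W y
       = exp (- k / y) * (2 * a / y\<^sup>2 * (u y * v y) + k / y\<^sup>2 * W y)" by (simp add: algebra_simps)
    have nn: "0 \<le> 2 * a / y\<^sup>2 * (u y * v y) + k / y\<^sup>2 * W y" using W'le[OF y(1)] by linarith
    show "\<exists>D. ((\<lambda>x. W x * exp (- k / x)) has_real_derivative D) (at y) \<and> 0 \<le> D"
      by (intro exI conjI, rule der, unfold eq, intro mult_nonneg_nonneg nn, simp)
  qed
  have decr: "- (W x0 * exp (k / x0)) \<le> - (W x * exp (k / x))" if x: "x0 \<le> x" for x
  proof (rule DERIV_nonneg_imp_nondecreasing[OF x])
    fix y assume y: "x0 \<le> y" "y \<le> x"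
    have y0: "0 < y" using y x0 by simp
    have der: "((\<lambda>x. - (W x * exp (k / x))) has_real_derivative
        - ((2 * a / y\<^sup>2 * (u y * v y)) * exp (k / y) + exp (k / y) * (- k / y\<^sup>2) * W y)) (at y)"
      using y0 by (auto intro!: derivative_eq_intros dW simp: power2_eq_square)
    have eq: "- ((2 * a / y\<^sup>2 * (u y * v y)) * exp (k / y) + exp (k / y) * (- k / y\<^sup>2) * W y)
       = exp (k / y) * (k / y\<^sup>2 * W y - 2 * a / y\<^sup>2 * (u y * v y))" by (simp add: algebra_simps)
    have nn: "0 \<le> k / y\<^sup>2 * W y - 2 * a / y\<^sup>2 * (u y * v y)" using W'le[OF y(1)] by linarith
    show "\<exists>D. ((\<lambda>x. - (W x * exp (k / x))) has_real_derivative D) (at y) \<and> 0 \<le> D"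
      by (intro exI conjI, rule der, unfold eq, intro mult_nonneg_nonneg nn, simp)
  qed
  show ?thesis
  proof (rule that[of x0 "4/5 * (W x0 * exp (- k / x0))" "4/3 * (W x0 * exp (k / x0))"])
    show "1 \<le> x0" by (rule x0)
    show "0 < 4/5 * (W x0 * exp (- k / x0))" "0 < 4/3 * (W x0 * exp (k / x0))" using W0[of x0] by auto
    fix x assume x: "x0 \<le> x"
    have "W x * exp (- k / x) \<le> W x * 1" using k0 x x0 W0[OF x] by (intro mult_left_mono) auto
    then have "W x0 * exp (- k / x0) \<le> 5/4 * N x"
      using order_trans[OF incr[OF x]] close(2)[OF x] by fastforce
    then show "4/5 * (W x0 * exp (- k / x0)) \<le> (u x)\<^sup>2 + (v x)\<^sup>2"
      unfolding N_def by (simp add: field_simps)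
    have "W x * 1 \<le> W x * exp (k / x)" using k0 x x0 W0[OF x] by (intro mult_left_mono) auto
    then have "3/4 * N x \<le> W x0 * exp (k / x0)"
      using decr[OF x] close(1)[OF x] by simp
    then show "(u x)\<^sup>2 + (v x)\<^sup>2 \<le> 4/3 * (W x0 * exp (k / x0))"
      unfolding N_def by (simp add: field_simps)
  qed
qed

text \<open>By Rolle there is z between two zeros with u'(z) = 0, that is v(z) = (a/z) u(z). If the
  zeros are close, u(z) is small because u' is bounded, so v(z) is small as well, against the lower
  energy bound. \<open>\<delta>\<close> is what makes both squares fall below c/2.\<close>

lemma zero_gap:
  obtains x0 \<delta> where "1 \<le> x0" "0 < \<delta>"
    "\<And>s t. x0 \<le> s \<Longrightarrow> s < t \<Longrightarrow> u s = 0 \<Longrightarrow> u t = 0 \<Longrightarrow> \<delta> \<le> t - s"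
proof -
  obtain x0 c C where x0: "1 \<le> x0" and c: "0 < c" and C: "0 < C"
    and lo: "\<And>x. x0 \<le> x \<Longrightarrow> c \<le> (u x)\<^sup>2 + (v x)\<^sup>2" and hi: "\<And>x. x0 \<le> x \<Longrightarrow> (u x)\<^sup>2 + (v x)\<^sup>2 \<le> C"
    using energy_bounds by blast
  define K where "K = (\<bar>a\<bar> + 1) * sqrt C"
  have K: "0 < K" using C by (simp add: K_def add_nonneg_pos)
  have uC: "\<bar>u x\<bar> \<le> sqrt C" "\<bar>v x\<bar> \<le> sqrt C" if "x0 \<le> x" for x
  proof -
    have "(u x)\<^sup>2 \<le> C" "(v x)\<^sup>2 \<le> C" using hi[OF that] zero_le_power2[of "u x"] zero_le_power2[of "v x"] by linarith+
    then show "\<bar>u x\<bar> \<le> sqrt C" "\<bar>v x\<bar> \<le> sqrt C" by (auto intro!: real_le_rsqrt)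
  qed
  have ax: "\<bar>a / x * y\<bar> \<le> \<bar>a\<bar> * \<bar>y\<bar>" if "x0 \<le> x" for x y
  proof -
    have "\<bar>a\<bar> / x \<le> \<bar>a\<bar>" using that x0 divide_left_mono[of 1 x "\<bar>a\<bar>"] by simp
    then have "\<bar>a\<bar> / x * \<bar>y\<bar> \<le> \<bar>a\<bar> * \<bar>y\<bar>" by (intro mult_right_mono) auto
    then show ?thesis using that x0 by (simp add: abs_mult)
  qed
  define \<delta> where "\<delta> = sqrt (c / 2) / ((\<bar>a\<bar> + 1) * K)"
  have \<delta>: "0 < \<delta>" using c K by (simp add: \<delta>_def add_nonneg_pos)
  show ?thesis
  proof (rule that[OF x0 \<delta>])
    fix s t assume st: "x0 \<le> s" "s < t" "u s = 0" "u t = 0"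
    show "\<delta> \<le> t - s"
    proof (rule ccontr)
      assume small: "\<not> \<delta> \<le> t - s"
      have "\<exists>z. s < z \<and> z < t \<and> u t - u s = (t - s) * (a / z * u z - v z)"
        using st x0 by (intro MVT2 deriv_u) auto
      then obtain z where z: "s < z" "z < t" "a / z * u z - v z = 0" using st by auto
      have zx: "x0 \<le> z" using z st by simp
      have "\<exists>y. s < y \<and> y < z \<and> u z - u s = (z - s) * (a / y * u y - v y)"
        using st z x0 by (intro MVT2 deriv_u) auto
      then obtain y where y: "s < y" "y < z" "u z = (z - s) * (a / y * u y - v y)" using st by auto
      have yx: "x0 \<le> y" using y st by simp
      have "\<bar>a / y * u y - v y\<bar> \<le> \<bar>a\<bar> * \<bar>u y\<bar> + \<bar>v y\<bar>" using ax[OF yx, of "u y"] by linarith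
      also have "\<dots> \<le> \<bar>a\<bar> * sqrt C + sqrt C" using uC[OF yx] by (intro add_mono mult_left_mono) auto
      finally have "\<bar>a / y * u y - v y\<bar> \<le> K" by (simp add: K_def algebra_simps)
      then have "\<bar>u z\<bar> \<le> (z - s) * K"
        unfolding y(3) abs_mult using z by (intro mult_mono) auto
      also have "\<dots> < \<delta> * K" using small z K by (intro mult_strict_right_mono) auto
      also have "\<delta> * K = sqrt (c / 2) / (\<bar>a\<bar> + 1)" using K by (simp add: \<delta>_def)
      finally have uz: "(\<bar>a\<bar> + 1) * \<bar>u z\<bar> < sqrt (c / 2)" by (simp add: field_simps add_nonneg_pos)
      have "\<bar>u z\<bar> \<le> (\<bar>a\<bar> + 1) * \<bar>u z\<bar>" by (simp add: algebra_simps)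
      then have u1: "\<bar>u z\<bar> < sqrt (c / 2)" using uz by simp
      have "\<bar>v z\<bar> \<le> \<bar>a\<bar> * \<bar>u z\<bar>" using ax[OF zx, of "u z"] z(3) by linarith
      also have "\<dots> \<le> (\<bar>a\<bar> + 1) * \<bar>u z\<bar>" by (simp add: algebra_simps)
      finally have v1: "\<bar>v z\<bar> < sqrt (c / 2)" using uz by simp
      have "(u z)\<^sup>2 < c / 2" "(v z)\<^sup>2 < c / 2"
        using power_strict_mono[OF u1, of 2] power_strict_mono[OF v1, of 2] c by auto
      then show False using lo[OF zx] by simp
    qed
  qed
qed

text \<open>If |u| < \<kappa> throughout an interval of length 2, the mean value theorem gives a
  point with |u'| < \<kappa>; there |v| < (|a| + 1) \<kappa> = sqrt (c/2), and the energy would be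
  below c.\<close>

lemma large_value:
  obtains x0 \<kappa> where "1 \<le> x0" "0 < \<kappa>" "\<And>x. x0 \<le> x \<Longrightarrow> \<exists>R\<in>{x..x + 2}. \<kappa> \<le> \<bar>u R\<bar>"
proof -
  obtain x0 c C where x0: "1 \<le> x0" and c: "0 < c" and C: "0 < C"
    and lo: "\<And>x. x0 \<le> x \<Longrightarrow> c \<le> (u x)\<^sup>2 + (v x)\<^sup>2" and "\<And>x. x0 \<le> x \<Longrightarrow> (u x)\<^sup>2 + (v x)\<^sup>2 \<le> C"
    using energy_bounds by blast
  define \<kappa> where "\<kappa> = sqrt (c / 2) / (\<bar>a\<bar> + 1)"
  have \<kappa>: "0 < \<kappa>" using c by (simp add: \<kappa>_def add_nonneg_pos)
  have \<kappa>2: "(\<bar>a\<bar> + 1) * \<kappa> = sqrt (c / 2)" by (simp add: \<kappa>_def add_nonneg_eq_0_iff)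
  show ?thesis
  proof (rule that[OF x0 \<kappa>], rule ccontr)
    fix x assume x: "x0 \<le> x" and "\<not> (\<exists>R\<in>{x..x + 2}. \<kappa> \<le> \<bar>u R\<bar>)"
    then have small: "\<And>R. x \<le> R \<Longrightarrow> R \<le> x + 2 \<Longrightarrow> \<bar>u R\<bar> < \<kappa>" by (auto simp: not_le)
    have "\<exists>z. x < z \<and> z < x + 2 \<and> u (x + 2) - u x = (x + 2 - x) * (a / z * u z - v z)"
      using x x0 by (intro MVT2 deriv_u) auto
    then obtain z where z: "x < z" "z < x + 2" "u (x + 2) - u x = 2 * (a / z * u z - v z)" by auto
    have "\<bar>a / z * u z\<bar> \<le> \<bar>a\<bar> * \<kappa>"
    proof -
      have "\<bar>a\<bar> / z \<le> \<bar>a\<bar>" using z x x0 divide_left_mono[of 1 z "\<bar>a\<bar>"] by simp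
      then have "\<bar>a\<bar> / z * \<bar>u z\<bar> \<le> \<bar>a\<bar> * \<kappa>" using small[of z] z by (intro mult_mono) auto
      then show ?thesis using z x x0 by (simp add: abs_mult)
    qed
    moreover have "\<bar>a / z * u z - v z\<bar> < \<kappa>" using z small[of x] small[of "x + 2"] by auto
    ultimately have "\<bar>v z\<bar> < \<bar>a\<bar> * \<kappa> + \<kappa>" by linarith
    then have v1: "\<bar>v z\<bar> < sqrt (c / 2)" using \<kappa>2 by (simp add: algebra_simps)
    have "\<kappa> \<le> (\<bar>a\<bar> + 1) * \<kappa>" using \<kappa> by (simp add: algebra_simps)
    then have u1: "\<bar>u z\<bar> < sqrt (c / 2)" using small[of z] z \<kappa>2 by simp
    have "(u z)\<^sup>2 < c / 2" "(v z)\<^sup>2 < c / 2"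
      using power_strict_mono[OF u1, of 2] power_strict_mono[OF v1, of 2] c by auto
    then show False using lo[of z] x z by simp
  qed
qed


text \<open>Along the chord from \<open>R\<close> to \<open>w\<close> the solutions \<open>P = U - \<i>V\<close> and \<open>Q = U + \<i>V\<close> stay close to those of the
  system with \<open>a = 0\<close>, since the coupling \<open>a/w\<close> is of size \<open>1/R\<close> and the recessive solution decays along the chord.\<close>

lemma chord_estimate:
  assumes R: "8 * \<bar>a\<bar> + 32 * a\<^sup>2 + 1 \<le> R"
    and w: "norm w = R" "0 \<le> Re w" "0 \<le> Im w"
  shows "exp (Im w) * (\<bar>u R\<bar> - (1 + 6 * \<bar>a\<bar> + 16 * a\<^sup>2) / R * sqrt ((u R)\<^sup>2 + (v R)\<^sup>2)) \<le> 2 * norm (U w)"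
proof -
  define d where "d = w - of_real R"
  define y where "y = Im w"
  define \<gamma> where "\<gamma> t = of_real R + of_real t * d" for t :: real
  define P where "P z = U z - \<i> * V z" for z
  define Q where "Q z = U z + \<i> * V z" for z
  \<comment> \<open>With this factor p' = d e r and r' = 2 i d r + d e p. For e = 0, p is constant
    and r decays like exp (- 2 y t); \<open>e\<close> is at most \<open>\<eta>\<close> because the
    chord stays at distance at least R/2 from 0.\<close>
  define p where "p t = exp (\<i> * d * of_real t) * P (\<gamma> t)" for t :: real
  define r where "r t = exp (\<i> * d * of_real t) * Q (\<gamma> t)" for t :: real
  define e where "e t = of_real a / \<gamma> t" for t
  define \<eta> where "\<eta> = 2 * \<bar>a\<bar> / R"
  define D where "D = norm d"
  have R1: "1 \<le> R" and R8: "8 * \<bar>a\<bar> \<le> R" and R32: "32 * a\<^sup>2 \<le> R"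
    using R zero_le_power2[of a] abs_ge_zero[of a] by linarith+
  have \<eta>0: "0 \<le> \<eta>" using R1 by (simp add: \<eta>_def)
  have \<eta>4: "\<eta> \<le> 1/4" using R1 R8 by (simp add: \<eta>_def field_simps)
  have y0: "0 \<le> y" using w by (simp add: y_def)
  have Imd: "Im d = y" "Re d = Re w - R" by (auto simp: d_def y_def)
  have xR: "Re w \<le> R" using complex_Re_le_cmod[of w] w by simp
  have y2: "y\<^sup>2 = (R - Re w) * (R + Re w)"
    using w(1) cmod_power2[of w] by (simp add: y_def power2_eq_square algebra_simps)
  have Rx: "R * (R - Re w) \<le> y\<^sup>2"
    unfolding y2 using mult_left_mono[of R "R + Re w" "R - Re w"] w xR by (simp add: mult.commute)
  have Rx2: "(R - Re w)\<^sup>2 \<le> y\<^sup>2"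
    unfolding y2 unfolding power2_eq_square using w xR by (intro mult_left_mono) auto
  \<comment> \<open>On the quarter circle R - Re w <= y, so the length of the chord is controlled by
    the decay rate 2y. This is what turns integrals over the chord into bounds free of
    \<open>D\<close>.\<close>
  have Dy: "D \<le> 2 * y"
  proof -
    have "D\<^sup>2 = (R - Re w)\<^sup>2 + y\<^sup>2"
      unfolding D_def cmod_power2 Imd by (simp add: power2_commute)
    also have "\<dots> \<le> 4 * y\<^sup>2" using Rx2 zero_le_power2[of y] by linarith
    also have "\<dots> = (2 * y)\<^sup>2" by (simp add: power_mult_distrib)
    finally show ?thesis by (rule power2_le_imp_le) (use y0 in simp)
  qed
  have D2: "D \<le> 2 * R"
    unfolding D_def d_def using norm_triangle_ineq4[of w "of_real R"] w R1 by simp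
  have D0: "0 \<le> D" by (simp add: D_def)
  have \<gamma>re: "Re (\<gamma> t) = (1 - t) * R + t * Re w" "Im (\<gamma> t) = t * y" for t
    by (simp_all add: \<gamma>_def Imd algebra_simps)
  have \<gamma>n: "R / 2 \<le> norm (\<gamma> t)" "0 \<le> Re (\<gamma> t)" if t: "0 \<le> t" "t \<le> 1" for t
  proof -
    show "0 \<le> Re (\<gamma> t)" unfolding \<gamma>re using t w R1 by (intro add_nonneg_nonneg mult_nonneg_nonneg) auto
    have "(norm (\<gamma> t))\<^sup>2 = (1 - t)\<^sup>2 * R\<^sup>2 + 2 * (t * (1 - t) * (R * Re w)) + t\<^sup>2 * ((Re w)\<^sup>2 + y\<^sup>2)"
      unfolding cmod_power2 \<gamma>re by (simp add: power2_eq_square algebra_simps)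
    also have "(Re w)\<^sup>2 + y\<^sup>2 = R\<^sup>2" unfolding y2 by (simp add: power2_eq_square algebra_simps)
    finally have "(norm (\<gamma> t))\<^sup>2 = ((1 - t)\<^sup>2 + t\<^sup>2) * R\<^sup>2 + 2 * (t * (1 - t) * (R * Re w))"
      by (simp add: algebra_simps)
    moreover have "0 \<le> t * (1 - t) * (R * Re w)" using t w R1 by (intro mult_nonneg_nonneg) auto
    moreover have "(1/4) * R\<^sup>2 \<le> ((1 - t)\<^sup>2 + t\<^sup>2) * R\<^sup>2"
    proof (rule mult_right_mono)
      have "0 \<le> (2 * t - 1)\<^sup>2" by simp
      then show "1/4 \<le> (1 - t)\<^sup>2 + t\<^sup>2" by (simp add: power2_eq_square algebra_simps)
    qed simp
    ultimately have "(R / 2)\<^sup>2 \<le> (norm (\<gamma> t))\<^sup>2" by (simp add: power_divide)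
    then show "R / 2 \<le> norm (\<gamma> t)" by (rule power2_le_imp_le) simp
  qed
  have \<gamma>0: "\<gamma> t \<noteq> 0" if "0 \<le> t" "t \<le> 1" for t using \<gamma>n[OF that] R1 by auto
  have en: "norm (e t) \<le> \<eta>" if "0 \<le> t" "t \<le> 1" for t
  proof -
    have "\<bar>a\<bar> / norm (\<gamma> t) \<le> \<bar>a\<bar> / (R / 2)"
      using \<gamma>n[OF that] \<gamma>0[OF that] R1 by (intro divide_left_mono mult_pos_pos) auto
    then show ?thesis by (simp add: e_def \<eta>_def norm_divide mult.commute)
  qed
  have dP: "(P has_field_derivative - \<i> * P z + of_real a / z * Q z) (at z)"
    and dQ: "(Q has_field_derivative \<i> * Q z + of_real a / z * P z) (at z)" if "0 \<le> Re z" "z \<noteq> 0" for z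
  proof -
    have "(P has_field_derivative (of_real a / z * U z - V z) - \<i> * (U z - of_real a / z * V z)) (at z)"
      unfolding P_def[abs_def] by (intro DERIV_diff DERIV_cmult deriv_U deriv_V that)
    then show "(P has_field_derivative - \<i> * P z + of_real a / z * Q z) (at z)"
      by (rule DERIV_cong) (simp add: P_def Q_def algebra_simps)
    have "(Q has_field_derivative (of_real a / z * U z - V z) + \<i> * (U z - of_real a / z * V z)) (at z)"
      unfolding Q_def[abs_def] by (intro DERIV_add DERIV_cmult deriv_U deriv_V that)
    then show "(Q has_field_derivative \<i> * Q z + of_real a / z * P z) (at z)"
      by (rule DERIV_cong) (simp add: P_def Q_def algebra_simps)
  qed
  have d\<gamma>: "(\<gamma> has_vector_derivative d) (at t)" for t
    unfolding \<gamma>_def by (auto intro!: derivative_eq_intros)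
  have dex: "((\<lambda>t. exp (c * of_real t)) has_vector_derivative c * exp (c * of_real t)) (at t)" for c :: complex and t :: real
    by (rule has_vector_derivative_real_field) (auto intro!: derivative_eq_intros)
  have dp: "(p has_vector_derivative d * e t * r t) (at t)" if t: "0 \<le> t" "t \<le> 1" for t
  proof -
    have "((\<lambda>t. P (\<gamma> t)) has_vector_derivative d * (- \<i> * P (\<gamma> t) + of_real a / \<gamma> t * Q (\<gamma> t))) (at t)"
      using field_vector_diff_chain_at[OF d\<gamma> dP[OF \<gamma>n(2)[OF t] \<gamma>0[OF t]]] by (simp add: o_def)
    from has_vector_derivative_mult[OF dex[of "\<i> * d"] this] show ?thesis
      unfolding p_def[abs_def] r_def e_def
      by (rule has_vector_derivative_eq_rhs) (simp add: algebra_simps)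
  qed
  have dr: "(r has_vector_derivative 2 * \<i> * d * r t + d * e t * p t) (at t)" if t: "0 \<le> t" "t \<le> 1" for t
  proof -
    have "((\<lambda>t. Q (\<gamma> t)) has_vector_derivative d * (\<i> * Q (\<gamma> t) + of_real a / \<gamma> t * P (\<gamma> t))) (at t)"
      using field_vector_diff_chain_at[OF d\<gamma> dQ[OF \<gamma>n(2)[OF t] \<gamma>0[OF t]]] by (simp add: o_def)
    from has_vector_derivative_mult[OF dex[of "\<i> * d"] this] show ?thesis
      unfolding r_def[abs_def] p_def e_def
      by (rule has_vector_derivative_eq_rhs) (simp add: algebra_simps)
  qed
  have contp: "continuous_on {0..1} p" 
    using dp by (intro continuous_at_imp_continuous_on ballI has_vector_derivative_continuous) auto
  have contr: "continuous_on {0..1} r" 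
    using dr by (intro continuous_at_imp_continuous_on ballI has_vector_derivative_continuous) auto
  obtain ts where ts: "ts \<in> {0..1}" "\<forall>t\<in>{0..1}. norm (p t) \<le> norm (p ts)"
    using continuous_attains_sup[OF _ _ continuous_on_norm[OF contp]] by auto
  define S where "S = norm (p ts)"
  have pS: "norm (p t) \<le> S" if "0 \<le> t" "t \<le> 1" for t using ts that by (simp add: S_def)
  have S0: "0 \<le> S" by (simp add: S_def)
  \<comment> \<open>Variation of constants: the error is at most D \<eta> S times the integral of
    exp (- 2 y (t - s)), hence at most D \<eta> S / (2y) <= \<eta> S. For y = 0 the chord is a
    point.\<close>
  have rest: "norm (r t - exp (2 * \<i> * d * of_real t) * r 0) \<le> \<eta> * S" if t: "0 \<le> t" "t \<le> 1" for t
  proof (cases "t = 0 \<or> y = 0")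
    case True
    have "y = 0 \<Longrightarrow> d = 0" using Dy D0 by (simp add: D_def)
    moreover have "r t = r 0" if "d = 0" by (simp add: r_def \<gamma>_def that)
    ultimately show ?thesis using True \<eta>0 S0 by auto
  next
    case False
    then have y: "0 < y" and t0: "0 < t" using y0 t by auto
    define m where "m s = exp (- 2 * \<i> * d * of_real s) * r s" for s :: real
    have ex: "norm (exp (- 2 * \<i> * d * of_real s)) = exp (2 * y * s)" for s
      by (simp add: Imd)
    have dm: "(m has_vector_derivative exp (- 2 * \<i> * d * of_real s) * (d * e s * p s)) (at s)" if "0 \<le> s" "s \<le> 1" for s
    proof -
      from has_vector_derivative_mult[OF dex[of "- 2 * \<i> * d"] dr[OF that]] show ?thesis
        unfolding m_def[abs_def] by (rule has_vector_derivative_eq_rhs) (simp add: algebra_simps)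
    qed
    have "norm (m t - m 0) \<le> D * \<eta> * S / (2 * y) * exp (2 * y * t) - D * \<eta> * S / (2 * y) * exp (2 * y * 0)"
    proof (rule differentiable_bound_general[OF t0])
      show "continuous_on {0..t} m"
        using t by (intro continuous_at_imp_continuous_on ballI has_vector_derivative_continuous[OF dm]) auto
      show "continuous_on {0..t} (\<lambda>s. D * \<eta> * S / (2 * y) * exp (2 * y * s))" by (intro continuous_intros)
      fix s assume s: "0 < s" "s < t"
      show "(m has_vector_derivative exp (- 2 * \<i> * d * of_real s) * (d * e s * p s)) (at s)"
        using s t by (intro dm) auto
      show "((\<lambda>s. D * \<eta> * S / (2 * y) * exp (2 * y * s)) has_vector_derivative exp (2 * y * s) * (D * \<eta> * S)) (at s)"
        unfolding has_real_derivative_iff_has_vector_derivative[symmetric]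
        using y by (auto intro!: derivative_eq_intros)
      show "norm (exp (- 2 * \<i> * d * of_real s) * (d * e s * p s)) \<le> exp (2 * y * s) * (D * \<eta> * S)"
        unfolding norm_mult[of "exp (- 2 * \<i> * d * of_real s)"] ex norm_mult D_def using en[of s] pS[of s] s t \<eta>0
        by (intro mult_left_mono mult_mono) auto
    qed
    also have "\<dots> \<le> D * \<eta> * S / (2 * y) * exp (2 * y * t)" using y D0 \<eta>0 S0 by simp
    also have "\<dots> \<le> (\<eta> * S) * exp (2 * y * t)"
    proof (rule mult_right_mono)
      have "D / (2 * y) * (\<eta> * S) \<le> 1 * (\<eta> * S)" using Dy y \<eta>0 S0 by (intro mult_right_mono) auto
      then show "D * \<eta> * S / (2 * y) \<le> \<eta> * S" by (simp add: mult.assoc)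
    qed simp
    finally have "norm (m t - m 0) \<le> (\<eta> * S) * exp (2 * y * t)" .
    then have "norm (exp (2 * \<i> * d * of_real t)) * norm (m t - m 0) \<le> exp (- (2 * y * t)) * ((\<eta> * S) * exp (2 * y * t))"
      by (intro mult_mono) (auto simp: Imd)
    also have "\<dots> = \<eta> * S" by (simp add: exp_minus)
    finally have "norm (exp (2 * \<i> * d * of_real t) * (m t - m 0)) \<le> \<eta> * S" by (simp add: norm_mult)
    moreover have "exp (2 * \<i> * d * of_real t) * (m t - m 0) = r t - exp (2 * \<i> * d * of_real t) * r 0"
      by (simp add: m_def right_diff_distrib mult.assoc[symmetric] exp_add[symmetric])
    ultimately show ?thesis by simp
  qed
  define \<rho> where "\<rho> = sqrt ((u R)\<^sup>2 + (v R)\<^sup>2)"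
  have UR: "U (of_real R) = of_real (u R)" "V (of_real R) = of_real (v R)" using R1 by (auto simp: U_of_real V_of_real)
  have p0: "p 0 = Complex (u R) (- v R)" and r0: "r 0 = Complex (u R) (v R)"
    by (simp_all add: p_def r_def P_def Q_def \<gamma>_def UR complex_eq_iff)
  have np0: "norm (p 0) = \<rho>" "norm (r 0) = \<rho>" by (simp_all add: p0 r0 \<rho>_def cmod_def)
  have \<rho>0: "0 \<le> \<rho>" by (simp add: \<rho>_def)
  \<comment> \<open>Inserting the bound for \<open>r\<close> in p' = d e r: the decaying part
    integrates to at most \<eta> \<rho>, the remaining part contributes D \<eta>^2 S, which is small
    because D <= 2R and \<eta> = 2|a|/R.\<close>
  have pest: "norm (p t - p 0) \<le> \<eta> * \<rho> + D * \<eta>\<^sup>2 * S" if t: "0 \<le> t" "t \<le> 1" for t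
  proof (cases "t = 0 \<or> y = 0")
    case True
    have "y = 0 \<Longrightarrow> d = 0" using Dy D0 by (simp add: D_def)
    moreover have "p t = p 0" if "d = 0" by (simp add: p_def \<gamma>_def that)
    ultimately show ?thesis using True \<eta>0 S0 \<rho>0 D0 by auto
  next
    case False
    then have y: "0 < y" and t0: "0 < t" using y0 t by auto
    define \<phi> where "\<phi> s = - (D * \<eta> * \<rho> / (2 * y)) * exp (- (2 * y * s)) + D * \<eta>\<^sup>2 * S * s" for s
    have "norm (p t - p 0) \<le> \<phi> t - \<phi> 0"
    proof (rule differentiable_bound_general[OF t0])
      show "continuous_on {0..t} p" using contp by (rule continuous_on_subset) (use t in auto)
      show "continuous_on {0..t} \<phi>" unfolding \<phi>_def by (intro continuous_intros)
      fix s assume s: "0 < s" "s < t"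
      show "(p has_vector_derivative d * e s * r s) (at s)" using s t by (intro dp) auto
      show "(\<phi> has_vector_derivative D * \<eta> * (exp (- (2 * y * s)) * \<rho> + \<eta> * S)) (at s)"
        unfolding has_real_derivative_iff_has_vector_derivative[symmetric] \<phi>_def
        using y by (auto intro!: derivative_eq_intros simp: field_simps power2_eq_square)
      have "norm (r s) \<le> norm (exp (2 * \<i> * d * of_real s) * r 0) + \<eta> * S"
        using rest[of s] s t norm_triangle_ineq2[of "r s" "exp (2 * \<i> * d * of_real s) * r 0"] by simp
      also have "norm (exp (2 * \<i> * d * of_real s) * r 0) = exp (- (2 * y * s)) * \<rho>"
        by (simp add: norm_mult np0 Imd)
      finally show "norm (d * e s * r s) \<le> D * \<eta> * (exp (- (2 * y * s)) * \<rho> + \<eta> * S)"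
        unfolding norm_mult D_def using en[of s] s t \<eta>0 by (intro mult_mono) auto
    qed
    also have "\<dots> = D / (2 * y) * (\<eta> * \<rho>) * (1 - exp (- (2 * y * t))) + D * \<eta>\<^sup>2 * S * t"
      by (simp add: \<phi>_def algebra_simps diff_divide_distrib)
    also have "\<dots> \<le> 1 * (\<eta> * \<rho>) * 1 + D * \<eta>\<^sup>2 * S * 1"
      using Dy y t \<eta>0 \<rho>0 D0 S0 by (intro add_mono mult_mono mult_nonneg_nonneg) auto
    finally show ?thesis by simp
  qed
  have D\<eta>: "D * \<eta>\<^sup>2 \<le> 8 * a\<^sup>2 / R"
  proof -
    have "D * \<eta>\<^sup>2 \<le> 2 * R * \<eta>\<^sup>2" using D2 by (intro mult_right_mono) auto
    also have "\<dots> = 8 * a\<^sup>2 / R" using R1 by (simp add: \<eta>_def power2_eq_square field_simps)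
    finally show ?thesis .
  qed
  have D\<eta>4: "D * \<eta>\<^sup>2 \<le> 1/4"
  proof -
    have "8 * a\<^sup>2 / R \<le> 1/4" using R32 R1 by (simp add: field_simps)
    then show ?thesis using D\<eta> by simp
  qed
  \<comment> \<open>Bootstrap: \<open>S\<close> occurs on the right with coefficient at most 1/4 and
    is absorbed on the left.\<close>
  have "S \<le> \<rho> + (\<eta> * \<rho> + D * \<eta>\<^sup>2 * S)"
    using pest[of ts] ts norm_triangle_ineq2[of "p ts" "p 0"] by (simp add: S_def np0)
  also have "\<dots> \<le> \<rho> + (1/4 * \<rho> + 1/4 * S)"
    using \<eta>4 D\<eta>4 \<rho>0 S0 by (intro add_mono mult_right_mono) auto
  finally have S2: "S \<le> 2 * \<rho>" using \<rho>0 by simp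
  have p1: "norm (p 1 - p 0) \<le> (\<eta> + 16 * a\<^sup>2 / R) * \<rho>"
  proof -
    have "D * \<eta>\<^sup>2 * S \<le> 8 * a\<^sup>2 / R * (2 * \<rho>)" using D\<eta> S2 S0 R1 by (intro mult_mono) auto
    then show ?thesis using pest[of 1] by (simp add: algebra_simps)
  qed
  have r1: "norm (r 1 - exp (2 * \<i> * d) * r 0) \<le> 2 * \<eta> * \<rho>"
    using rest[of 1] mult_left_mono[OF S2 \<eta>0] by (simp add: algebra_simps)
  \<comment> \<open>Drops the oscillating phase of exp (2 i d). The phase differs from 1 by at most
    2 (R - Re w) <= 2 y^2 / R, and the weight exp (- 2y) compensates y^2.\<close>
  have r2: "norm (exp (2 * \<i> * d) * r 0 - of_real (exp (- 2 * y)) * r 0) \<le> 1 / R * \<rho>"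
  proof -
    have "exp (2 * \<i> * d) = of_real (exp (- 2 * y)) * exp (\<i> * of_real (2 * (Re w - R)))"
      unfolding exp_of_real[symmetric] exp_add[symmetric]
      by (rule arg_cong[of _ _ exp]) (simp add: complex_eq_iff Imd)
    then have "exp (2 * \<i> * d) * r 0 - of_real (exp (- 2 * y)) * r 0
       = of_real (exp (- 2 * y)) * (exp (\<i> * of_real (2 * (Re w - R))) - 1) * r 0"
      by (simp add: algebra_simps)
    then have "norm (exp (2 * \<i> * d) * r 0 - of_real (exp (- 2 * y)) * r 0)
       = exp (- 2 * y) * norm (exp (\<i> * of_real (2 * (Re w - R))) - 1) * \<rho>"
      by (simp add: norm_mult np0)
    also have "\<dots> \<le> exp (- 2 * y) * (2 * (R - Re w)) * \<rho>"
    proof -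
      have "norm (exp (\<i> * of_real (2 * (Re w - R))) - 1) \<le> \<bar>2 * (Re w - R)\<bar>"
        using dist_exp_i_1[of "2 * (Re w - R)"] abs_sin_x_le_abs_x[of "2 * (Re w - R) / 2"] by simp
      then show ?thesis using xR \<rho>0 by (intro mult_right_mono mult_left_mono) auto
    qed
    also have "\<dots> \<le> 1 / R * \<rho>"
    proof (rule mult_right_mono[OF _ \<rho>0])
      have "2 * (R - Re w) \<le> 2 * y\<^sup>2 / R" using Rx R1 by (simp add: field_simps)
      also have "\<dots> \<le> exp (2 * y) / R"
      proof (rule divide_right_mono)
        have "1 + 2 * y + (2 * y)\<^sup>2 / 2 \<le> exp (2 * y)" using y0 by (intro exp_lower_Taylor_quadratic) auto
        then show "2 * y\<^sup>2 \<le> exp (2 * y)" using y0 by (simp add: power_mult_distrib)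
      qed (use R1 in auto)
      finally have "exp (- 2 * y) * (2 * (R - Re w)) \<le> exp (- 2 * y) * (exp (2 * y) / R)"
        by (intro mult_left_mono) auto
      also have "\<dots> = 1 / R" by (simp add: exp_add[symmetric])
      finally show "exp (- 2 * y) * (2 * (R - Re w)) \<le> 1 / R" .
    qed
    finally show ?thesis .
  qed
  \<comment> \<open>The real parts of \<open>p 0\<close> and \<open>r 0\<close> are both u(R), so
    they add without cancellation.\<close>
  have main0: "\<bar>u R\<bar> \<le> norm (p 0 + of_real (exp (- 2 * y)) * r 0)"
  proof -
    have "\<bar>u R\<bar> * 1 \<le> \<bar>u R\<bar> * (1 + exp (- 2 * y))" by (intro mult_left_mono) auto
    also have "\<dots> = \<bar>Re (p 0 + of_real (exp (- 2 * y)) * r 0)\<bar>"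
    proof -
      have "Re (p 0 + of_real (exp (- 2 * y)) * r 0) = u R * (1 + exp (- 2 * y))"
        by (simp add: p0 r0 algebra_simps)
      then show ?thesis by (simp add: abs_mult)
    qed
    also have "\<dots> \<le> norm (p 0 + of_real (exp (- 2 * y)) * r 0)" by (rule abs_Re_le_cmod)
    finally show ?thesis by simp
  qed
  have "\<bar>u R\<bar> - (1 + 6 * \<bar>a\<bar> + 16 * a\<^sup>2) / R * \<rho> \<le> norm (p 1 + r 1)"
  proof -
    have "p 0 + of_real (exp (- 2 * y)) * r 0 = (p 1 + r 1) - (p 1 - p 0) - (r 1 - exp (2 * \<i> * d) * r 0)
       - (exp (2 * \<i> * d) * r 0 - of_real (exp (- 2 * y)) * r 0)" by simp
    from arg_cong[OF this, of norm] have "norm (p 0 + of_real (exp (- 2 * y)) * r 0) \<le> norm (p 1 + r 1) + norm (p 1 - p 0)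
        + norm (r 1 - exp (2 * \<i> * d) * r 0) + norm (exp (2 * \<i> * d) * r 0 - of_real (exp (- 2 * y)) * r 0)"
      using norm_triangle_ineq4[of "p 1 + r 1" "p 1 - p 0"]
        norm_triangle_ineq4[of "(p 1 + r 1) - (p 1 - p 0)" "r 1 - exp (2 * \<i> * d) * r 0"]
        norm_triangle_ineq4[of "(p 1 + r 1) - (p 1 - p 0) - (r 1 - exp (2 * \<i> * d) * r 0)"
          "exp (2 * \<i> * d) * r 0 - of_real (exp (- 2 * y)) * r 0"] by linarith
    also have "\<dots> \<le> norm (p 1 + r 1) + (\<eta> + 16 * a\<^sup>2 / R) * \<rho> + 2 * \<eta> * \<rho> + 1 / R * \<rho>"
      using p1 r1 r2 by (intro add_mono) auto
    also have "\<dots> = norm (p 1 + r 1) + (1 + 6 * \<bar>a\<bar> + 16 * a\<^sup>2) / R * \<rho>"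
      by (simp add: \<eta>_def add_divide_distrib algebra_simps)
    finally show ?thesis using main0 by linarith
  qed
  moreover have "norm (p 1 + r 1) = exp (- Im w) * (2 * norm (U w))"
  proof -
    have "\<gamma> 1 = w" by (simp add: \<gamma>_def d_def)
    then have "p 1 + r 1 = exp (\<i> * d) * (2 * U w)"
      by (simp add: p_def r_def P_def Q_def algebra_simps)
    then show ?thesis by (simp add: norm_mult Imd y_def)
  qed
  ultimately have "exp (Im w) * (\<bar>u R\<bar> - (1 + 6 * \<bar>a\<bar> + 16 * a\<^sup>2) / R * \<rho>) \<le> exp (Im w) * (exp (- Im w) * (2 * norm (U w)))"
    by (intro mult_left_mono) auto
  then show ?thesis by (simp add: \<rho>_def mult.assoc[symmetric] exp_add[symmetric])
qed

text \<open>The error in \<open>chord_estimate\<close> is O(1/R) times the bounded square root of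
  the energy. At a radius supplied by \<open>large_value\<close> it is at most half of |u R| once R
  is large.\<close>

lemma circle_lower_bound:
  obtains x0 c where "1 \<le> x0" "0 < c"
    "\<And>x. x0 \<le> x \<Longrightarrow> \<exists>R\<in>{x..x + 2}. \<forall>w. norm w = R \<longrightarrow> 0 \<le> Re w \<longrightarrow> 0 \<le> Im w \<longrightarrow> c * exp (Im w) \<le> norm (U w)"
proof -
  obtain x1 c C where x1: "1 \<le> x1" and "0 < c" and C: "0 < C"
    and "\<And>x. x1 \<le> x \<Longrightarrow> c \<le> (u x)\<^sup>2 + (v x)\<^sup>2" and hi: "\<And>x. x1 \<le> x \<Longrightarrow> (u x)\<^sup>2 + (v x)\<^sup>2 \<le> C"
    using energy_bounds by blast
  obtain x2 \<kappa> where x2: "1 \<le> x2" and \<kappa>: "0 < \<kappa>" and large: "\<And>x. x2 \<le> x \<Longrightarrow> \<exists>R\<in>{x..x + 2}. \<kappa> \<le> \<bar>u R\<bar>"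
    using large_value by blast
  define L where "L = 1 + 6 * \<bar>a\<bar> + 16 * a\<^sup>2"
  have L: "0 < L" by (simp add: L_def add_pos_nonneg)
  define x0 where "x0 = Max {x1, x2, 8 * \<bar>a\<bar> + 32 * a\<^sup>2 + 1, 2 * L * sqrt C / \<kappa>}"
  have x0: "x1 \<le> x0" "x2 \<le> x0" "8 * \<bar>a\<bar> + 32 * a\<^sup>2 + 1 \<le> x0" "2 * L * sqrt C / \<kappa> \<le> x0"
    by (auto simp: x0_def)
  show ?thesis
  proof (rule that[of x0 "\<kappa> / 4"])
    show "1 \<le> x0" "0 < \<kappa> / 4" using x0 x1 \<kappa> by auto
    fix x assume x: "x0 \<le> x"
    then obtain R where R: "R \<in> {x..x + 2}" "\<kappa> \<le> \<bar>u R\<bar>" using large[of x] x0 by auto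
    have xR: "x0 \<le> R" using R x by simp
    have R0: "0 < R" using xR x0 x1 by simp
    have "L / R * sqrt ((u R)\<^sup>2 + (v R)\<^sup>2) \<le> L / R * sqrt C"
      using hi[of R] xR x0 L R0 by (intro mult_left_mono) auto
    also have "\<dots> \<le> \<kappa> / 2"
    proof -
      have "2 * L * sqrt C / \<kappa> \<le> R" using x0 xR by simp
      then show ?thesis using R0 \<kappa> by (simp add: field_simps)
    qed
    finally have k2: "\<kappa> / 2 \<le> \<bar>u R\<bar> - L / R * sqrt ((u R)\<^sup>2 + (v R)\<^sup>2)" using R by simp
    have "\<kappa> / 4 * exp (Im w) \<le> norm (U w)" if "norm w = R" "0 \<le> Re w" "0 \<le> Im w" for w
    proof -
      have "exp (Im w) * (\<kappa> / 2) \<le> exp (Im w) * (\<bar>u R\<bar> - L / R * sqrt ((u R)\<^sup>2 + (v R)\<^sup>2))"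
        using k2 by (intro mult_left_mono) auto
      also have "\<dots> \<le> 2 * norm (U w)"
        using x0 xR unfolding L_def by (intro chord_estimate that) auto
      finally show ?thesis by (simp add: mult.commute)
    qed
    then show "\<exists>R\<in>{x..x + 2}. \<forall>w. norm w = R \<longrightarrow> 0 \<le> Re w \<longrightarrow> 0 \<le> Im w \<longrightarrow> \<kappa> / 4 * exp (Im w) \<le> norm (U w)"
      using R by blast
  qed
qed

end

section \<open>Zeros of the two functions: never common, always real\<close>

lemma Abes_of_real: "nu > -1 \<Longrightarrow> Abes nu (of_real x) \<in> \<real>"
  by (simp add: Reals_cnj_iff cnj_Abes)

lemma Bbes_of_real: "nu > -1 \<Longrightarrow> Bbes nu (of_real x) \<in> \<real>"
  by (simp add: Reals_cnj_iff cnj_Bbes)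

text \<open>With k = 2|2\<nu>+1| the function x^k (A^2 + B^2) is nondecreasing on the positive axis.
  A common zero would make it vanish all the way down to 0, although A(0) = 1.\<close>

lemma Abes_Bbes_no_common_zero:
  assumes nu: "nu > -1" and x: "0 < x"
  shows "Abes nu (of_real x) \<noteq> 0 \<or> Bbes nu (of_real x) \<noteq> 0"
proof (rule ccontr)
  assume H: "\<not> ?thesis"
  define \<alpha> where "\<alpha> x = Re (Abes nu (of_real x))" for x
  define \<beta> where "\<beta> x = Re (Bbes nu (of_real x))" for x
  define q where "q = 2 * nu + 1"
  define k where "k = 2 * \<bar>q\<bar>"
  have A: "Abes nu (of_real t) = of_real (\<alpha> t)" and B: "Bbes nu (of_real t) = of_real (\<beta> t)" for t
    using Abes_of_real[OF nu, of t] Bbes_of_real[OF nu, of t] by (simp_all add: \<alpha>_def \<beta>_def)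
  have d\<alpha>: "(\<alpha> has_real_derivative - \<beta> t) (at t)" for t
    using has_real_derivative_Re_of_real[OF has_field_derivative_Abes[OF nu, of "of_real t"]]
    unfolding B by (simp add: \<alpha>_def[abs_def])
  have d\<beta>: "(\<beta> has_real_derivative \<alpha> t - q / t * \<beta> t) (at t)" if "0 < t" for t
  proof -
    have e: "Abes nu (of_real t) - of_real (2 * nu + 1) / of_real t * Bbes nu (of_real t) = of_real (\<alpha> t - q / t * \<beta> t)"
      unfolding A B q_def by simp
    show ?thesis
      using has_real_derivative_Re_of_real[OF has_field_derivative_Bbes'[OF nu, of "of_real t"]] that
      unfolding e by (simp add: \<beta>_def[abs_def])
  qed
  have zero: "\<alpha> x = 0" "\<beta> x = 0" using H by (auto simp: \<alpha>_def \<beta>_def)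
  have mono: "t powr k * ((\<alpha> t)\<^sup>2 + (\<beta> t)\<^sup>2) \<le> x powr k * ((\<alpha> x)\<^sup>2 + (\<beta> x)\<^sup>2)" if t: "0 < t" "t \<le> x" for t
  proof (rule DERIV_nonneg_imp_nondecreasing[OF t(2)])
    fix y assume y: "t \<le> y" "y \<le> x"
    have y0: "0 < y" using y t by simp
    have 1: "((\<lambda>y. y powr k) has_real_derivative k * y powr (k - 1)) (at y)"
      using y0 by (rule has_real_derivative_powr)
    have 2: "((\<lambda>y. (\<alpha> y)\<^sup>2 + (\<beta> y)\<^sup>2) has_real_derivative 2 * \<alpha> y * (- \<beta> y) + 2 * \<beta> y * (\<alpha> y - q / y * \<beta> y)) (at y)"
      using y0 by (auto intro!: derivative_eq_intros d\<alpha> d\<beta>)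
    have "k * y powr (k - 1) * ((\<alpha> y)\<^sup>2 + (\<beta> y)\<^sup>2) + (2 * \<alpha> y * (- \<beta> y) + 2 * \<beta> y * (\<alpha> y - q / y * \<beta> y)) * y powr k
       = y powr k / y * (k * (\<alpha> y)\<^sup>2 + (k - 2 * q) * (\<beta> y)\<^sup>2)"
      using y0 by (simp add: powr_diff field_simps power2_eq_square)
    moreover have "0 \<le> y powr k / y * (k * (\<alpha> y)\<^sup>2 + (k - 2 * q) * (\<beta> y)\<^sup>2)"
      using y0 by (intro mult_nonneg_nonneg add_nonneg_nonneg) (auto simp: k_def)
    ultimately show "\<exists>D. ((\<lambda>y. y powr k * ((\<alpha> y)\<^sup>2 + (\<beta> y)\<^sup>2)) has_real_derivative D) (at y) \<and> 0 \<le> D"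
      using DERIV_mult[OF 1 2] by auto
  qed
  have z: "\<alpha> t = 0" if t: "0 < t" "t \<le> x" for t
  proof -
    have "t powr k * ((\<alpha> t)\<^sup>2 + (\<beta> t)\<^sup>2) \<le> 0" using mono[OF t] by (simp add: zero)
    then have "(\<alpha> t)\<^sup>2 + (\<beta> t)\<^sup>2 \<le> 0" using t by (simp add: mult_le_0_iff)
    then show ?thesis by (simp add: sum_power2_le_zero_iff)
  qed
  have "\<alpha> 0 = 1" by (simp add: \<alpha>_def Abes_0)
  moreover have "isCont \<alpha> 0" using d\<alpha> by (rule DERIV_isCont)
  ultimately have "(\<alpha> \<longlongrightarrow> 1) (at_right 0)"
    unfolding isCont_def by (metis filterlim_at_split)
  moreover have "\<forall>\<^sub>F t in at_right 0. \<alpha> t = 0"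
    unfolding eventually_at_right_field using x z by (auto intro!: exI[of _ x])
  ultimately have "((\<lambda>t. 0::real) \<longlongrightarrow> 1) (at_right (0::real))"
    by (rule Lim_transform_eventually)
  from tendsto_unique[OF trivial_limit_at_right_real this tendsto_const] show False by simp
qed

lemma Re_of_real_mult: "Re (of_real r * z) = r * Re z"
  by simp

text \<open>A Sturm-Liouville argument along the segment from 0 to s. The flux Z = x^q Re (\<omega>
  cnj(A) B) is nondecreasing, vanishes at both ends for a zero of either function, and is therefore
  constant; its derivative then forces A = 0 on the segment, against A(0) = 1.\<close>

lemma bessel_zeros_real:
  assumes nu: "nu > -1" and zero: "Abes nu s = 0 \<or> Bbes nu s = 0"
  shows "s \<in> \<real>"
proof (rule ccontr)
  assume nr: "s \<notin> \<real>"
  then have s0: "s \<noteq> 0" by auto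
  define q where "q = 2 * nu + 1"
  have q: "q > -1" using nu by (simp add: q_def)
  \<comment> \<open>The two sign conditions make both terms of \<open>g\<close> nonnegative, the one
    with |A|^2 strictly so. A purely imaginary s is handled by -1, every other nonreal s by a purely
    imaginary \<open>\<omega>\<close> of the right sign.\<close>
  obtain \<omega> where \<omega>: "Re \<omega> \<le> 0" "0 < Re (\<omega> * s\<^sup>2)"
  proof (cases "Im (s\<^sup>2) = 0")
    case True
    then have "Re s * Im s = 0" by (auto simp: power2_eq_square)
    then have "Re s = 0" "Im s \<noteq> 0" using nr by (auto simp: complex_is_Real_iff)
    then have "Re (-1 * s\<^sup>2) = (Im s)\<^sup>2" by (simp add: power2_eq_square)
    with \<open>Im s \<noteq> 0\<close> have "0 < Re (-1 * s\<^sup>2)" by (metis zero_less_power2)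
    then show ?thesis by (intro that[of "-1"]) auto
  next
    case False
    then have "0 < Re (- \<i> * of_real (Im (s\<^sup>2)) * s\<^sup>2)"
      by (auto simp: zero_less_mult_iff linorder_neq_iff)
    then show ?thesis by (intro that[of "- \<i> * of_real (Im (s\<^sup>2))"]) auto
  qed
  define A where "A x = Abes nu (s * of_real x)" for x :: real
  define B where "B x = s * Bbes nu (s * of_real x)" for x :: real
  define Y where "Y x = Re (\<omega> * (cnj (A x) * B x))" for x
  define g where "g x = Re (\<omega> * s\<^sup>2) * (norm (A x))\<^sup>2 - Re \<omega> * (norm (B x))\<^sup>2" for x
  have dl: "((\<lambda>x. s * of_real x) has_vector_derivative s) (at x)" for x :: real
    by (auto intro!: derivative_eq_intros)
  have dA: "(A has_vector_derivative - B x) (at x)" for x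
    using field_vector_diff_chain_at[OF dl has_field_derivative_Abes[OF nu]]
    by (simp add: A_def[abs_def] B_def o_def)
  have dB: "(B has_vector_derivative s\<^sup>2 * A x - of_real (q / x) * B x) (at x)" if x: "0 < x" for x
  proof -
    have "s * of_real x \<noteq> 0" using s0 x by simp
    from has_vector_derivative_mult_right[OF field_vector_diff_chain_at[OF dl has_field_derivative_Bbes'[OF nu this]], of s]
    have "(B has_vector_derivative s * (s * (Abes nu (s * of_real x) - of_real (2 * nu + 1) / (s * of_real x) * Bbes nu (s * of_real x)))) (at x)"
      by (simp add: B_def[abs_def] o_def)
    then show ?thesis
      by (rule has_vector_derivative_eq_rhs)
        (use s0 x in \<open>simp add: A_def B_def q_def power2_eq_square field_simps\<close>)
  qed
  have dY: "(Y has_real_derivative g x - q / x * Y x) (at x)" if x: "0 < x" for x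
  proof -
    have "((\<lambda>x. \<omega> * (cnj (A x) * B x)) has_vector_derivative
       \<omega> * (cnj (A x) * (s\<^sup>2 * A x - of_real (q / x) * B x) + cnj (- B x) * B x)) (at x)"
      by (intro has_vector_derivative_mult_right has_vector_derivative_mult has_vector_derivative_cnj dA dB x)
    from has_field_derivative_Re[OF this]
    have der: "(Y has_real_derivative Re (\<omega> * (cnj (A x) * (s\<^sup>2 * A x - of_real (q / x) * B x) + cnj (- B x) * B x))) (at x)"
      by (simp add: Y_def[abs_def])
    have eq: "\<omega> * (cnj (A x) * (s\<^sup>2 * A x - of_real (q / x) * B x) + cnj (- B x) * B x)
      = of_real ((norm (A x))\<^sup>2) * (\<omega> * s\<^sup>2) - of_real ((norm (B x))\<^sup>2) * \<omega> - of_real (q / x) * (\<omega> * (cnj (A x) * B x))"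
      unfolding complex_norm_square by (simp add: algebra_simps)
    have "Re (\<omega> * (cnj (A x) * (s\<^sup>2 * A x - of_real (q / x) * B x) + cnj (- B x) * B x)) = g x - q / x * Y x"
      unfolding eq minus_complex.sel Re_of_real_mult g_def Y_def by (simp only: mult.commute)
    then show ?thesis using der by simp
  qed
  have g0: "0 \<le> g x" for x
    unfolding g_def using mult_nonneg_nonneg[OF less_imp_le[OF \<omega>(2)] zero_le_power2[of "norm (A x)"]]
      mult_nonpos_nonneg[OF \<omega>(1) zero_le_power2[of "norm (B x)"]] by linarith
  define Z where "Z x = x powr q * Y x" for x
  have dZ: "(Z has_real_derivative x powr q * g x) (at x)" if x: "0 < x" for x
  proof -
    have "(Z has_real_derivative q * x powr (q - 1) * Y x + (g x - q / x * Y x) * x powr q) (at x)"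
      unfolding Z_def[abs_def] by (rule DERIV_mult[OF has_real_derivative_powr[OF x] dY[OF x]])
    then show ?thesis
      by (rule DERIV_cong) (use x in \<open>simp add: powr_diff field_simps\<close>)
  qed
  have mono: "Z x \<le> Z y" if "0 < x" "x \<le> y" for x y
    using that(2)
  proof (rule DERIV_nonneg_imp_nondecreasing)
    fix t assume "x \<le> t" "t \<le> y"
    then show "\<exists>D. (Z has_real_derivative D) (at t) \<and> 0 \<le> D"
      using dZ[of t] g0[of t] that by (intro exI[of _ "t powr q * g t"]) auto
  qed
  have Y1: "Y 1 = 0" using zero by (auto simp: Y_def A_def B_def)
  \<comment> \<open>B contributes a factor x, so Z = x^(q+1) h(x) with \<open>h\<close> continuous
    at 0 from the right; q + 1 > 0 is exactly \<nu> > -1.\<close>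
  have lim: "(Z \<longlongrightarrow> 0) (at_right 0)"
  proof -
    define h where "h x = Re (\<omega> * (cnj (A x) * (s * (s / 2 * bessel_series nu 1 ((s * of_real x / 2)\<^sup>2)))))" for x :: real
    have "isCont (bessel_series nu 1) z" for z
      by (rule DERIV_isCont[OF has_field_derivative_bessel_series[OF nu]])
    then have "continuous_on UNIV (bessel_series nu 1)" by (simp add: continuous_at_imp_continuous_on)
    then have c1: "isCont (\<lambda>x. bessel_series nu 1 ((s * of_real x / 2)\<^sup>2)) x" for x :: real
      using continuous_on_compose2[of UNIV "bessel_series nu 1" UNIV "\<lambda>x::real. (s * of_real x / 2)\<^sup>2"]
      by (simp add: continuous_on_eq_continuous_at continuous_intros)
    have "isCont A 0" using has_vector_derivative_continuous[OF dA] .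
    then have "(A \<longlongrightarrow> A 0) (at_right 0)"
      unfolding isCont_def by (metis filterlim_at_split)
    moreover have "((\<lambda>x. bessel_series nu 1 ((s * of_real x / 2)\<^sup>2)) \<longlongrightarrow> bessel_series nu 1 ((s * of_real 0 / 2)\<^sup>2)) (at_right 0)"
      using c1[of 0] unfolding isCont_def by (metis (no_types, lifting) filterlim_at_split)
    ultimately have h: "(h \<longlongrightarrow> h 0) (at_right 0)"
      unfolding h_def by (intro tendsto_intros)
    have "((\<lambda>x. x powr (q + 1)) \<longlongrightarrow> 0) (at_right 0)"
      using q by (intro tendsto_zero_powrI[where b = "q + 1"])
         (auto intro!: tendsto_intros eventually_at_right_less[THEN eventually_mono])
    from tendsto_mult[OF this h] have "((\<lambda>x. x powr (q + 1) * h x) \<longlongrightarrow> 0) (at_right 0)" by simp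
    moreover have "\<forall>\<^sub>F x in at_right 0. x powr (q + 1) * h x = Z x"
      using eventually_at_right_less[of 0]
    proof eventually_elim
      case (elim x)
      have "\<omega> * (cnj (A x) * B x) = of_real x * (\<omega> * (cnj (A x) * (s * (s / 2 * bessel_series nu 1 ((s * of_real x / 2)\<^sup>2)))))"
        unfolding B_def Bbes_eq_series[OF nu] by (simp add: mult_ac)
      then have "Y x = x * h x" unfolding Y_def h_def by (simp only: Re_of_real_mult)
      then show ?case using elim by (simp add: Z_def powr_add)
    qed
    ultimately show ?thesis by (rule Lim_transform_eventually)
  qed
  have Zge: "0 \<le> Z x" if x: "0 < x" for x
  proof (rule tendsto_upperbound[OF lim])
    show "\<forall>\<^sub>F t in at_right 0. Z t \<le> Z x"
      unfolding eventually_at_right_field using x mono by (intro exI[of _ x]) auto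
  qed simp
  have Z0: "Z x = 0" if x: "0 < x" "x \<le> 1" for x
    using Zge[OF x(1)] mono[OF x] Y1 by (simp add: Z_def)
  have gz: "g x = 0" if x: "0 < x" "x < 1" for x
  proof -
    have "(Z has_real_derivative 0) (at x)"
    proof (rule has_field_derivative_transform_within_open[where f = "\<lambda>_. 0" and S = "{0<..<1}"])
      show "0 = Z t" if "t \<in> {0<..<1}" for t using Z0[of t] that by simp
    qed (use x in auto)
    then have "x powr q * g x = 0" using dZ[OF x(1)] DERIV_unique by blast
    then show ?thesis using x by simp
  qed
  have Az: "A x = 0" if x: "0 < x" "x < 1" for x
  proof (rule ccontr)
    assume "A x \<noteq> 0"
    then have "0 < Re (\<omega> * s\<^sup>2) * (norm (A x))\<^sup>2" using \<omega> by simp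
    moreover have "Re \<omega> * (norm (B x))\<^sup>2 \<le> 0" using \<omega> by (simp add: mult_nonpos_nonneg)
    ultimately show False using gz[OF x] by (simp add: g_def)
  qed
  have "A 0 = 1" by (simp add: A_def Abes_0)
  moreover have "isCont A 0" using has_vector_derivative_continuous[OF dA] .
  ultimately have "(A \<longlongrightarrow> 1) (at_right 0)"
    unfolding isCont_def by (metis filterlim_at_split)
  moreover have "\<forall>\<^sub>F t in at_right 0. A t = 0"
    unfolding eventually_at_right_field using Az by (auto intro!: exI[of _ 1])
  ultimately have "((\<lambda>t. 0::complex) \<longlongrightarrow> 1) (at_right (0::real))"
    by (rule Lim_transform_eventually)
  from tendsto_unique[OF trivial_limit_at_right_real this tendsto_const] show False by simp
qed


text \<open>What the residue argument uses of A and B. Both satisfy it with a = \<nu> + 1/2: the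
  sign change of the first-order system for B affects neither E'' = -(2a/s) E' at the zeros nor the
  weight. The gap concerns positive zeros, the others follow by symmetry; the circle bound is
  available only for one radius in each interval of length 2.\<close>

locale interpolation_function =
  fixes a :: real and E :: "complex \<Rightarrow> complex"
  assumes holo: "E holomorphic_on UNIV"
    and zeros_real: "\<And>s. E s = 0 \<Longrightarrow> s \<in> \<real>"
    and zeros_simple: "\<And>s. E s = 0 \<Longrightarrow> deriv E s \<noteq> 0"
    and second: "\<And>s. E s = 0 \<Longrightarrow> s \<noteq> 0 \<Longrightarrow> deriv (deriv E) s = - of_real (2 * a) / s * deriv E s"
    and second_0: "E 0 = 0 \<Longrightarrow> deriv (deriv E) 0 = 0"
    and zeros_minus: "\<And>s. E s = 0 \<Longrightarrow> E (- s) = 0"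
    and deriv_lower: "\<exists>x0 c. 0 < c \<and> (\<forall>s. E s = 0 \<longrightarrow> x0 \<le> norm s \<longrightarrow> c \<le> norm s powr (2 * a) * (norm (deriv E s))\<^sup>2)"
    and zeros_gap: "\<exists>x0 \<delta>. 0 < \<delta> \<and> (\<forall>s t. x0 \<le> s \<longrightarrow> s < t \<longrightarrow> E (of_real s) = 0 \<longrightarrow> E (of_real t) = 0 \<longrightarrow> \<delta> \<le> t - s)"
    and circles: "\<exists>x0 c. 0 < c \<and> (\<forall>x\<ge>x0. \<exists>R\<in>{x..x + 2}. \<forall>w. norm w = R \<longrightarrow>
                    c * exp (2 * \<bar>Im w\<bar>) \<le> norm w powr (2 * a) * (norm (E w))\<^sup>2)"

text \<open>The exponent \<open>b\<close> is kept separate from the parameter \<open>a\<close> of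
  the system, because for B the system has a = - b. At a zero of E the energy reduces to v^2, which
  yields the lower bound for the derivative.\<close>

lemma (in bessel_system) interpolation_functionI:
  assumes holo: "E holomorphic_on UNIV"
    and zr: "\<And>s. E s = 0 \<Longrightarrow> s \<in> \<real>"
    and "\<And>s. E s = 0 \<Longrightarrow> deriv E s \<noteq> 0"
    and "\<And>s. E s = 0 \<Longrightarrow> s \<noteq> 0 \<Longrightarrow> deriv (deriv E) s = - of_real (2 * b) / s * deriv E s"
    and "E 0 = 0 \<Longrightarrow> deriv (deriv E) 0 = 0"
    and minus: "\<And>z. norm (E (- z)) = norm (E z)" and cnj: "\<And>z. norm (E (cnj z)) = norm (E z)"
    and dminus: "\<And>z. norm (deriv E (- z)) = norm (deriv E z)"
    and U: "\<And>w. U w = w powr of_real b * E w"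
    and V: "\<And>x. 0 < x \<Longrightarrow> E (of_real x) = 0 \<Longrightarrow> norm (V (of_real x)) = x powr b * norm (deriv E (of_real x))"
  shows "interpolation_function b E"
proof
  have nU: "norm (U w) = norm w powr b * norm (E w)" for w
    by (simp add: U norm_mult norm_powr_real_powr')
  have powr2: "r powr (2 * b) = (r powr b)\<^sup>2" for r :: real
    by (simp add: power2_eq_square powr_add[symmetric])
  show "E (- s) = 0" if "E s = 0" for s using minus[of s] that by simp
  obtain x1 c C where x1: "1 \<le> x1" and c: "0 < c" and "0 < C"
    and lo: "\<And>x. x1 \<le> x \<Longrightarrow> c \<le> (u x)\<^sup>2 + (v x)\<^sup>2" and "\<And>x. x1 \<le> x \<Longrightarrow> (u x)\<^sup>2 + (v x)\<^sup>2 \<le> C"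
    using energy_bounds by blast
  have uz: "u x = 0" if "0 < x" "E (of_real x) = 0" for x
    using that by (simp add: u_def U)
  have "c \<le> norm s powr (2 * b) * (norm (deriv E s))\<^sup>2" if s: "E s = 0" "x1 \<le> norm s" for s
  proof -
    define x where "x = norm s"
    have x0: "0 < x" "x1 \<le> x" using s x1 by (auto simp: x_def)
    have "s \<in> \<real>" using zr s by simp
    then have "of_real x = s \<or> of_real x = - s"
      unfolding x_def by (cases rule: Reals_cases) (auto simp: abs_if)
    then have nE: "norm (E (of_real x)) = norm (E s)" and nd: "norm (deriv E (of_real x)) = norm (deriv E s)"
      using minus[of s] dminus[of s] by auto
    have Ex: "E (of_real x) = 0" using nE s by simp
    have "c \<le> (v x)\<^sup>2" using lo[OF x0(2)] uz[OF x0(1) Ex] by simp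
    also have "\<dots> = (norm (V (of_real x)))\<^sup>2" using V_of_real[OF x0(1)] by simp
    also have "\<dots> = norm s powr (2 * b) * (norm (deriv E s))\<^sup>2"
      unfolding V[OF x0(1) Ex] nd powr2 by (simp add: power_mult_distrib x_def)
    finally show ?thesis .
  qed
  then show "\<exists>x0 c. 0 < c \<and> (\<forall>s. E s = 0 \<longrightarrow> x0 \<le> norm s \<longrightarrow> c \<le> norm s powr (2 * b) * (norm (deriv E s))\<^sup>2)"
    using c by blast
  obtain x2 \<delta> where "1 \<le> x2" "0 < \<delta>"
    "\<And>s t. x2 \<le> s \<Longrightarrow> s < t \<Longrightarrow> u s = 0 \<Longrightarrow> u t = 0 \<Longrightarrow> \<delta> \<le> t - s"
    using zero_gap by blast
  then show "\<exists>x0 \<delta>. 0 < \<delta> \<and> (\<forall>s t. x0 \<le> s \<longrightarrow> s < t \<longrightarrow> E (of_real s) = 0 \<longrightarrow> E (of_real t) = 0 \<longrightarrow> \<delta> \<le> t - s)"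
    using uz by (intro exI[of _ x2] exI[of _ \<delta>]) auto
  obtain x3 k where x3: "1 \<le> x3" and k: "0 < k"
    and circ: "\<And>x. x3 \<le> x \<Longrightarrow> \<exists>R\<in>{x..x + 2}. \<forall>w. norm w = R \<longrightarrow> 0 \<le> Re w \<longrightarrow> 0 \<le> Im w \<longrightarrow> k * exp (Im w) \<le> norm (U w)"
    using circle_lower_bound by blast
  have "\<exists>R\<in>{x..x + 2}. \<forall>w. norm w = R \<longrightarrow> k\<^sup>2 * exp (2 * \<bar>Im w\<bar>) \<le> norm w powr (2 * b) * (norm (E w))\<^sup>2"
    if x: "x3 \<le> x" for x
  proof -
    obtain R where R: "R \<in> {x..x + 2}"
      "\<And>w. norm w = R \<Longrightarrow> 0 \<le> Re w \<Longrightarrow> 0 \<le> Im w \<Longrightarrow> k * exp (Im w) \<le> norm (U w)"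
      using circ[OF x] by blast
    have "k\<^sup>2 * exp (2 * \<bar>Im w\<bar>) \<le> norm w powr (2 * b) * (norm (E w))\<^sup>2" if w: "norm w = R" for w
    proof -
      \<comment> \<open>Reflects w into the closed first quadrant, where the circle bound is known;
        the symmetries under minus and conjugation preserve |E|.\<close>
      define z where "z = Complex \<bar>Re w\<bar> \<bar>Im w\<bar>"
      have nz: "norm z = norm w" by (simp add: z_def cmod_def)
      have "z = w \<or> z = - w \<or> z = cnj w \<or> z = - cnj w"
        by (auto simp: z_def complex_eq_iff abs_if)
      then have Ez: "norm (E z) = norm (E w)"
        using minus cnj by auto
      have "k * exp (Im z) \<le> norm (U z)" using w nz by (intro R) (auto simp: z_def)
      moreover have "Im z = \<bar>Im w\<bar>" by (simp add: z_def)
      ultimately have "(k * exp \<bar>Im w\<bar>)\<^sup>2 \<le> (norm w powr b * norm (E w))\<^sup>2"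
        using k by (intro power_mono) (auto simp: nU nz Ez)
      then show ?thesis
        by (simp add: powr2 power_mult_distrib exp_double)
    qed
    then show ?thesis using R(1) by blast
  qed
  then show "\<exists>x0 c. 0 < c \<and> (\<forall>x\<ge>x0. \<exists>R\<in>{x..x + 2}. \<forall>w. norm w = R \<longrightarrow>
                    c * exp (2 * \<bar>Im w\<bar>) \<le> norm w powr (2 * b) * (norm (E w))\<^sup>2)"
    using k by (intro exI[of _ x3] exI[of _ "k\<^sup>2"]) auto
qed (fact assms)+

text \<open>A constant multiple of sqrt w J_\<nu>(w), and \<open>bessel_V\<close> below is the same
  multiple of sqrt w J_(\<nu>+1)(w). This normalisation makes the solutions bounded on the positive
  axis at infinity and the coupling symmetric, plus and minus a/w.\<close>

definition bessel_U :: "real \<Rightarrow> complex \<Rightarrow> complex" where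
  "bessel_U nu w = w powr of_real (nu + 1 / 2) * Abes nu w"

definition bessel_V :: "real \<Rightarrow> complex \<Rightarrow> complex" where
  "bessel_V nu w = w powr of_real (nu + 1 / 2) * Bbes nu w"

lemma bessel_powr_derivs:
  assumes nu: "nu > -1" and w: "0 \<le> Re w" "w \<noteq> 0"
  defines "a \<equiv> nu + 1 / 2"
  shows "(bessel_U nu has_field_derivative of_real a / w * bessel_U nu w - bessel_V nu w) (at w)"
    "(bessel_V nu has_field_derivative bessel_U nu w - of_real a / w * bessel_V nu w) (at w)"
proof -
  note UV = bessel_U_def bessel_V_def
  have "w \<notin> \<real>\<^sub>\<le>\<^sub>0" using w by (auto simp: complex_nonpos_Reals_iff complex_eq_iff)
  then have "((\<lambda>w. w powr of_real a) has_field_derivative of_real a * w powr (of_real a - 1)) (at w)"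
    by (rule has_field_derivative_powr)
  then have p: "((\<lambda>w. w powr of_real a) has_field_derivative of_real a / w * w powr of_real a) (at w)"
    by (rule DERIV_cong) (use w in \<open>simp add: powr_diff\<close>)
  have "(bessel_U nu has_field_derivative of_real a / w * w powr of_real a * Abes nu w + - Bbes nu w * w powr of_real a) (at w)"
    unfolding UV[abs_def] a_def[symmetric] by (rule DERIV_mult[OF p has_field_derivative_Abes[OF nu]])
  then show "(bessel_U nu has_field_derivative of_real a / w * bessel_U nu w - bessel_V nu w) (at w)"
    by (rule DERIV_cong) (unfold UV a_def[symmetric], simp)
  have "(bessel_V nu has_field_derivative of_real a / w * w powr of_real a * Bbes nu w
      + (Abes nu w - of_real (2 * nu + 1) / w * Bbes nu w) * w powr of_real a) (at w)"
    unfolding UV[abs_def] a_def[symmetric] by (rule DERIV_mult[OF p has_field_derivative_Bbes'[OF nu w(2)]])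
  moreover have "of_real (2 * nu + 1) = (2 * of_real a :: complex)" by (simp add: a_def)
  ultimately have "(bessel_V nu has_field_derivative of_real a / w * w powr of_real a * Bbes nu w
      + (Abes nu w - 2 * of_real a / w * Bbes nu w) * w powr of_real a) (at w)" by simp
  then show "(bessel_V nu has_field_derivative bessel_U nu w - of_real a / w * bessel_V nu w) (at w)"
    by (rule DERIV_cong) (unfold UV a_def[symmetric], use w in \<open>simp add: field_simps\<close>)
qed

lemma bessel_system_Abes:
  assumes nu: "nu > -1"
  shows "bessel_system (nu + 1 / 2) (bessel_U nu) (bessel_V nu)"
proof
  show "bessel_U nu (of_real x) \<in> \<real>" "bessel_V nu (of_real x) \<in> \<real>" if "0 < x" for x
    unfolding bessel_U_def bessel_V_def using that Abes_of_real[OF nu] Bbes_of_real[OF nu]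
    by (auto simp: powr_of_real intro!: Reals_mult)
  show "bessel_U nu (of_real x) \<noteq> 0 \<or> bessel_V nu (of_real x) \<noteq> 0" if "0 < x" for x
    using that Abes_Bbes_no_common_zero[OF nu that] by (auto simp: bessel_U_def bessel_V_def)
qed (use bessel_powr_derivs[OF nu] in blast)+

lemma bessel_system_Bbes:
  assumes nu: "nu > -1"
  shows "bessel_system (- (nu + 1 / 2)) (bessel_V nu) (\<lambda>w. - bessel_U nu w)"
proof -
  interpret bessel_system "nu + 1 / 2" "bessel_U nu" "bessel_V nu"
    by (rule bessel_system_Abes[OF nu])
  show ?thesis
  proof
    fix w :: complex assume w: "0 \<le> Re w" "w \<noteq> 0"
    show "(bessel_V nu has_field_derivative
       of_real (- (nu + 1 / 2)) / w * bessel_V nu w - - bessel_U nu w) (at w)"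
      by (rule DERIV_cong[OF deriv_V[OF w]]) (unfold of_real_minus, simp del: of_real_add)
    show "((\<lambda>w. - bessel_U nu w) has_field_derivative
       bessel_V nu w - of_real (- (nu + 1 / 2)) / w * - bessel_U nu w) (at w)"
      by (rule DERIV_cong[OF DERIV_minus[OF deriv_U[OF w]]]) (unfold of_real_minus, simp del: of_real_add)
  qed (use real_U real_V nontrivial in auto)
qed

lemma deriv_Abes: "nu > -1 \<Longrightarrow> deriv (Abes nu) z = - Bbes nu z"
  by (rule DERIV_imp_deriv[OF has_field_derivative_Abes])

lemma deriv_Bbes: "nu > -1 \<Longrightarrow> z \<noteq> 0 \<Longrightarrow> deriv (Bbes nu) z = Abes nu z - of_real (2 * nu + 1) / z * Bbes nu z"
  by (rule DERIV_imp_deriv[OF has_field_derivative_Bbes'])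

lemma Abes_Bbes_no_common_zero':
  assumes nu: "nu > -1"
  shows "Abes nu s \<noteq> 0 \<or> Bbes nu s \<noteq> 0"
proof (cases "s \<in> \<real>")
  case True
  then obtain x where x: "s = of_real x" by (elim Reals_cases)
  consider "x > 0" | "x = 0" | "x < 0" by linarith
  then show ?thesis
  proof cases
    case 1 then show ?thesis using Abes_Bbes_no_common_zero[OF nu 1] x by simp
  next
    case 2 then show ?thesis using x by (simp add: Abes_0)
  next
    case 3
    then show ?thesis using Abes_Bbes_no_common_zero[OF nu, of "- x"] x
      by (simp add: Abes_minus Bbes_minus[OF nu])
  qed
qed (use bessel_zeros_real[OF nu] in auto)

lemma interpolation_function_Abes:
  assumes nu: "nu > -1"
  shows "interpolation_function (nu + 1 / 2) (Abes nu)"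
proof -
  interpret bessel_system "nu + 1 / 2" "bessel_U nu" "bessel_V nu"
    by (rule bessel_system_Abes[OF nu])
  have e: "2 * (nu + 1 / 2) = 2 * nu + 1" by simp
  have dA: "deriv (Abes nu) = (\<lambda>z. - Bbes nu z)" using deriv_Abes[OF nu] by auto
  show ?thesis
  proof (rule interpolation_functionI)
    show "Abes nu holomorphic_on UNIV" by (rule holomorphic_Abes[OF nu])
    show "s \<in> \<real>" if "Abes nu s = 0" for s using bessel_zeros_real[OF nu] that by blast
    show "deriv (Abes nu) s \<noteq> 0" if "Abes nu s = 0" for s
      using Abes_Bbes_no_common_zero'[OF nu, of s] that by (simp add: dA)
    show "deriv (deriv (Abes nu)) s = - of_real (2 * (nu + 1 / 2)) / s * deriv (Abes nu) s"
      if "Abes nu s = 0" "s \<noteq> 0" for s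
    proof -
      have "deriv (\<lambda>z. - Bbes nu z) s = - (Abes nu s - of_real (2 * nu + 1) / s * Bbes nu s)"
        by (intro DERIV_imp_deriv DERIV_minus has_field_derivative_Bbes' nu that)
      then show ?thesis unfolding dA e using that by (simp add: field_simps)
    qed
    show "norm (bessel_V nu (of_real x))
        = x powr (nu + 1 / 2) * norm (deriv (Abes nu) (of_real x))" if "0 < x" for x
      using that by (simp add: norm_mult norm_powr_real_powr' dA bessel_V_def)
    show "norm (Abes nu (cnj z)) = norm (Abes nu z)" for z
      by (metis cnj_Abes[OF nu] complex_mod_cnj)
  qed (auto simp: Abes_0 Abes_minus dA Bbes_minus[OF nu] bessel_U_def)
qed

lemma interpolation_function_Bbes:
  assumes nu: "nu > -1"
  shows "interpolation_function (nu + 1 / 2) (Bbes nu)"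
proof -
  interpret bessel_system "- (nu + 1 / 2)" "bessel_V nu" "\<lambda>w. - bessel_U nu w"
    by (rule bessel_system_Bbes[OF nu])
  have e: "2 * (nu + 1 / 2) = 2 * nu + 1" by simp
  have dB: "deriv (Bbes nu) z = Abes nu z - of_real (nu + 1 / 2) * bessel_series nu 1 ((z / 2)\<^sup>2)" for z
    by (rule DERIV_imp_deriv[OF has_field_derivative_Bbes[OF nu]])
  show ?thesis
  proof (rule interpolation_functionI)
    show "Bbes nu holomorphic_on UNIV" by (rule holomorphic_Bbes[OF nu])
    show "s \<in> \<real>" if "Bbes nu s = 0" for s using bessel_zeros_real[OF nu] that by blast
    show "deriv (Bbes nu) s \<noteq> 0" if "Bbes nu s = 0" for s
    proof (cases "s = 0")
      case True
      then show ?thesis unfolding True deriv_Bbes_0[OF nu] of_real_eq_0_iff using nu by simp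
    next
      case False
      then show ?thesis using Abes_Bbes_no_common_zero'[OF nu, of s] that deriv_Bbes[OF nu, of s] by simp
    qed
    show "deriv (deriv (Bbes nu)) s = - of_real (2 * (nu + 1 / 2)) / s * deriv (Bbes nu) s"
      if s: "Bbes nu s = 0" "s \<noteq> 0" for s
    proof -
      have "((\<lambda>z. Abes nu z - of_real (2 * nu + 1) / z * Bbes nu z) has_field_derivative
          - Bbes nu s - (- of_real (2 * nu + 1) / s\<^sup>2 * Bbes nu s
             + (Abes nu s - of_real (2 * nu + 1) / s * Bbes nu s) * (of_real (2 * nu + 1) / s))) (at s)"
        using s by (intro DERIV_diff has_field_derivative_Abes nu DERIV_mult has_field_derivative_Bbes')
          (auto intro!: derivative_eq_intros simp: power2_eq_square)
      then have "(deriv (Bbes nu) has_field_derivative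
          - Bbes nu s - (- of_real (2 * nu + 1) / s\<^sup>2 * Bbes nu s
             + (Abes nu s - of_real (2 * nu + 1) / s * Bbes nu s) * (of_real (2 * nu + 1) / s))) (at s)"
        by (rule has_field_derivative_transform_within_open[where S = "- {0}"]) (use s deriv_Bbes[OF nu] in auto)
      from DERIV_imp_deriv[OF this] show ?thesis
        unfolding e using s deriv_Bbes[OF nu s(2)] by (simp add: field_simps)
    qed
    show "deriv (deriv (Bbes nu)) 0 = 0"
    proof -
      have "((\<lambda>z. Abes nu z - of_real (nu + 1 / 2) * bessel_series nu 1 ((z / 2)\<^sup>2)) has_field_derivative
          - Bbes nu 0 - of_real (nu + 1 / 2) * (- bessel_series nu (Suc 1) ((0 / 2)\<^sup>2) * (0 / 2))) (at 0)"
        by (intro DERIV_diff has_field_derivative_Abes nu DERIV_cmult has_field_derivative_bessel_series_square)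
      then have "((\<lambda>z. deriv (Bbes nu) z) has_field_derivative 0) (at 0)"
        unfolding dB by (simp add: Bbes_0[OF nu])
      then show ?thesis by (rule DERIV_imp_deriv)
    qed
    show "norm (- bessel_U nu (of_real x))
        = x powr (nu + 1 / 2) * norm (deriv (Bbes nu) (of_real x))" if "0 < x" "Bbes nu (of_real x) = 0" for x
      using that by (simp add: norm_mult norm_powr_real_powr' deriv_Bbes[OF nu] bessel_U_def)
    show "norm (deriv (Bbes nu) (- z)) = norm (deriv (Bbes nu) z)" for z
      unfolding dB by (simp add: Abes_minus)
    show "norm (Bbes nu (cnj z)) = norm (Bbes nu z)" for z
      by (metis cnj_Bbes[OF nu] complex_mod_cnj)
  qed (auto simp: Bbes_minus[OF nu] bessel_V_def)
qed

section \<open>The interpolation formula\<close>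

text \<open>Factoring E = (w - s) e, the residue is the derivative at s of F / (e^2 (w - z)), with
  e(s) = E'(s) and e'(s) = E''(s) / 2. The term with E'' is the source of the second sum of the
  formula.\<close>

lemma residue_at_double_pole:
  assumes F: "F holomorphic_on UNIV" and E: "E holomorphic_on UNIV"
    and s: "E s = 0" "deriv E s \<noteq> 0" "s \<noteq> z"
  shows "residue (\<lambda>w. F w / ((E w)\<^sup>2 * (w - z))) s =
     - (F s / ((deriv E s)\<^sup>2 * (z - s)\<^sup>2) + deriv F s / ((deriv E s)\<^sup>2 * (z - s))
        - F s * deriv (deriv E) s / ((deriv E s) ^ 3 * (z - s)))"
proof -
  define e where "e = (\<lambda>w. if w = s then deriv E s else (E w - E s) / (w - s))"
  have he: "e holomorphic_on UNIV" unfolding e_def by (rule pole_lemma_open[OF E open_UNIV])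
  have Ee: "E w = (w - s) * e w" for w using s by (simp add: e_def)
  have es: "e s = deriv E s" by (simp add: e_def)
  have de: "(e has_field_derivative deriv e w) (at w)" for w
    using he by (simp add: holomorphic_derivI)
  have dde: "(deriv e has_field_derivative deriv (deriv e) w) (at w)" for w
    using holomorphic_deriv[OF he open_UNIV] by (simp add: holomorphic_derivI)
  have dE: "deriv E w = e w + (w - s) * deriv e w" for w
  proof -
    have "((\<lambda>w. (w - s) * e w) has_field_derivative e w + (w - s) * deriv e w) (at w)"
      by (auto intro!: derivative_eq_intros de)
    moreover have "(\<lambda>w. (w - s) * e w) = E" using Ee by auto
    ultimately show ?thesis by (simp add: DERIV_imp_deriv)
  qed
  have ddE: "deriv (deriv E) s = 2 * deriv e s"
  proof -
    have "((\<lambda>w. e w + (w - s) * deriv e w) has_field_derivative deriv e s + (deriv e s + (s - s) * deriv (deriv e) s)) (at s)"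
      by (auto intro!: derivative_eq_intros de dde)
    moreover have "(\<lambda>w. e w + (w - s) * deriv e w) = deriv E" using dE by auto
    ultimately have "(deriv E has_field_derivative 2 * deriv e s) (at s)" by simp
    then show ?thesis by (rule DERIV_imp_deriv)
  qed
  define h where "h w = F w / ((e w)\<^sup>2 * (w - z))" for w
  define S where "S = {w. e w \<noteq> 0} \<inter> - {z}"
  have "open {w. e w \<noteq> 0}"
    by (intro open_Collect_neq holomorphic_on_imp_continuous_on[OF he] continuous_on_const)
  then have oS: "open S" unfolding S_def by auto
  have sS: "s \<in> S" using s es by (simp add: S_def)
  have hh: "h holomorphic_on S"
    unfolding h_def using holomorphic_on_subset[OF F] holomorphic_on_subset[OF he]
    by (intro holomorphic_intros) (auto simp: S_def)
  have "(\<lambda>w. F w / ((E w)\<^sup>2 * (w - z))) = (\<lambda>w. h w / (w - s) ^ Suc 1)"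
    by (rule ext) (simp add: Ee h_def power_mult_distrib mult_ac power2_eq_square)
  then have "residue (\<lambda>w. F w / ((E w)\<^sup>2 * (w - z))) s = deriv h s"
    using residue_holomorphic_over_power[OF oS sS hh, of 1] by simp
  also have "deriv h s = (deriv F s * ((e s)\<^sup>2 * (s - z)) - F s * (2 * e s * deriv e s * (s - z) + (e s)\<^sup>2)) / ((e s)\<^sup>2 * (s - z))\<^sup>2"
  proof (rule DERIV_imp_deriv)
    have 1: "(F has_field_derivative deriv F s) (at s)" using F by (simp add: holomorphic_derivI)
    have 2: "((\<lambda>w. (e w)\<^sup>2 * (w - z)) has_field_derivative 2 * e s * deriv e s * (s - z) + (e s)\<^sup>2) (at s)"
      by (auto intro!: derivative_eq_intros de)
    have nz: "(e s)\<^sup>2 * (s - z) \<noteq> 0" using s es by simp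
    show "(h has_field_derivative (deriv F s * ((e s)\<^sup>2 * (s - z)) - F s * (2 * e s * deriv e s * (s - z) + (e s)\<^sup>2)) / ((e s)\<^sup>2 * (s - z))\<^sup>2) (at s)"
      unfolding h_def[abs_def] using DERIV_divide[OF 1 2 nz] by (simp add: power2_eq_square)
  qed
  also have "\<dots> = - (F s / ((deriv E s)\<^sup>2 * (z - s)\<^sup>2) + deriv F s / ((deriv E s)\<^sup>2 * (z - s))
        - F s * deriv (deriv E) s / ((deriv E s) ^ 3 * (z - s)))"
  proof -
    define d where "d = s - z"
    have d: "d \<noteq> 0" "z - s = - d" using s by (auto simp: d_def)
    have e0: "e s \<noteq> 0" using s es by simp
    show ?thesis
      unfolding d_def[symmetric] d(2) ddE es[symmetric] using d e0
      by (simp add: field_simps power2_eq_square power3_eq_cube)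
  qed
  finally show ?thesis .
qed

section \<open>Distribution of the zeros\<close>

context interpolation_function
begin

lemma finite_zeros: "finite {s. E s = 0 \<and> norm s \<le> R}"
proof (cases "E constant_on UNIV")
  case True
  then obtain c where c: "\<And>z. E z = c" by (auto simp: constant_on_def)
  then have "E = (\<lambda>_. c)" by auto
  then have "deriv E 0 = 0" by simp
  then have "c \<noteq> 0" using zeros_simple[of 0] c by auto
  then show ?thesis by (simp add: c)
next
  case False
  have "finite {s \<in> cball 0 R. E s = 0}"
    by (rule holomorphic_compact_finite_zeros[OF holo open_UNIV _ _ _ False]) auto
  then show ?thesis by (rule rev_finite_subset) auto
qed

lemma zero_of_real_norm:
  assumes "E s = 0"
  shows "E (of_real (norm s)) = 0" "s = of_real (norm s) \<or> s = - of_real (norm s)"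
proof -
  have "s \<in> \<real>" using assms by (rule zeros_real)
  then show "s = of_real (norm s) \<or> s = - of_real (norm s)"
    by (cases rule: Reals_cases) (auto simp: abs_if)
  then show "E (of_real (norm s)) = 0"
    using assms zeros_minus[OF assms] by (metis minus_minus)
qed

text \<open>Cells of width \<open>\<delta>\<close> contain at most one zero on each half-line, since
  distinct zeros there are at least \<open>\<delta>\<close> apart. \<open>\<sigma>\<close> selects
  the half-line; counting and summability of zeros both reduce to integers in this way.\<close>

lemma zeros_spread:
  obtains x1 \<delta> where "1 \<le> x1" "0 < \<delta>" "\<delta> \<le> x1"
    "\<And>\<sigma>. inj_on (\<lambda>s. nat \<lfloor>norm s / \<delta>\<rfloor>) {s. E s = 0 \<and> x1 \<le> norm s \<and> (0 < Re s) = \<sigma>}"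
proof -
  obtain x0 \<delta> where \<delta>: "0 < \<delta>"
    and gap: "\<And>s t. x0 \<le> s \<Longrightarrow> s < t \<Longrightarrow> E (of_real s) = 0 \<Longrightarrow> E (of_real t) = 0 \<Longrightarrow> \<delta> \<le> t - s"
    using zeros_gap by blast
  define x1 where "x1 = Max {1, x0, \<delta>}"
  have x1: "1 \<le> x1" "x0 \<le> x1" "\<delta> \<le> x1" by (auto simp: x1_def)
  have "inj_on (\<lambda>s. nat \<lfloor>norm s / \<delta>\<rfloor>) {s. E s = 0 \<and> x1 \<le> norm s \<and> (0 < Re s) = \<sigma>}" for \<sigma>
  proof (rule inj_onI, clarify)
    fix s t assume st: "E s = 0" "x1 \<le> norm s" "E t = 0" "x1 \<le> norm t" "(0 < Re t) = (0 < Re s)"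
      and eq: "nat \<lfloor>norm s / \<delta>\<rfloor> = nat \<lfloor>norm t / \<delta>\<rfloor>"
    have fl: "\<lfloor>norm s / \<delta>\<rfloor> = \<lfloor>norm t / \<delta>\<rfloor>" using eq \<delta> by (simp add: eq_nat_nat_iff)
    have no: False if l: "norm p < norm q" "E p = 0" "E q = 0" "x1 \<le> norm p" "\<lfloor>norm p / \<delta>\<rfloor> = \<lfloor>norm q / \<delta>\<rfloor>" for p q
    proof -
      have "\<delta> \<le> norm q - norm p"
        using gap[of "norm p" "norm q"] zero_of_real_norm(1)[of p] zero_of_real_norm(1)[of q] l x1 by auto
      then have "norm p / \<delta> + 1 \<le> norm q / \<delta>" using \<delta> divide_right_mono[of "norm p + \<delta>" "norm q" \<delta>] by (simp add: add_divide_distrib)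
      then have "\<lfloor>norm p / \<delta> + 1\<rfloor> \<le> \<lfloor>norm q / \<delta>\<rfloor>" by (rule floor_mono)
      then show False using l(5) by simp
    qed
    have "norm s = norm t"
      using no[of s t] no[of t s] st fl by (metis linorder_neqE_linordered_idom)
    moreover have "0 < norm s" using st x1 by linarith
    ultimately show "s = t"
      using zero_of_real_norm(2)[OF st(1)] zero_of_real_norm(2)[OF st(3)] st(5)
      by (metis Re_complex_of_real uminus_complex.sel(1) neg_0_less_iff_less less_asym)
  qed
  then show ?thesis using that[OF x1(1) \<delta> x1(3)] by blast
qed

lemma card_zeros_le:
  obtains x1 N where "\<And>R. x1 \<le> R \<Longrightarrow> real (card {s. E s = 0 \<and> R < norm s \<and> norm s \<le> R + 2}) \<le> N"
proof -
  obtain x1 \<delta> where x1: "1 \<le> x1" and \<delta>: "0 < \<delta>" and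
    inj: "\<And>\<sigma>. inj_on (\<lambda>s. nat \<lfloor>norm s / \<delta>\<rfloor>) {s. E s = 0 \<and> x1 \<le> norm s \<and> (0 < Re s) = \<sigma>}"
    using zeros_spread by blast
  have half: "real (card {s. E s = 0 \<and> R < norm s \<and> norm s \<le> R + 2 \<and> (0 < Re s) = \<sigma>}) \<le> 2 / \<delta> + 2"
    if R: "x1 \<le> R" for R \<sigma>
  proof -
    let ?Z = "{s. E s = 0 \<and> R < norm s \<and> norm s \<le> R + 2 \<and> (0 < Re s) = \<sigma>}"
    let ?f = "\<lambda>s. nat \<lfloor>norm s / \<delta>\<rfloor>"
    have R0: "0 < R" using R x1 by simp
    have "card ?Z = card (?f ` ?Z)"
      by (rule card_image[symmetric], rule inj_on_subset[OF inj[of \<sigma>]]) (use R in auto)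
    also have "\<dots> \<le> card {nat \<lfloor>R / \<delta>\<rfloor>..nat \<lfloor>(R + 2) / \<delta>\<rfloor>}"
      using \<delta> by (intro card_mono) (auto intro!: nat_mono floor_mono divide_right_mono)
    also have "\<dots> = Suc (nat \<lfloor>(R + 2) / \<delta>\<rfloor>) - nat \<lfloor>R / \<delta>\<rfloor>" by simp
    finally have "real (card ?Z) \<le> real (Suc (nat \<lfloor>(R + 2) / \<delta>\<rfloor>) - nat \<lfloor>R / \<delta>\<rfloor>)" by simp
    also have "\<dots> \<le> 2 / \<delta> + 2"
    proof -
      have fR: "0 \<le> \<lfloor>R / \<delta>\<rfloor>" "0 \<le> \<lfloor>(R + 2) / \<delta>\<rfloor>" using R0 \<delta> by auto
      have "nat \<lfloor>R / \<delta>\<rfloor> \<le> nat \<lfloor>(R + 2) / \<delta>\<rfloor>"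
        using \<delta> by (intro nat_mono floor_mono divide_right_mono) auto
      then have "real (Suc (nat \<lfloor>(R + 2) / \<delta>\<rfloor>) - nat \<lfloor>R / \<delta>\<rfloor>) = of_int \<lfloor>(R + 2) / \<delta>\<rfloor> + 1 - of_int \<lfloor>R / \<delta>\<rfloor>"
        using fR by (simp add: of_nat_diff)
      also have "\<dots> \<le> (R + 2) / \<delta> + 1 - (R / \<delta> - 1)"
        using of_int_floor_le[of "(R + 2) / \<delta>"] floor_correct[of "R / \<delta>"] by linarith
      also have "\<dots> = 2 / \<delta> + 2" by (simp add: add_divide_distrib)
      finally show ?thesis .
    qed
    finally show ?thesis .
  qed
  show ?thesis
  proof (rule that[of x1 "2 * (2 / \<delta> + 2)"])
    fix R assume R: "x1 \<le> R"
    have eq: "{s. E s = 0 \<and> R < norm s \<and> norm s \<le> R + 2} =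
        {s. E s = 0 \<and> R < norm s \<and> norm s \<le> R + 2 \<and> (0 < Re s) = True} \<union>
        {s. E s = 0 \<and> R < norm s \<and> norm s \<le> R + 2 \<and> (0 < Re s) = False}" by auto
    have "card {s. E s = 0 \<and> R < norm s \<and> norm s \<le> R + 2} \<le>
        card {s. E s = 0 \<and> R < norm s \<and> norm s \<le> R + 2 \<and> (0 < Re s) = True} +
        card {s. E s = 0 \<and> R < norm s \<and> norm s \<le> R + 2 \<and> (0 < Re s) = False}"
      by (subst eq) (rule card_Un_le)
    from of_nat_mono[OF this, where 'a = real]
    have "real (card {s. E s = 0 \<and> R < norm s \<and> norm s \<le> R + 2}) \<le> (2 / \<delta> + 2) + (2 / \<delta> + 2)"
      unfolding of_nat_add by (rule order_trans[OF _ add_mono[OF half[OF R, of True] half[OF R, of False]]])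
    then show "real (card {s. E s = 0 \<and> R < norm s \<and> norm s \<le> R + 2}) \<le> 2 * (2 / \<delta> + 2)"
      by simp
  qed
qed

lemma summable_zeros:
  obtains x1 where "1 \<le> x1" "(\<lambda>s. 1 / (norm s)\<^sup>2) summable_on {s. E s = 0 \<and> x1 \<le> norm s}"
proof -
  obtain x1 \<delta> where x1: "1 \<le> x1" and \<delta>: "0 < \<delta>" "\<delta> \<le> x1" and
    inj: "\<And>\<sigma>. inj_on (\<lambda>s. nat \<lfloor>norm s / \<delta>\<rfloor>) {s. E s = 0 \<and> x1 \<le> norm s \<and> (0 < Re s) = \<sigma>}"
    using zeros_spread by blast
  have half: "(\<lambda>s. 1 / (norm s)\<^sup>2) summable_on {s. E s = 0 \<and> x1 \<le> norm s \<and> (0 < Re s) = \<sigma>}" for \<sigma>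
  proof -
    let ?Z = "{s. E s = 0 \<and> x1 \<le> norm s \<and> (0 < Re s) = \<sigma>}"
    let ?f = "\<lambda>s. nat \<lfloor>norm s / \<delta>\<rfloor>"
    have "summable (\<lambda>n. inverse (real n ^ 2))" by (rule inverse_power_summable) simp
    then have "(\<lambda>n. inverse (real n ^ 2)) summable_on UNIV"
      by (subst summable_on_UNIV_nonneg_real_iff) auto
    then have "(\<lambda>n. inverse (real n ^ 2)) summable_on (?f ` ?Z)"
      by (rule summable_on_subset_banach) auto
    then have "(\<lambda>s. inverse (real (?f s) ^ 2)) summable_on ?Z"
      unfolding summable_on_reindex[OF inj] by (simp add: o_def)
    then have "(\<lambda>s. 1 / \<delta>\<^sup>2 * inverse (real (?f s) ^ 2)) summable_on ?Z"
      by (rule summable_on_cmult_right)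
    then show ?thesis
    proof (rule summable_on_comparison_test)
      fix s assume s: "s \<in> ?Z"
      \<comment> \<open>\<open>\<delta> \<le> x1\<close> keeps the cell index away from 0, where the
        inverse would take its default value.\<close>
      have f1: "1 \<le> \<lfloor>norm s / \<delta>\<rfloor>" using s \<delta> by (simp add: le_floor_iff)
      then have f2: "real (?f s) = of_int \<lfloor>norm s / \<delta>\<rfloor>" by simp
      have "real (?f s) \<le> norm s / \<delta>" unfolding f2 by (rule of_int_floor_le)
      then have "\<delta> * real (?f s) \<le> \<delta> * (norm s / \<delta>)" using \<delta> by (intro mult_left_mono) auto
      then have "\<delta> * real (?f s) \<le> norm s" using \<delta> by simp
      moreover have "0 < \<delta> * real (?f s)" using f1 f2 \<delta> by simp
      ultimately have "1 / (norm s)\<^sup>2 \<le> 1 / (\<delta> * real (?f s))\<^sup>2"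
        by (intro frac_le power_mono zero_less_power) (auto simp del: zero_less_mult_iff)
      then show "1 / (norm s)\<^sup>2 \<le> 1 / \<delta>\<^sup>2 * inverse (real (?f s) ^ 2)"
        by (simp add: power_mult_distrib divide_inverse)
    qed auto
  qed
  have "(\<lambda>s. 1 / (norm s)\<^sup>2) summable_on
     {s. E s = 0 \<and> x1 \<le> norm s \<and> (0 < Re s) = True} \<union> {s. E s = 0 \<and> x1 \<le> norm s \<and> (0 < Re s) = False}"
    by (intro summable_on_Un_disjoint half) auto
  moreover have "{s. E s = 0 \<and> x1 \<le> norm s \<and> (0 < Re s) = True} \<union> {s. E s = 0 \<and> x1 \<le> norm s \<and> (0 < Re s) = False}
    = {s. E s = 0 \<and> x1 \<le> norm s}" by auto
  ultimately show ?thesis using that[OF x1] by simp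
qed

end

section \<open>Residue sums and their uniform limits\<close>

locale interpolation_pair = interpolation_function a E for a E +
  fixes F :: "complex \<Rightarrow> complex"
  assumes F_holo: "F holomorphic_on UNIV"
    and decay: "((\<lambda>w. norm (F w) * norm w powr (2 * a) * exp (- 2 * \<bar>Im w\<bar>)) \<longlongrightarrow> 0) at_infinity"
begin

definition double_part :: "complex \<Rightarrow> complex \<Rightarrow> complex" where
  "double_part s z = F s / ((deriv E s)\<^sup>2 * (z - s)\<^sup>2) + deriv F s / ((deriv E s)\<^sup>2 * (z - s))"

text \<open>For \<open>s = 0\<close> this is \<open>0\<close> by the convention \<open>x / 0 = 0\<close>.\<close>

definition simple_part :: "complex \<Rightarrow> complex \<Rightarrow> complex" where
  "simple_part s z = F s / (s * (deriv E s)\<^sup>2 * (z - s))"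

definition remainder :: "real \<Rightarrow> complex \<Rightarrow> complex" where
  "remainder R z = F z / (E z)\<^sup>2 -
     (\<Sum>s\<in>{s. E s = 0 \<and> norm s \<le> R}. double_part s z + of_real (2 * a) * simple_part s z)"

lemma residue_eq:
  assumes "E s = 0" "s \<noteq> z"
  shows "residue (\<lambda>w. F w / ((E w)\<^sup>2 * (w - z))) s = - (double_part s z + of_real (2 * a) * simple_part s z)"
proof -
  note ds = zeros_simple[OF assms(1)]
  have "F s * deriv (deriv E) s / ((deriv E s) ^ 3 * (z - s)) = - of_real (2 * a) * simple_part s z"
  proof (cases "s = 0")
    \<comment> \<open>A node at 0 occurs for B only. There E''(0) = 0, and the simple part vanishes
      by division by 0, so both sides are 0.\<close>
    case True
    then show ?thesis using second_0 assms by (simp add: simple_part_def)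
  next
    case False
    then show ?thesis
      unfolding second[OF assms(1) False] simple_part_def using ds assms
      by (simp add: field_simps power3_eq_cube power2_eq_square)
  qed
  then show ?thesis
    unfolding residue_at_double_pole[OF F_holo holo assms(1) ds assms(2)] double_part_def by simp
qed

lemma contour_integral_circle:
  assumes R: "0 < R" "\<And>w. norm w = R \<Longrightarrow> E w \<noteq> 0" and z: "norm z < R" "E z \<noteq> 0"
  shows "contour_integral (circlepath 0 R) (\<lambda>w. F w / ((E w)\<^sup>2 * (w - z))) =
    2 * pi * \<i> * remainder R z"
proof -
  let ?f = "\<lambda>w. F w / ((E w)\<^sup>2 * (w - z))"
  \<comment> \<open>The residue theorem requires an open set around the closed disc, here of radius
    R + 1; the additional zeros lie outside the circle and have winding number 0.\<close>
  define Z where "Z = {s. E s = 0 \<and> norm s \<le> R + 1}"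
  define Z1 where "Z1 = {s. E s = 0 \<and> norm s \<le> R}"
  have fin: "finite Z" "finite Z1" unfolding Z_def Z1_def by (rule finite_zeros)+
  have zZ: "z \<notin> Z" "z \<notin> Z1" using z by (auto simp: Z_def Z1_def)
  have sub: "Z1 \<subseteq> Z" by (auto simp: Z_def Z1_def)
  have hol: "?f holomorphic_on ball 0 (R + 1) - insert z Z"
    using holomorphic_on_subset[OF F_holo] holomorphic_on_subset[OF holo]
    by (intro holomorphic_intros) (auto simp: Z_def)
  have w1: "winding_number (circlepath 0 R) p = 1" if "norm p < R" for p
    using that by (intro winding_number_circlepath) auto
  have w0: "winding_number (circlepath 0 R) p = 0" if "R < norm p" for p
    by (rule winding_number_zero_outside[of _ "cball 0 R"]) (use that R in auto)
  have "contour_integral (circlepath 0 R) ?f =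
      2 * pi * \<i> * (\<Sum>p\<in>insert z Z. winding_number (circlepath 0 R) p * residue ?f p)"
  proof (rule Residue_theorem[OF _ _ _ hol])
    show "path_image (circlepath 0 R) \<subseteq> ball 0 (R + 1) - insert z Z"
      using R z by (auto simp: Z_def)
    show "\<forall>p. p \<notin> ball 0 (R + 1) \<longrightarrow> winding_number (circlepath 0 R) p = 0"
      using w0 by auto
  qed (use fin in auto)
  also have "(\<Sum>p\<in>insert z Z. winding_number (circlepath 0 R) p * residue ?f p) =
      winding_number (circlepath 0 R) z * residue ?f z + (\<Sum>p\<in>Z. winding_number (circlepath 0 R) p * residue ?f p)"
    using fin zZ by simp
  also have "winding_number (circlepath 0 R) z * residue ?f z = F z / (E z)\<^sup>2"
  proof -
    have "open {w. E w \<noteq> 0}"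
      by (intro open_Collect_neq holomorphic_on_imp_continuous_on[OF holo] continuous_on_const)
    moreover have "(\<lambda>w. F w / (E w)\<^sup>2) holomorphic_on {w. E w \<noteq> 0}"
      using holomorphic_on_subset[OF F_holo] holomorphic_on_subset[OF holo]
      by (intro holomorphic_intros) auto
    ultimately have "residue (\<lambda>w. F w / (E w)\<^sup>2 / (w - z)) z = F z / (E z)\<^sup>2"
      using z by (intro residue_simple) auto
    then show ?thesis using w1[OF z(1)] by (simp add: divide_divide_eq_left)
  qed
  also have "(\<Sum>p\<in>Z. winding_number (circlepath 0 R) p * residue ?f p) = (\<Sum>p\<in>Z1. residue ?f p)"
  proof (rule sum.mono_neutral_cong_right[OF fin(1) sub])
    show "\<forall>i\<in>Z - Z1. winding_number (circlepath 0 R) i * residue ?f i = 0"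
      using w0 by (auto simp: Z_def Z1_def not_le)
    show "winding_number (circlepath 0 R) x * residue ?f x = residue ?f x" if "x \<in> Z1" for x
    proof -
      have "norm x < R" using that R(2)[of x] by (auto simp: Z1_def less_le)
      then show ?thesis by (simp add: w1)
    qed
  qed
  also have "\<dots> = (\<Sum>p\<in>Z1. - (double_part p z + of_real (2 * a) * simple_part p z))"
    using zZ by (intro sum.cong residue_eq) (auto simp: Z1_def)
  finally show ?thesis by (simp only: remainder_def sum_negf Z1_def diff_conv_add_uminus)
qed

lemma decayD:
  assumes "0 < e"
  obtains X where "\<And>w. X \<le> norm w \<Longrightarrow> norm (F w) * norm w powr (2 * a) \<le> e * exp (2 * \<bar>Im w\<bar>)"
proof -
  have "\<forall>\<^sub>F w in at_infinity. norm (F w) * norm w powr (2 * a) * exp (- 2 * \<bar>Im w\<bar>) < e"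
    using decay assms by (rule order_tendstoD)
  then obtain X where X: "\<And>w. X \<le> norm w \<Longrightarrow> norm (F w) * norm w powr (2 * a) * exp (- 2 * \<bar>Im w\<bar>) < e"
    by (auto simp: eventually_at_infinity)
  have "norm (F w) * norm w powr (2 * a) \<le> e * exp (2 * \<bar>Im w\<bar>)" if "X \<le> norm w" for w
    using X[OF that] by (simp add: exp_minus field_simps)
  then show ?thesis using that by blast
qed

text \<open>On a good circle decay and lower bound give |F / E^2| <= e/2, and 2 |z| <= x gives |w -
  z| >= R/2. The integrand is thus at most e/R, which cancels the length of the circle, uniformly in
  z.\<close>

lemma circle_estimate:
  assumes e: "0 < e"
  shows "\<exists>X. \<forall>x\<ge>X. \<exists>R\<in>{x..x + 2}. \<forall>z. 2 * norm z \<le> x \<longrightarrow> E z \<noteq> 0 \<longrightarrow> norm (remainder R z) \<le> e"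
proof -
  obtain x0 c where c: "0 < c" and circ: "\<And>x. x0 \<le> x \<Longrightarrow> \<exists>R\<in>{x..x + 2}. \<forall>w. norm w = R \<longrightarrow>
                    c * exp (2 * \<bar>Im w\<bar>) \<le> norm w powr (2 * a) * (norm (E w))\<^sup>2"
    using circles by blast
  have "0 < e * c / 2" using e c by simp
  then obtain X where X: "\<And>w. X \<le> norm w \<Longrightarrow> norm (F w) * norm w powr (2 * a) \<le> e * c / 2 * exp (2 * \<bar>Im w\<bar>)"
    using decayD by blast
  show ?thesis
  proof (intro exI[of _ "Max {X, x0, 1}"] allI impI)
    fix x assume "Max {X, x0, 1} \<le> x"
    then have x: "X \<le> x" "x0 \<le> x" "1 \<le> x" by auto
    obtain R where R: "R \<in> {x..x + 2}" and low: "\<And>w. norm w = R \<Longrightarrow>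
                  c * exp (2 * \<bar>Im w\<bar>) \<le> norm w powr (2 * a) * (norm (E w))\<^sup>2"
      using circ[OF x(2)] by blast
    have R0: "0 < R" "X \<le> R" using R x by auto
    have nz: "E w \<noteq> 0" if "norm w = R" for w
      using low[OF that] mult_pos_pos[OF c exp_gt_zero[of "2 * \<bar>Im w\<bar>"]] by auto
    have "norm (remainder R z) \<le> e" if z: "2 * norm z \<le> x" "E z \<noteq> 0" for z
    proof -
      let ?f = "\<lambda>w. F w / ((E w)\<^sup>2 * (w - z))"
      have zR: "2 * norm z \<le> R" using z R by simp
      then have zR': "norm z < R" using R0 by (cases "z = 0") auto
      have ne: "w \<noteq> z" if "norm w = R" for w using that zR' by auto
      have "continuous_on (path_image (circlepath 0 R)) ?f"
        using nz ne R0 by (intro continuous_intros continuous_on_subset[OF holomorphic_on_imp_continuous_on[OF F_holo]]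
            continuous_on_subset[OF holomorphic_on_imp_continuous_on[OF holo]]) auto
      then have "?f contour_integrable_on circlepath 0 R"
        by (rule contour_integrable_continuous_circlepath)
      then have "(?f has_contour_integral contour_integral (circlepath 0 R) ?f) (circlepath 0 R)"
        by (rule has_contour_integral_integral)
      then have "norm (contour_integral (circlepath 0 R) ?f) \<le> e / R * (2 * pi * R)"
      proof (rule has_contour_integral_bound_circlepath)
        show "0 \<le> e / R" "0 < R" using e R0 by auto
        fix w :: complex assume "norm (w - 0) = R"
        then have w: "norm w = R" by simp
        have "norm (F w) * norm w powr (2 * a) \<le> e / 2 * (c * exp (2 * \<bar>Im w\<bar>))"
          using X[of w] w R0 by (simp add: mult.assoc)
        also have "\<dots> \<le> e / 2 * (norm w powr (2 * a) * (norm (E w))\<^sup>2)"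
          using low[OF w] e by (intro mult_left_mono) auto
        finally have "norm w powr (2 * a) * norm (F w) \<le> norm w powr (2 * a) * (e / 2 * (norm (E w))\<^sup>2)"
          by (simp only: mult_ac)
        then have "norm (F w) \<le> e / 2 * (norm (E w))\<^sup>2"
          by (rule mult_left_le_imp_le) (use w R0 in simp)
        then have 1: "norm (F w) / (norm (E w))\<^sup>2 \<le> e / 2"
          using nz[OF w] by (simp add: pos_divide_le_eq)
        have "R \<le> norm (w - z) + norm z" using norm_triangle_sub[of w z] w by simp
        then have "R / 2 \<le> norm (w - z)" using zR by simp
        then have 2: "1 / norm (w - z) \<le> 2 / R"
          using R0 ne[OF w] by (simp add: field_simps)
        have "norm (?f w) = norm (F w) / (norm (E w))\<^sup>2 * (1 / norm (w - z))"
          by (simp add: norm_divide norm_mult norm_power)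
        also have "\<dots> \<le> e / 2 * (2 / R)" using 1 2 e by (intro mult_mono) auto
        finally show "norm (?f w) \<le> e / R" by simp
      qed
      then have "2 * pi * norm (remainder R z) \<le> 2 * pi * e"
        using contour_integral_circle[OF R0(1) nz zR' z(2)] R0 by (simp add: norm_mult mult_ac)
      then show ?thesis by (rule mult_left_le_imp_le) simp
    qed
    then show "\<exists>R\<in>{x..x + 2}. \<forall>z. 2 * norm z \<le> x \<longrightarrow> E z \<noteq> 0 \<longrightarrow> norm (remainder R z) \<le> e"
      using R by blast
  qed
qed

text \<open>The zeros are real, so the exponential in the decay bound is 1 at a zero and the powers
  of |s| cancel against \<open>deriv_lower\<close>. The bound for F' comes from Cauchy's inequality
  on the unit circle about s, on which |Im w| <= 1; \<open>K\<close> collects the resulting exp 2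
  and the change of weight from |s| to |w|.\<close>

lemma zero_estimates:
  assumes e: "0 < e"
  shows "\<exists>X. \<forall>s. E s = 0 \<longrightarrow> X \<le> norm s \<longrightarrow>
       norm (F s) / (norm (deriv E s))\<^sup>2 \<le> e \<and> norm (deriv F s) / (norm (deriv E s))\<^sup>2 \<le> e"
proof -
  obtain x0 c where c: "0 < c" and low: "\<And>s. E s = 0 \<Longrightarrow> x0 \<le> norm s \<Longrightarrow> c \<le> norm s powr (2 * a) * (norm (deriv E s))\<^sup>2"
    using deriv_lower by blast
  define K where "K = 2 powr \<bar>2 * a\<bar> * exp 2"
  have K1: "1 \<le> K"
    unfolding K_def using mult_mono[of 1 "2 powr \<bar>2 * a\<bar>" 1 "exp 2"] by (simp add: ge_one_powr_ge_zero)
  define b where "b = e * c / K"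
  have b: "0 < b" "K * b = e * c" using e c K1 by (auto simp: b_def)
  obtain X where X: "\<And>w. X \<le> norm w \<Longrightarrow> norm (F w) * norm w powr (2 * a) \<le> b * exp (2 * \<bar>Im w\<bar>)"
    using decayD[OF b(1)] by blast
  have conv: "y / (norm (deriv E s))\<^sup>2 \<le> e"
    if s: "E s = 0" "x0 \<le> norm s" "0 < norm s" and y: "y * norm s powr (2 * a) \<le> K * b" for y s
  proof -
    have d0: "0 < (norm (deriv E s))\<^sup>2" using zeros_simple[OF s(1)] by simp
    have "y * norm s powr (2 * a) \<le> e * c" using y b by simp
    also have "\<dots> \<le> e * (norm s powr (2 * a) * (norm (deriv E s))\<^sup>2)"
      using low[OF s(1,2)] e by (intro mult_left_mono) auto
    finally have "norm s powr (2 * a) * y \<le> norm s powr (2 * a) * (e * (norm (deriv E s))\<^sup>2)"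
      by (simp only: mult_ac)
    moreover have "0 < norm s powr (2 * a)" using s by simp
    ultimately have "y \<le> e * (norm (deriv E s))\<^sup>2" by (rule mult_left_le_imp_le)
    then show ?thesis using d0 by (simp only: pos_divide_le_eq)
  qed
  show ?thesis
  proof (intro exI[of _ "Max {X + 1, x0, 2}"] allI impI conjI)
    fix s assume s: "E s = 0" and "Max {X + 1, x0, 2} \<le> norm s"
    then have sX: "X + 1 \<le> norm s" "x0 \<le> norm s" "2 \<le> norm s" by auto
    have Ims: "Im s = 0" using zeros_real[OF s] by (simp add: complex_is_Real_iff)
    have "norm (F s) * norm s powr (2 * a) \<le> 1 * b" using X[of s] sX Ims by simp
    also have "\<dots> \<le> K * b" using K1 b by (intro mult_right_mono) auto
    finally show "norm (F s) / (norm (deriv E s))\<^sup>2 \<le> e" using s sX by (intro conv) auto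
    have pos: "0 < norm s powr (2 * a)" using sX by (simp del: norm_le_zero_iff) auto
    have "norm ((deriv ^^ 1) F s) \<le> fact 1 * (K * b / norm s powr (2 * a)) / 1 ^ 1"
    proof (rule Cauchy_inequality)
      show "F holomorphic_on ball s 1" by (rule holomorphic_on_subset[OF F_holo]) simp
      show "continuous_on (cball s 1) F"
        by (rule continuous_on_subset[OF holomorphic_on_imp_continuous_on[OF F_holo]]) simp
      fix w assume w: "norm (s - w) = 1"
      have l: "norm s \<le> norm w + 1" "norm w \<le> norm s + 1"
        using norm_triangle_sub[of s w] norm_triangle_sub[of w s] w by (auto simp: norm_minus_commute)
      have "\<bar>Im w\<bar> \<le> 1" using abs_Im_le_cmod[of "s - w"] w Ims by simp
      then have "exp (2 * \<bar>Im w\<bar>) \<le> exp 2" by simp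
      then have "b * exp (2 * \<bar>Im w\<bar>) \<le> b * exp 2" using b by (intro mult_left_mono) auto
      moreover have "X \<le> norm w" using l sX by linarith
      ultimately have w1: "norm (F w) * norm w powr (2 * a) \<le> b * exp 2"
        using X order_trans by blast
      have "norm s powr (2 * a) \<le> 2 powr \<bar>2 * a\<bar> * norm w powr (2 * a)"
      proof (cases "norm s \<le> norm w")
        case True
        then show ?thesis using l sX by (intro powr_comparable(2)) auto
      next
        case False
        then show ?thesis using l sX by (intro powr_comparable(1)) auto
      qed
      then have "norm (F w) * norm s powr (2 * a) \<le> norm (F w) * (2 powr \<bar>2 * a\<bar> * norm w powr (2 * a))"
        by (intro mult_left_mono) auto
      also have "\<dots> = 2 powr \<bar>2 * a\<bar> * (norm (F w) * norm w powr (2 * a))" by (simp only: mult_ac)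
      also have "\<dots> \<le> 2 powr \<bar>2 * a\<bar> * (b * exp 2)" using w1 by (intro mult_left_mono) auto
      also have "\<dots> = K * b" by (simp add: K_def)
      finally show "norm (F w) \<le> K * b / norm s powr (2 * a)"
        using pos by (simp add: pos_le_divide_eq)
    qed simp
    then have "norm (deriv F s) * norm s powr (2 * a) \<le> K * b"
      using pos by (simp add: pos_le_divide_eq)
    then show "norm (deriv F s) / (norm (deriv E s))\<^sup>2 \<le> e" using s sX by (intro conv) auto
  qed
qed

text \<open>The quadratic decay makes the second series absolutely summable; the two plain bounds
  are for the boundedly many terms in an annulus. For the double part nothing summable is
  obtained.\<close>

lemma norm_parts_le:
  assumes z: "2 * norm z \<le> norm s" "2 \<le> norm s"
    and F: "norm (F s) / (norm (deriv E s))\<^sup>2 \<le> B" and F': "norm (deriv F s) / (norm (deriv E s))\<^sup>2 \<le> B"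
  shows "norm (double_part s z) \<le> 2 * B" "norm (simple_part s z) \<le> 2 * B / (norm s)\<^sup>2" "norm (simple_part s z) \<le> B"
proof -
  have B0: "0 \<le> B" using F by (meson divide_nonneg_nonneg norm_ge_zero order_trans zero_le_power2)
  have "norm s \<le> norm (z - s) + norm z" using norm_triangle_sub[of s z] by (simp add: norm_minus_commute)
  then have zs: "norm s / 2 \<le> norm (z - s)" using z by simp
  then have zs1: "1 \<le> norm (z - s)" using z by simp
  have "norm (F s / ((deriv E s)\<^sup>2 * (z - s)\<^sup>2)) = norm (F s) / (norm (deriv E s))\<^sup>2 / (norm (z - s))\<^sup>2"
    by (simp add: norm_divide norm_mult norm_power)
  also have "\<dots> \<le> B / 1" using F B0 zs1 by (intro frac_le) auto
  finally have 1: "norm (F s / ((deriv E s)\<^sup>2 * (z - s)\<^sup>2)) \<le> B" by simp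
  have "norm (deriv F s / ((deriv E s)\<^sup>2 * (z - s))) = norm (deriv F s) / (norm (deriv E s))\<^sup>2 / norm (z - s)"
    by (simp add: norm_divide norm_mult norm_power)
  also have "\<dots> \<le> B / 1" using F' B0 zs1 by (intro frac_le) auto
  finally have 2: "norm (deriv F s / ((deriv E s)\<^sup>2 * (z - s))) \<le> B" by simp
  show "norm (double_part s z) \<le> 2 * B"
    unfolding double_part_def using norm_triangle_le[OF add_mono[OF 1 2]] by simp
  have "norm (simple_part s z) = norm (F s) / (norm (deriv E s))\<^sup>2 / (norm s * norm (z - s))"
    by (simp add: simple_part_def norm_divide norm_mult norm_power mult_ac)
  also have "\<dots> \<le> B / (norm s * (norm s / 2))"
    using F B0 zs z by (intro frac_le mult_left_mono mult_pos_pos) auto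
  also have "\<dots> = 2 * B / (norm s)\<^sup>2" by (simp add: power2_eq_square)
  finally show 3: "norm (simple_part s z) \<le> 2 * B / (norm s)\<^sup>2" .
  have "2 \<le> (norm s)\<^sup>2" using power_mono[OF z(2), of 2] by simp
  then have "2 * B / (norm s)\<^sup>2 \<le> 2 * B / 2" using B0 by (intro divide_left_mono) auto
  then show "norm (simple_part s z) \<le> B" using 3 by simp
qed

lemma uniform_limit_total:
  assumes K: "compact K" "K \<inter> {s. E s = 0} = {}"
  shows "uniform_limit K (\<lambda>R z. \<Sum>s\<in>{s. E s = 0 \<and> norm s \<le> R}. double_part s z + of_real (2 * a) * simple_part s z)
     (\<lambda>z. F z / (E z)\<^sup>2) at_top"
proof (rule uniform_limitI)
  fix e :: real assume e: "0 < e"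
  define t where "t s z = double_part s z + of_real (2 * a) * simple_part s z" for s z
  define Z where "Z R = {s. E s = 0 \<and> norm s \<le> R}" for R
  obtain M where M: "\<And>z. z \<in> K \<Longrightarrow> norm z \<le> M"
    using compact_imp_bounded[OF K(1)] unfolding bounded_iff by blast
  obtain x1 N where N: "\<And>R. x1 \<le> R \<Longrightarrow> real (card {s. E s = 0 \<and> R < norm s \<and> norm s \<le> R + 2}) \<le> N"
    using card_zeros_le by blast
  \<comment> \<open>One share for the remainder on a good circle, and for each of at most N zeros in
    the annulus the bound 2 + |2a| of its term. Halving in \<open>b\<close> makes the final
    inequality strict.\<close>
  define D where "D = 1 + \<bar>N\<bar> * (2 + \<bar>2 * a\<bar>)"
  have D: "0 < D" unfolding D_def by (simp add: add_pos_nonneg)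
  define b where "b = e / (2 * D)"
  have b: "0 < b" using e D by (simp add: b_def)
  obtain X1 where X1: "\<And>x. X1 \<le> x \<Longrightarrow> \<exists>R\<in>{x..x + 2}. \<forall>z. 2 * norm z \<le> x \<longrightarrow> E z \<noteq> 0 \<longrightarrow> norm (remainder R z) \<le> b"
    using circle_estimate[OF b] by blast
  obtain X2 where X2: "\<And>s. E s = 0 \<Longrightarrow> X2 \<le> norm s \<Longrightarrow>
       norm (F s) / (norm (deriv E s))\<^sup>2 \<le> b \<and> norm (deriv F s) / (norm (deriv E s))\<^sup>2 \<le> b"
    using zero_estimates[OF b] by blast
  define X where "X = Max {X1, X2, x1, 2 * M, 2}"
  have X: "X1 \<le> X" "X2 \<le> X" "x1 \<le> X" "2 * M \<le> X" "2 \<le> X" by (auto simp: X_def)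
  have main: "dist (\<Sum>s\<in>Z x. t s z) (F z / (E z)\<^sup>2) < e" if x: "X \<le> x" and z: "z \<in> K" for x z
  proof -
    have zM: "2 * norm z \<le> x" using M[OF z] X x by simp
    have Ez: "E z \<noteq> 0" using K(2) z by auto
    \<comment> \<open>A good radius within 2 above the arbitrary x; the two partial sums differ by
      the zeros in the annulus \<open>W\<close>.\<close>
    obtain R where R: "R \<in> {x..x + 2}" and Rz: "norm (F z / (E z)\<^sup>2 - (\<Sum>s\<in>Z R. t s z)) \<le> b"
      using X1[of x] X x zM Ez unfolding Z_def t_def remainder_def by force
    define W where "W = {s. E s = 0 \<and> x < norm s \<and> norm s \<le> x + 2}"
    have finW: "finite W" unfolding W_def by (rule rev_finite_subset[OF finite_zeros[of "x + 2"]]) auto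
    have tb: "norm (t s z) \<le> (2 + \<bar>2 * a\<bar>) * b" if "s \<in> W" for s
    proof -
      have s: "E s = 0" "x < norm s" using that by (auto simp: W_def)
      have fb: "norm (F s) / (norm (deriv E s))\<^sup>2 \<le> b" "norm (deriv F s) / (norm (deriv E s))\<^sup>2 \<le> b"
        using X2[OF s(1)] s X x by auto
      have zs: "2 * norm z \<le> norm s" "2 \<le> norm s" using zM s X x by auto
      note p = norm_parts_le[OF zs fb]
      have "norm (t s z) \<le> norm (double_part s z) + \<bar>2 * a\<bar> * norm (simple_part s z)"
        unfolding t_def using norm_triangle_ineq[of "double_part s z" "of_real (2 * a) * simple_part s z"]
        by (simp add: norm_mult)
      also have "\<dots> \<le> 2 * b + \<bar>2 * a\<bar> * b"
        using p by (intro add_mono mult_left_mono) auto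
      finally show ?thesis by (simp add: algebra_simps)
    qed
    have "norm ((\<Sum>s\<in>Z R. t s z) - (\<Sum>s\<in>Z x. t s z)) = norm (\<Sum>s\<in>Z R - Z x. t s z)"
      using R finite_zeros unfolding Z_def by (subst sum_diff) auto
    also have "\<dots> \<le> (\<Sum>s\<in>Z R - Z x. norm (t s z))" by (rule norm_sum)
    also have "\<dots> \<le> (\<Sum>s\<in>W. norm (t s z))"
      using R finW by (intro sum_mono2) (auto simp: Z_def W_def)
    also have "\<dots> \<le> real (card W) * ((2 + \<bar>2 * a\<bar>) * b)"
      by (rule sum_bounded_above[OF tb])
    also have "\<dots> \<le> \<bar>N\<bar> * ((2 + \<bar>2 * a\<bar>) * b)"
      using N[of x] X x b by (intro mult_right_mono) (auto simp: W_def)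
    finally have d: "norm ((\<Sum>s\<in>Z R. t s z) - (\<Sum>s\<in>Z x. t s z)) \<le> \<bar>N\<bar> * ((2 + \<bar>2 * a\<bar>) * b)" .
    have "dist (\<Sum>s\<in>Z x. t s z) (F z / (E z)\<^sup>2) = norm ((F z / (E z)\<^sup>2 - (\<Sum>s\<in>Z R. t s z)) + ((\<Sum>s\<in>Z R. t s z) - (\<Sum>s\<in>Z x. t s z)))"
      by (simp add: dist_norm norm_minus_commute)
    also have "\<dots> \<le> b + \<bar>N\<bar> * ((2 + \<bar>2 * a\<bar>) * b)"
      by (rule norm_triangle_mono[OF Rz d])
    also have "\<dots> = D * b" by (simp add: D_def algebra_simps)
    also have "\<dots> < e" using D e by (simp add: b_def)
    finally show ?thesis .
  qed
  show "\<forall>\<^sub>F R in at_top. \<forall>z\<in>K. dist (\<Sum>s\<in>{s. E s = 0 \<and> norm s \<le> R}. double_part s z + of_real (2 * a) * simple_part s z) (F z / (E z)\<^sup>2) < e"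
    using eventually_ge_at_top[of X] by eventually_elim (use main in \<open>auto simp: Z_def t_def\<close>)
qed

lemma uniform_limit_simple_part:
  assumes K: "compact K" "K \<inter> {s. E s = 0} = {}"
  shows "uniform_limit K (\<lambda>R z. \<Sum>s\<in>{s. E s = 0 \<and> s \<noteq> 0 \<and> norm s \<le> R}. simple_part s z)
     (\<lambda>z. \<Sum>\<^sub>\<infinity>s\<in>{s. E s = 0 \<and> s \<noteq> 0}. simple_part s z) at_top"
proof -
  let ?Z = "{s. E s = 0 \<and> s \<noteq> 0}"
  obtain M where M: "\<And>z. z \<in> K \<Longrightarrow> norm z \<le> M"
    using compact_imp_bounded[OF K(1)] unfolding bounded_iff by blast
  obtain X1 where X1: "\<And>s. E s = 0 \<Longrightarrow> X1 \<le> norm s \<Longrightarrow>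
       norm (F s) / (norm (deriv E s))\<^sup>2 \<le> 1 \<and> norm (deriv F s) / (norm (deriv E s))\<^sup>2 \<le> 1"
    using zero_estimates[of 1] by auto
  obtain x2 where x2: "(\<lambda>s. 1 / (norm s)\<^sup>2) summable_on {s. E s = 0 \<and> x2 \<le> norm s}"
    using summable_zeros by blast
  define X where "X = Max {X1, x2, 2 * M, 2}"
  have X: "X1 \<le> X" "x2 \<le> X" "2 * M \<le> X" "2 \<le> X" by (auto simp: X_def)
  have "\<exists>b. \<forall>z\<in>K. norm (simple_part s z) \<le> b" if s: "E s = 0" for s
  proof -
    have "continuous_on K (simple_part s)"
    proof (cases "F s / (s * (deriv E s)\<^sup>2) = 0")
      case True
      then have "simple_part s = (\<lambda>z. 0)" by (auto simp: simple_part_def)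
      then show ?thesis by simp
    next
      case False
      then show ?thesis unfolding simple_part_def[abs_def] using K(2) s
        by (intro continuous_intros) auto
    qed
    then have "bounded (simple_part s ` K)" using K(1) by (intro compact_imp_bounded compact_continuous_image)
    then show ?thesis by (auto simp: bounded_iff)
  qed
  then obtain b where b: "\<And>s z. E s = 0 \<Longrightarrow> z \<in> K \<Longrightarrow> norm (simple_part s z) \<le> b s" by metis
  \<comment> \<open>Far zeros use the quadratic bound; for the finitely many others a bound over the
    compact set \<open>K\<close> is taken.\<close>
  define m where "m s = (if X \<le> norm s then 2 * (1 / (norm s)\<^sup>2) else b s)" for s
  have "m summable_on {s \<in> ?Z. X \<le> norm s}"
  proof -
    have "(\<lambda>s. 1 / (norm s)\<^sup>2) summable_on {s \<in> ?Z. X \<le> norm s}"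
      by (rule summable_on_subset_banach[OF x2]) (use X in auto)
    then have "(\<lambda>s. 2 * (1 / (norm s)\<^sup>2)) summable_on {s \<in> ?Z. X \<le> norm s}"
      by (rule summable_on_cmult_right)
    then show ?thesis by (rule summable_on_cong[THEN iffD1, rotated]) (auto simp: m_def)
  qed
  moreover have "m summable_on {s \<in> ?Z. norm s < X}"
    by (rule summable_on_finite, rule rev_finite_subset[OF finite_zeros[of X]]) auto
  ultimately have "m summable_on {s \<in> ?Z. X \<le> norm s} \<union> {s \<in> ?Z. norm s < X}"
    by (rule summable_on_Un_disjoint) auto
  moreover have "{s \<in> ?Z. X \<le> norm s} \<union> {s \<in> ?Z. norm s < X} = ?Z" by auto
  ultimately have sm: "m summable_on ?Z" by simp
  have "uniform_limit K (\<lambda>Y z. \<Sum>s\<in>Y. simple_part s z) (\<lambda>z. \<Sum>\<^sub>\<infinity>s\<in>?Z. simple_part s z) (finite_subsets_at_top ?Z)"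
  proof (rule Weierstrass_m_test_general[OF _ sm])
    fix s z assume s: "s \<in> ?Z" and z: "z \<in> K"
    show "norm (simple_part s z) \<le> m s"
    proof (cases "X \<le> norm s")
      case True
      have "2 * norm z \<le> norm s" "2 \<le> norm s" using M[OF z] X True by auto
      moreover have "norm (F s) / (norm (deriv E s))\<^sup>2 \<le> 1" "norm (deriv F s) / (norm (deriv E s))\<^sup>2 \<le> 1"
        using X1[of s] s X True by auto
      ultimately have "norm (simple_part s z) \<le> 2 * 1 / (norm s)\<^sup>2" by (rule norm_parts_le(2))
      then show ?thesis using True by (simp add: m_def)
    next
      case False
      then show ?thesis using b[of s z] s z by (simp add: m_def)
    qed
  qed
  \<comment> \<open>Passes from the unordered sum to the order of increasing |s|, since the sets of
    zeros with norm at most R eventually contain every finite set of nodes.\<close>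
  moreover have "filterlim (\<lambda>R. {s. E s = 0 \<and> s \<noteq> 0 \<and> norm s \<le> R}) (finite_subsets_at_top ?Z) at_top"
    unfolding filterlim_finite_subsets_at_top
  proof (intro allI impI)
    fix Y assume Y: "finite Y \<and> Y \<subseteq> ?Z"
    then obtain r where r: "\<And>s. s \<in> Y \<Longrightarrow> norm s \<le> r"
      using finite_imp_bounded[of Y] by (auto simp: bounded_iff)
    show "\<forall>\<^sub>F R in at_top. finite {s. E s = 0 \<and> s \<noteq> 0 \<and> norm s \<le> R} \<and>
        Y \<subseteq> {s. E s = 0 \<and> s \<noteq> 0 \<and> norm s \<le> R} \<and> {s. E s = 0 \<and> s \<noteq> 0 \<and> norm s \<le> R} \<subseteq> ?Z"
      using eventually_ge_at_top[of r]
    proof eventually_elim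
      case (elim R)
      have "finite {s. E s = 0 \<and> s \<noteq> 0 \<and> norm s \<le> R}"
        by (rule rev_finite_subset[OF finite_zeros[of R]]) auto
      moreover have "norm s \<le> R" if "s \<in> Y" for s using r[OF that] elim by simp
      ultimately show ?case using Y by auto
    qed
  qed
  ultimately show ?thesis by (rule filterlim_compose)
qed

theorem interpolation_formula:
  "\<exists>S1 S2.
    (\<forall>K. compact K \<and> K \<inter> {s. E s = 0} = {} \<longrightarrow>
       uniform_limit K (\<lambda>R z. \<Sum>s\<in>{s. E s = 0 \<and> norm s \<le> R}.
          F s / ((deriv E s)\<^sup>2 * (z - s)\<^sup>2) + deriv F s / ((deriv E s)\<^sup>2 * (z - s))) S1 at_top \<and>
       uniform_limit K (\<lambda>R z. \<Sum>s\<in>{s. E s = 0 \<and> s \<noteq> 0 \<and> norm s \<le> R}.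
          F s / (s * (deriv E s)\<^sup>2 * (z - s))) S2 at_top) \<and>
    (\<forall>z. E z \<noteq> 0 \<longrightarrow> F z / (E z)\<^sup>2 = S1 z + of_real (2 * a) * S2 z)"
proof -
  define S2 where "S2 z = (\<Sum>\<^sub>\<infinity>s\<in>{s. E s = 0 \<and> s \<noteq> 0}. simple_part s z)" for z
  \<comment> \<open>Defined so that the identity holds outright; its being the limit of the first
    series is then the difference of the combined limit and the second one.\<close>
  define S1 where "S1 z = F z / (E z)\<^sup>2 - of_real (2 * a) * S2 z" for z
  have "uniform_limit K (\<lambda>R z. \<Sum>s\<in>{s. E s = 0 \<and> norm s \<le> R}. double_part s z) S1 at_top \<and>
     uniform_limit K (\<lambda>R z. \<Sum>s\<in>{s. E s = 0 \<and> s \<noteq> 0 \<and> norm s \<le> R}. simple_part s z) S2 at_top"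
    if K: "compact K" "K \<inter> {s. E s = 0} = {}" for K
  proof
    show u2: "uniform_limit K (\<lambda>R z. \<Sum>s\<in>{s. E s = 0 \<and> s \<noteq> 0 \<and> norm s \<le> R}. simple_part s z) S2 at_top"
      unfolding S2_def[abs_def] by (rule uniform_limit_simple_part[OF K])
    have eq: "(\<Sum>s\<in>{s. E s = 0 \<and> norm s \<le> R}. double_part s z) =
        (\<Sum>s\<in>{s. E s = 0 \<and> norm s \<le> R}. double_part s z + of_real (2 * a) * simple_part s z)
        - of_real (2 * a) * (\<Sum>s\<in>{s. E s = 0 \<and> s \<noteq> 0 \<and> norm s \<le> R}. simple_part s z)" for R z
    proof -
      have "(\<Sum>s\<in>{s. E s = 0 \<and> s \<noteq> 0 \<and> norm s \<le> R}. simple_part s z) = (\<Sum>s\<in>{s. E s = 0 \<and> norm s \<le> R}. simple_part s z)"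
        by (rule sum.mono_neutral_left[OF finite_zeros]) (auto simp: simple_part_def)
      then show ?thesis by (simp add: sum.distrib sum_distrib_left)
    qed
    show "uniform_limit K (\<lambda>R z. \<Sum>s\<in>{s. E s = 0 \<and> norm s \<le> R}. double_part s z) S1 at_top"
      unfolding eq S1_def[abs_def]
      by (intro uniform_limit_minus uniform_limit_total[OF K]
          bounded_linear.uniform_limit[OF bounded_linear_mult_right] u2)
  qed
  moreover have "F z / (E z)\<^sup>2 = S1 z + of_real (2 * a) * S2 z" for z by (simp add: S1_def)
  ultimately show ?thesis unfolding double_part_def simple_part_def by blast
qed

end

theorem theorem13:
  fixes p nu :: real and F :: "complex \<Rightarrow> complex"
  assumes "0 < p" and "nu > -1"
    and "F holomorphic_on UNIV"
    and "exp_type_le F 2"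
    and "(\<integral>\<^sup>+ t. ennreal (indicator {t. 1 \<le> \<bar>t\<bar>} t *
            norm (F (of_real t) * of_real (\<bar>t\<bar> powr (2*nu+1))) powr p) \<partial>lborel) < \<infinity>"
  shows
   "(\<exists>S1 S2.
      (\<forall>K. compact K \<and> K \<inter> {s. Abes nu s = 0} = {} \<longrightarrow>
         uniform_limit K
           (\<lambda>R z. \<Sum>s\<in>{s. Abes nu s = 0 \<and> norm s \<le> R}.
              F s / ((deriv (Abes nu) s)^2 * (z - s)^2)
              + deriv F s / ((deriv (Abes nu) s)^2 * (z - s)))
           S1 at_top \<and>
         uniform_limit K
           (\<lambda>R z. \<Sum>s\<in>{s. Abes nu s = 0 \<and> norm s \<le> R}.
              F s / (s * (deriv (Abes nu) s)^2 * (z - s)))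
           S2 at_top) \<and>
      (\<forall>z. Abes nu z \<noteq> 0 \<longrightarrow>
         F z / (Abes nu z)^2 = S1 z + of_real (2*nu+1) * S2 z))
    \<and>
    (\<exists>T1 T2.
      (\<forall>K. compact K \<and> K \<inter> {t. Bbes nu t = 0} = {} \<longrightarrow>
         uniform_limit K
           (\<lambda>R z. \<Sum>t\<in>{t. Bbes nu t = 0 \<and> norm t \<le> R}.
              F t / ((deriv (Bbes nu) t)^2 * (z - t)^2)
              + deriv F t / ((deriv (Bbes nu) t)^2 * (z - t)))
           T1 at_top \<and>
         uniform_limit K
           (\<lambda>R z. \<Sum>t\<in>{t. Bbes nu t = 0 \<and> t \<noteq> 0 \<and> norm t \<le> R}.
              F t / (t * (deriv (Bbes nu) t)^2 * (z - t)))
           T2 at_top) \<and>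
      (\<forall>z. Bbes nu z \<noteq> 0 \<longrightarrow>
         F z / (Bbes nu z)^2 = T1 z + of_real (2*nu+1) * T2 z))"
proof -
  have two: "2 * (nu + 1 / 2) = 2 * nu + 1" by simp
  note decay = exponential_type_decay[OF assms(3,4,1,5)]
  interpret A: interpolation_pair "nu + 1 / 2" "Abes nu" F
    by (intro interpolation_pair.intro interpolation_pair_axioms.intro interpolation_function_Abes assms)
       (unfold two, rule decay)
  interpret B: interpolation_pair "nu + 1 / 2" "Bbes nu" F
    by (intro interpolation_pair.intro interpolation_pair_axioms.intro interpolation_function_Bbes assms)
       (unfold two, rule decay)
  \<comment> \<open>A(0) = 1, so 0 is not a node and the exclusion of 0 in the second sum is vacuous
    for A.\<close>
  have nz: "{s. Abes nu s = 0 \<and> s \<noteq> 0 \<and> norm s \<le> R} = {s. Abes nu s = 0 \<and> norm s \<le> R}" for R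
    by (auto simp: Abes_0)
  show ?thesis
    by (rule conjI[OF A.interpolation_formula[unfolded two nz] B.interpolation_formula[unfolded two]])
qed

end
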